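(* Let $\mathfrak e$ be a finite gap set and let $J$ be a bounded half-line Jacobi matrix in the Nevai class for $\mathfrak e$. Then $\sup_{x_0\in\sigma(J)}p_n(x_0)^2/K_n(x_0,x_0)\to0$ as $n\to\infty$; i.e. the Nevai condition holds for $J$ uniformly on $\sigma(J)$.
   Context: A finite gap set is $\mathfrak e=\bigcup_{j=1}^{\ell+1}[\alpha_j,\beta_j]$ with $\alpha_1<\beta_1<\alpha_2<\beta_2<\cdots<\alpha_{\ell+1}<\beta_{\ell+1}$. Its isospectral torus $\mathcal T_{\mathfrak e}$ is the set of bounded two-sided Jacobi matrices $J'$ (on $\ell^2(\mathbb{Z})$, with $J'_{nn}=b'_n$, $J'_{n,n+1}=J'_{n+1,n}=a'_n>0$) with $\sigma(J')=\mathfrak e$ that are reflectionless on $\mathfrak e$, i.e. for every $n\in\mathbb{Z}$, $\operatorname{Re}\langle\delta_n,(J'-x-i0)^{-1}\delta_n\rangle=0$ for Lebesgue a.e. $x\in\mathfrak e$. A half-line Jacobi matrix $J$ (on $\ell^2(\{1,2,\dots\})$, $J_{nn}=b_n$, $J_{n,n+1}=J_{n+1,n}=a_n>0$) is in the Nevai class for $\mathfrak e$ if all its right limits lie in $\mathcal T_{\mathfrak e}$, where a right limit is a two-sided Jacobi matrix with parameters $a^{(r)}_n=\lim_j a_{m_j+n}$, $b^{(r)}_n=\lim_jb_{m_j+n}$ ($n\in\mathbb{Z}$) for some $m_j\to\infty$. $\rho$ is the spectral measure of $J$ for $\delta_1$, $p_n$ its orthonormal polynomials ($p_{-1}=0$,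 $p_0=1$, $xp_n=a_{n+1}p_{n+1}+b_{n+1}p_n+a_np_{n-1}$), $K_n(x,y)=\sum_{j=0}^np_j(x)p_j(y)$; the Nevai condition at $x_0$ means $K_n(x,x_0)^2d\rho(x)/K_n(x_0,x_0)\to\delta_{x_0}$ weakly. *)

theory Defs
  imports "HOL-Analysis.Analysis"
begin

definition finite_gap_set :: "real set \<Rightarrow> bool" where
  "finite_gap_set e \<longleftrightarrow>
     (\<exists>(l::nat) (\<alpha>::nat \<Rightarrow> real) (\<beta>::nat \<Rightarrow> real).
        (\<forall>j\<le>l. \<alpha> j < \<beta> j) \<and> (\<forall>j<l. \<beta> j < \<alpha> (Suc j)) \<and>
        e = (\<Union>j\<le>l. {\<alpha> j..\<beta> j}))"

definition l2 :: "('i \<Rightarrow> complex) set" where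
  "l2 = {u. (\<lambda>i. (norm (u i))\<^sup>2) summable_on UNIV}"

definition jac2 :: "(int \<Rightarrow> real) \<Rightarrow> (int \<Rightarrow> real) \<Rightarrow> (int \<Rightarrow> complex) \<Rightarrow> int \<Rightarrow> complex" where
  "jac2 a b u n = of_real (a (n - 1)) * u (n - 1) + of_real (b n) * u n + of_real (a n) * u (n + 1)"

definition spectrum2 :: "(int \<Rightarrow> real) \<Rightarrow> (int \<Rightarrow> real) \<Rightarrow> complex set" where
  "spectrum2 a b = {z. \<not> bij_betw (\<lambda>u n. jac2 a b u n - z * u n) l2 l2}"

definition green2 :: "(int \<Rightarrow> real) \<Rightarrow> (int \<Rightarrow> real) \<Rightarrow> int \<Rightarrow> complex \<Rightarrow> complex" where
  "green2 a b n z =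
     (THE u. u \<in> l2 \<and> (\<forall>k. jac2 a b u k - z * u k = (if k = n then 1 else 0))) n"

definition reflectionless :: "real set \<Rightarrow> (int \<Rightarrow> real) \<Rightarrow> (int \<Rightarrow> real) \<Rightarrow> bool" where
  "reflectionless e a b \<longleftrightarrow>
     (\<forall>n. AE x in lborel. x \<in> e \<longrightarrow>
        (\<exists>L. ((\<lambda>\<epsilon>. green2 a b n (complex_of_real x + \<i> * complex_of_real \<epsilon>)) \<longlongrightarrow> L)
                 (at_right 0) \<and> Re L = 0))"

definition isospectral_torus :: "real set \<Rightarrow> ((int \<Rightarrow> real) \<times> (int \<Rightarrow> real)) set" where
  "isospectral_torus e =
     {(a, b). (\<forall>n. a n > 0) \<and> bounded (range a) \<and> bounded (range b) \<and>
              spectrum2 a b = complex_of_real ` e \<and> reflectionless e a b}"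

text \<open>Parameters a n, b n for n \<ge> 1 (values at index 0 are irrelevant).
  The Hilbert space l2({1,2,...}) is represented by l2 sequences on nat vanishing at 0.\<close>
definition l2_half :: "(nat \<Rightarrow> complex) set" where
  "l2_half = {u. u \<in> l2 \<and> u 0 = 0}"

definition jac_half :: "(nat \<Rightarrow> real) \<Rightarrow> (nat \<Rightarrow> real) \<Rightarrow> (nat \<Rightarrow> complex) \<Rightarrow> nat \<Rightarrow> complex" where
  "jac_half a b u n = (if n = 0 then 0 else
     of_real (a (n - 1)) * u (n - 1) + of_real (b n) * u n + of_real (a n) * u (n + 1))"

definition spectrum_half :: "(nat \<Rightarrow> real) \<Rightarrow> (nat \<Rightarrow> real) \<Rightarrow> complex set" where
  "spectrum_half a b = {z. \<not> bij_betw (\<lambda>u n. jac_half a b u n - z * u n) l2_half l2_half}"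

definition right_limit :: "(nat \<Rightarrow> real) \<Rightarrow> (nat \<Rightarrow> real) \<Rightarrow> (int \<Rightarrow> real) \<Rightarrow> (int \<Rightarrow> real) \<Rightarrow> bool" where
  "right_limit a b ar br \<longleftrightarrow>
     (\<exists>m::nat \<Rightarrow> nat. filterlim m at_top sequentially \<and>
        (\<forall>n::int. (\<lambda>j. a (nat (int (m j) + n))) \<longlonglongrightarrow> ar n) \<and>
        (\<forall>n::int. (\<lambda>j. b (nat (int (m j) + n))) \<longlonglongrightarrow> br n))"

definition nevai_class :: "real set \<Rightarrow> (nat \<Rightarrow> real) \<Rightarrow> (nat \<Rightarrow> real) \<Rightarrow> bool" where
  "nevai_class e a b \<longleftrightarrow>
     (\<forall>ar br. right_limit a b ar br \<longrightarrow> (ar, br) \<in> isospectral_torus e)"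

text \<open>opp a b n x = (p_{n-1}(x), p_n(x)), with p_{-1} = 0, p_0 = 1 and
  x p_n = a_{n+1} p_{n+1} + b_{n+1} p_n + a_n p_{n-1}.\<close>
fun opp :: "(nat \<Rightarrow> real) \<Rightarrow> (nat \<Rightarrow> real) \<Rightarrow> nat \<Rightarrow> real \<Rightarrow> real \<times> real" where
  "opp a b 0 x = (0, 1)"
| "opp a b (Suc n) x =
     (snd (opp a b n x),
      ((x - b (Suc n)) * snd (opp a b n x) - a n * fst (opp a b n x)) / a (Suc n))"

definition opoly :: "(nat \<Rightarrow> real) \<Rightarrow> (nat \<Rightarrow> real) \<Rightarrow> nat \<Rightarrow> real \<Rightarrow> real" where
  "opoly a b n x = snd (opp a b n x)"

definition CD_kernel :: "(nat \<Rightarrow> real) \<Rightarrow> (nat \<Rightarrow> real) \<Rightarrow> nat \<Rightarrow> real \<Rightarrow> real \<Rightarrow> real" where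
  "CD_kernel a b n x y = (\<Sum>j\<le>n. opoly a b j x * opoly a b j y)"

end

theory Submission
  imports Defs "HOL-Complex_Analysis.Complex_Analysis"
begin

text \<open>
  If the ratios did not tend to 0 uniformly, there would be \<open>x\<^sub>j \<in> \<sigma>(J)\<close>, \<open>n\<^sub>j \<rightarrow> \<infinity>\<close> and
  \<open>\<eta> > 0\<close> with \<open>p\<^bsub>n\<^sub>j\<^esub>(x\<^sub>j)\<^sup>2 > \<eta> K\<^bsub>n\<^sub>j\<^esub>(x\<^sub>j, x\<^sub>j)\<close>. Translating by \<open>n\<^sub>j\<close> and normalising, a subsequence
  converges to a right limit \<open>J'\<close>, an energy \<open>x\<close> and a solution of \<open>J'u = xu\<close> on the left half line
  that is square summable at \<open>-\<infinity>\<close>.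

  If \<open>x\<close> lies in the bands, this contradicts reflectionlessness. The left Weyl ratio \<open>s\<close> satisfies
  \<open>s(x + i\<epsilon>) = s\<^sub>0 + O(\<epsilon>)\<close> with \<open>s\<^sub>0\<close> real, and \<open>a\<^sub>0\<^sup>2 G\<^sub>1\<^sub>1 = s(1 + s G\<^sub>0\<^sub>0)\<close>. Since the diagonal Green
  functions are imaginary on the bands, they continue analytically across them with values in
  \<open>i(0, \<infinity>)\<close>, and at a band edge \<open>G\<^sub>n\<^sub>n\<^sup>2\<close> has a simple pole or a simple zero. No such orders are
  compatible with the relation between \<open>G\<^sub>0\<^sub>0\<close>, \<open>G\<^sub>1\<^sub>1\<close> and \<open>s\<close>.

  If \<open>x\<close> lies outside the bands, then \<open>p\<^sub>n(x\<^sub>j)\<close> is bounded in \<open>n\<close> for large \<open>j\<close>: otherwise \<open>J - x\<^sub>j\<close>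
  would be bounded below in the sup norm (again by translation compactness), hence with
  exponential weights in \<open>\<ell>\<^sup>2\<close>, and \<open>x\<^sub>j\<close> would not be in the spectrum. Translating by near-maximal
  indices instead of \<open>n\<^sub>j\<close> gives a bounded solution of \<open>J'u = xu\<close> off the spectrum of \<open>J'\<close>, which is impossible.
\<close>

section \<open>Symmetric operators on real Hilbert spaces\<close>

text \<open>Square summability at minus infinity is contradictory only on the bands. Off the
  spectrum of J' such solutions exist anyway, so there the membership of x_j in the spectrum of J
  has to enter; on the bands it only bounds x_j. Compactness by itself yields a sup-norm estimate,
  because a normalised maximum survives a limit of translates while an l^2 norm may escape;
  exponential weights then convert it to l^2. The orders at an edge come from soft facts instead of
  explicit formulas: |G| <= 1/|Im z| limits the pole, Im G >= const Im z limits the zero, and G^2 is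
  nonnegative in the gap but nonpositive in the band, so its order is odd. The error O(eps) of s
  must be linear because the last case is decided at scale eps^(1/2); it comes from Cauchy-Schwarz
  in the Wronskian with the square summable solution. The spectrum is defined by bijectivity on l^2
  alone, with no bounded inverse; the next lemma recovers lower bounds by a Baire argument.\<close>

lemma surj_adjoint_bounded_below:
  fixes T T' :: "'a::{real_inner,complete_space} \<Rightarrow> 'a"
  assumes adj: "\<And>f g. inner (T f) g = inner f (T' g)" and "surj T'"
  shows "\<exists>c>0. \<forall>f. c * norm f \<le> norm (T f)"
proof (rule ccontr)
  assume "\<not> ?thesis"
  then have "\<exists>f. norm (T f) < inverse (real (Suc n)) * norm f" for n
    by (metis not_le inverse_positive_iff_positive of_nat_0_less_iff zero_less_Suc)
  then obtain F where F: "norm (T (F n)) < inverse (real (Suc n)) * norm (F n)" for n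
    by metis
  \<comment> \<open>The functionals \<open>(n + 1) <F n / |F n|, _>\<close> have norm
    \<open>n + 1\<close>, but are pointwise bounded on the range of \<open>T'\<close>, which is
    everything. \<open>A N\<close> collects the points where they are bounded by \<open>N\<close>;
    Baire makes one of these sets contain a ball.\<close>
  define A where "A N = {h. \<forall>n. \<bar>inner (F n) h\<bar> * real (Suc n) \<le> real N * norm (F n)}" for N :: nat
  have Fpos: "norm (F n) > 0" for n
    using F[of n] norm_ge_zero[of "T (F n)"]
    by (metis zero_less_norm_iff mult_zero_right norm_zero not_less)
  have cl: "closed (A N)" for N
    unfolding A_def by (intro closed_Collect_all closed_Collect_le continuous_intros)
  have un: "(\<Union>N. A N) = UNIV"
  proof (intro set_eqI iffI UNIV_I)
    fix h
    obtain h' where h: "h = T' h'" using \<open>surj T'\<close> by (metis surjD)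
    obtain N :: nat where N: "norm h' \<le> real N" using real_arch_simple by blast
    have "\<bar>inner (F n) h\<bar> * real (Suc n) \<le> real N * norm (F n)" for n
    proof -
      have "\<bar>inner (F n) h\<bar> * real (Suc n) = \<bar>inner (T (F n)) h'\<bar> * real (Suc n)"
        by (simp add: h adj)
      also have "\<dots> \<le> norm (T (F n)) * norm h' * real (Suc n)"
        by (intro mult_right_mono Cauchy_Schwarz_ineq2) auto
      also have "\<dots> \<le> (inverse (real (Suc n)) * norm (F n)) * norm h' * real (Suc n)"
        using F[of n] by (intro mult_right_mono) auto
      also have "\<dots> = norm h' * norm (F n)" by (simp add: field_simps del: of_nat_Suc)
      also have "\<dots> \<le> real N * norm (F n)" using N by (intro mult_right_mono) auto
      finally show ?thesis .
    qed
    then show "h \<in> (\<Union>N. A N)" by (auto simp: A_def)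
  qed
  have "\<exists>N. interior (A N) \<noteq> {}"
  proof (rule ccontr)
    assume "\<nexists>N. interior (A N) \<noteq> {}"
    then have "euclidean interior_of (\<Union>(range A)) = {}"
      using cl by (intro Baire_category_alt) (auto simp: completely_metrizable_space_euclidean)
    then show False using un by simp
  qed
  then obtain N h where "h \<in> interior (A N)" by blast
  then obtain r where r: "r > 0" "cball h r \<subseteq> A N"
    by (metis open_contains_cball open_interior interior_subset subset_trans)
  have bd: "r * real (Suc n) \<le> 2 * real N" for n
  proof -
    \<comment> \<open>Testing at \<open>h + g\<close> and at \<open>h\<close>, with \<open>g\<close>
      parallel to \<open>F n\<close>, reads off the full norm of the functional.\<close>
    define g where "g = (r / norm (F n)) *\<^sub>R F n"
    have "norm g = r" using Fpos[of n] r by (simp add: g_def)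
    then have "h + g \<in> A N" "h \<in> A N" using r by (auto simp: dist_norm)
    then have 1: "\<bar>inner (F n) (h + g)\<bar> * real (Suc n) \<le> real N * norm (F n)"
      and 2: "\<bar>inner (F n) h\<bar> * real (Suc n) \<le> real N * norm (F n)" by (auto simp: A_def)
    have "inner (F n) g = r * norm (F n)"
      using Fpos[of n] by (simp add: g_def power2_norm_eq_inner[symmetric] power2_eq_square)
    then have "r * norm (F n) \<le> \<bar>inner (F n) (h + g)\<bar> + \<bar>inner (F n) h\<bar>"
      by (simp add: inner_add_right)
    then have "r * norm (F n) * real (Suc n) \<le> (\<bar>inner (F n) (h + g)\<bar> + \<bar>inner (F n) h\<bar>) * real (Suc n)"
      by (intro mult_right_mono) auto
    also have "\<dots> \<le> 2 * real N * norm (F n)" using 1 2 by (simp add: algebra_simps)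
    finally have "(r * real (Suc n)) * norm (F n) \<le> (2 * real N) * norm (F n)" by (simp add: mult_ac)
    then show ?thesis using Fpos[of n] by (rule mult_right_le_imp_le)
  qed
  obtain n :: nat where "2 * real N / r < real n" using reals_Archimedean2 by blast
  then have "2 * real N < r * real n" using r by (simp add: field_simps)
  also have "\<dots> \<le> r * real (Suc n)" using r by simp
  finally show False using bd[of n] by simp
qed

text \<open>\<open>T\<^sup>2 f = g\<close> is solved by the contraction \<open>f \<mapsto> f - t (T\<^sup>2 f - g)\<close>.\<close>

lemma symmetric_bounded_below_bij:
  fixes T :: "'a::{real_inner,complete_space} \<Rightarrow> 'a"
  assumes lin: "bounded_linear T" and sym: "\<And>f g. inner (T f) g = inner f (T g)"
    and "c > 0" and low: "\<And>f. c * norm f \<le> norm (T f)"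
  shows "bij T"
proof -
  interpret bounded_linear T by fact
  obtain K where "K > 0" and K: "\<And>f. norm (T f) \<le> norm f * K" using pos_bounded by blast
  \<comment> \<open>With \<open>t * K\<^sup>2 = 1\<close> the quadratic term absorbs half of
    \<open>2 * t * |T f|^2\<close>, which leaves the factor \<open>1 - t * c\<^sup>2\<close>. The
    \<open>max 0\<close> below acts only on the trivial space, since otherwise
    \<open>c \<le> K\<close>.\<close>
  define t where "t = 1 / K\<^sup>2"
  define q where "q = sqrt (max 0 (1 - t * c\<^sup>2))"
  have "t > 0" using \<open>K > 0\<close> by (simp add: t_def)
  have q: "0 \<le> q" "q < 1" using \<open>t > 0\<close> \<open>c > 0\<close> by (auto simp: q_def)
  have contr: "norm (f - t *\<^sub>R T (T f)) \<le> q * norm f" for f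
  proof -
    have "(norm (f - t *\<^sub>R T (T f)))\<^sup>2 = (norm f)\<^sup>2 - 2 * t * (norm (T f))\<^sup>2 + t\<^sup>2 * (norm (T (T f)))\<^sup>2"
    proof -
      have "inner f (T (T f)) = inner (T f) (T f)" "inner (T (T f)) f = inner (T f) (T f)"
        using sym[of "T f" f] sym[of f "T f"] by simp_all
      then show ?thesis
        unfolding power2_norm_eq_inner
        by (simp add: inner_diff_left inner_diff_right power2_eq_square algebra_simps)
    qed
    also have "\<dots> \<le> (norm f)\<^sup>2 - 2 * t * (norm (T f))\<^sup>2 + t\<^sup>2 * (norm (T f) * K)\<^sup>2"
      using K[of "T f"] by (intro add_left_mono mult_left_mono power_mono) auto
    also have "\<dots> = (norm f)\<^sup>2 - 2 * t * (norm (T f))\<^sup>2 + t * (t * K\<^sup>2) * (norm (T f))\<^sup>2"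
      by (simp add: power_mult_distrib power2_eq_square[of t])
    also have "t * K\<^sup>2 = 1" using \<open>K > 0\<close> by (simp add: t_def)
    also have "(norm f)\<^sup>2 - 2 * t * (norm (T f))\<^sup>2 + t * 1 * (norm (T f))\<^sup>2
        = (norm f)\<^sup>2 - t * (norm (T f))\<^sup>2" by simp
    also have "\<dots> \<le> (norm f)\<^sup>2 - t * (c * norm f)\<^sup>2"
      using low[of f] \<open>t > 0\<close> \<open>c > 0\<close> by (intro diff_left_mono mult_left_mono power_mono) auto
    also have "\<dots> = (1 - t * c\<^sup>2) * (norm f)\<^sup>2" by (simp add: algebra_simps power_mult_distrib)
    also have "\<dots> \<le> (max 0 (1 - t * c\<^sup>2)) * (norm f)\<^sup>2" by (intro mult_right_mono) auto
    also have "\<dots> = (q * norm f)\<^sup>2" by (simp add: q_def power_mult_distrib)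
    finally show ?thesis by (rule power2_le_imp_le) (use q in simp)
  qed
  have "inj T"
  proof (rule injI)
    fix f g assume "T f = T g"
    then show "f = g" using low[of "f - g"] \<open>c > 0\<close> by (simp add: diff mult_le_0_iff)
  qed
  moreover have "\<exists>f. T f = g" for g
  proof -
    define \<Phi> where "\<Phi> f = f - t *\<^sub>R (T (T f) - g)" for f
    have "dist (\<Phi> f) (\<Phi> h) \<le> q * dist f h" for f h
    proof -
      have "\<Phi> f - \<Phi> h = (f - h) - t *\<^sub>R T (T (f - h))"
        by (simp add: \<Phi>_def diff scaleR_diff_right)
      then show ?thesis using contr[of "f - h"] by (simp add: dist_norm)
    qed
    then have "\<exists>!f. \<Phi> f = f" using q by (intro banach_fix_type) auto
    then obtain f where "\<Phi> f = f" by blast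
    then have "T (T f) = g" using \<open>t > 0\<close> by (simp add: \<Phi>_def)
    then show ?thesis by blast
  qed
  then have "surj T" by (metis surj_def)
  ultimately show ?thesis by (rule bijI)
qed

text \<open>For nonnegative \<open>A\<close> with bound \<open>K\<close>, the form at
  \<open>f - A f / K\<close> is nonnegative, which gives \<open>|A f|^2 <= K <A f, f>\<close>.
  Surjectivity would bound the left side below by \<open>c^2 |f|^2\<close> and keep the form away
  from 0. Used at the top of a numerical range to produce a spectral point.\<close>

lemma symmetric_nonneg_not_surj:
  fixes A :: "'a::{real_inner,complete_space} \<Rightarrow> 'a"
  assumes lin: "bounded_linear A" and sym: "\<And>f g. inner (A f) g = inner f (A g)"
    and pos: "\<And>f. inner (A f) f \<ge> 0"
    and inf: "\<And>d. d > 0 \<Longrightarrow> \<exists>f. f \<noteq> 0 \<and> inner (A f) f < d * (norm f)\<^sup>2"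
  shows "\<not> surj A"
proof
  assume "surj A"
  then obtain c where "c > 0" and c: "\<And>f. c * norm f \<le> norm (A f)"
    using surj_adjoint_bounded_below[OF sym] by blast
  interpret bounded_linear A by fact
  obtain K where "K > 0" and K: "\<And>f. norm (A f) \<le> norm f * K" using pos_bounded by blast
  obtain f where f: "f \<noteq> 0" "inner (A f) f < c\<^sup>2 / K * (norm f)\<^sup>2"
    using inf[of "c\<^sup>2 / K"] \<open>c > 0\<close> \<open>K > 0\<close> by auto
  define t where "t = 1 / K"
  have "0 \<le> inner (A (f - t *\<^sub>R A f)) (f - t *\<^sub>R A f)" by (rule pos)
  also have "\<dots> = inner (A f) f - 2 * t * (norm (A f))\<^sup>2 + t\<^sup>2 * inner (A (A f)) (A f)"
    using sym[of "A f" f] unfolding power2_norm_eq_inner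
    by (simp add: diff scaleR inner_diff_left inner_diff_right power2_eq_square algebra_simps)
  also have "\<dots> \<le> inner (A f) f - 2 * t * (norm (A f))\<^sup>2 + t\<^sup>2 * ((norm (A f) * K) * norm (A f))"
  proof (intro add_left_mono mult_left_mono)
    have "inner (A (A f)) (A f) \<le> norm (A (A f)) * norm (A f)" by (rule norm_cauchy_schwarz)
    also have "\<dots> \<le> (norm (A f) * K) * norm (A f)" by (intro mult_right_mono K) auto
    finally show "inner (A (A f)) (A f) \<le> (norm (A f) * K) * norm (A f)" .
  qed auto
  also have "\<dots> = inner (A f) f - (norm (A f))\<^sup>2 / K"
    using \<open>K > 0\<close> by (simp add: t_def field_simps power2_eq_square)
  also have "\<dots> \<le> inner (A f) f - (c * norm f)\<^sup>2 / K"
    using c[of f] \<open>K > 0\<close> \<open>c > 0\<close> by (intro diff_left_mono divide_right_mono power_mono) auto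
  finally show False using f by (simp add: power_mult_distrib)
qed

section \<open>The space of square summable sequences\<close>

lemma l2_finite_sumsI:
  assumes "\<And>F. finite F \<Longrightarrow> (\<Sum>i\<in>F. (norm (u i))\<^sup>2) \<le> B"
  shows "u \<in> l2" "(\<Sum>\<^sub>\<infinity>i. (norm (u i))\<^sup>2) \<le> B"
proof -
  have "(\<lambda>i. (norm (u i))\<^sup>2) summable_on UNIV"
    using assms by (intro nonneg_bdd_above_summable_on bdd_aboveI2) auto
  then show "u \<in> l2" "(\<Sum>\<^sub>\<infinity>i. (norm (u i))\<^sup>2) \<le> B"
    using assms by (auto simp: l2_def intro!: infsum_le_finite_sums)
qed

lemma l2_dominated:
  assumes "u \<in> l2" and "\<And>i. norm (v i) \<le> C * norm (u i)"
  shows "v \<in> l2"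
proof -
  have "(\<lambda>i. C\<^sup>2 * (norm (u i))\<^sup>2) summable_on UNIV"
    using assms(1) by (intro summable_on_cmult_right) (simp add: l2_def)
  then show ?thesis
    unfolding l2_def mem_Collect_eq
    by (rule summable_on_comparison_test)
       (use power_mono[OF assms(2)] in \<open>auto simp: power_mult_distrib\<close>)
qed

lemma l2_add:
  assumes "u \<in> l2" "v \<in> l2"
  shows "(\<lambda>i. u i + v i) \<in> l2"
proof -
  have "(\<lambda>i. 2 * (norm (u i))\<^sup>2 + 2 * (norm (v i))\<^sup>2) summable_on UNIV"
    using assms by (intro summable_on_add summable_on_cmult_right) (auto simp: l2_def)
  then show ?thesis
    unfolding l2_def mem_Collect_eq
  proof (rule summable_on_comparison_test)
    fix i
    have "(norm (u i + v i))\<^sup>2 \<le> (norm (u i) + norm (v i))\<^sup>2"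
      by (intro power_mono norm_triangle_ineq) auto
    also have "\<dots> \<le> 2 * (norm (u i))\<^sup>2 + 2 * (norm (v i))\<^sup>2"
      using sum_squares_bound[of "norm (u i)" "norm (v i)"] by (simp add: power2_sum)
    finally show "(norm (u i + v i))\<^sup>2 \<le> 2 * (norm (u i))\<^sup>2 + 2 * (norm (v i))\<^sup>2" .
  qed auto
qed

lemma l2_inner_summable:
  assumes "u \<in> l2" "v \<in> l2"
  shows "(\<lambda>i. inner (u i) (v i)) summable_on UNIV"
proof -
  have "(\<lambda>i. (norm (u i))\<^sup>2 + (norm (v i))\<^sup>2) summable_on UNIV"
    using assms by (intro summable_on_add) (auto simp: l2_def)
  then have "(\<lambda>i. norm (inner (u i) (v i))) summable_on UNIV"
  proof (rule Infinite_Sum.abs_summable_on_comparison_test')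
    fix i
    have "norm (inner (u i) (v i)) \<le> norm (u i) * norm (v i)"
      by (simp add: Cauchy_Schwarz_ineq2)
    also have "\<dots> \<le> (norm (u i))\<^sup>2 + (norm (v i))\<^sup>2"
      using sum_squares_bound[of "norm (u i)" "norm (v i)"]
        mult_nonneg_nonneg[OF norm_ge_zero[of "u i"] norm_ge_zero[of "v i"]] by linarith
    finally show "norm (inner (u i) (v i)) \<le> (norm (u i))\<^sup>2 + (norm (v i))\<^sup>2" .
  qed
  then show ?thesis by (rule abs_summable_summable)
qed

text \<open>A type for the set \<open>l2\<close>, so that Baire, Banach and Cauchy-Schwarz apply.
  The class structure is real, with the real part of the complex inner product; complex scalars act
  through \<open>cscale\<close>.\<close>

typedef 'i ell2 = "l2 :: ('i \<Rightarrow> complex) set"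
  morphisms coord Abs_ell2
  by (rule exI[of _ "\<lambda>_. 0"]) (simp add: l2_def)

setup_lifting type_definition_ell2

instantiation ell2 :: (type) real_inner
begin

lift_definition zero_ell2 :: "'a ell2" is "\<lambda>_. 0"
  by (simp add: l2_def)

lift_definition plus_ell2 :: "'a ell2 \<Rightarrow> 'a ell2 \<Rightarrow> 'a ell2" is "\<lambda>u v i. u i + v i"
  by (rule l2_add)

lift_definition uminus_ell2 :: "'a ell2 \<Rightarrow> 'a ell2" is "\<lambda>u i. - u i"
  by (erule l2_dominated[where C = 1]) simp

lift_definition scaleR_ell2 :: "real \<Rightarrow> 'a ell2 \<Rightarrow> 'a ell2" is "\<lambda>r u i. r *\<^sub>R u i"
  subgoal for r u by (rule l2_dominated[where C = "\<bar>r\<bar>" and u = u]) simp_all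
  done

definition minus_ell2 :: "'a ell2 \<Rightarrow> 'a ell2 \<Rightarrow> 'a ell2" where
  "f - g = f + (- g)" for f g :: "'a ell2"

lift_definition inner_ell2 :: "'a ell2 \<Rightarrow> 'a ell2 \<Rightarrow> real" is
  "\<lambda>u v. \<Sum>\<^sub>\<infinity>i. inner (u i) (v i)" .

definition norm_ell2 :: "'a ell2 \<Rightarrow> real" where
  "norm f = sqrt (inner f f)" for f :: "'a ell2"

definition dist_ell2 :: "'a ell2 \<Rightarrow> 'a ell2 \<Rightarrow> real" where
  "dist f g = norm (f - g)" for f g :: "'a ell2"

definition sgn_ell2 :: "'a ell2 \<Rightarrow> 'a ell2" where
  "sgn f = scaleR (inverse (norm f)) f" for f :: "'a ell2"

definition uniformity_ell2 :: "('a ell2 \<times> 'a ell2) filter" where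
  "uniformity_ell2 = (INF e\<in>{0 <..}. principal {(f, g). dist f g < e})"

definition open_ell2 :: "'a ell2 set \<Rightarrow> bool" where
  "open_ell2 U \<longleftrightarrow> (\<forall>x\<in>U. \<forall>\<^sub>F (x', y) in uniformity. x' = x \<longrightarrow> y \<in> U)"

instance
proof
  fix f g h :: "'a ell2" and r s :: real
  show "f + g + h = f + (g + h)" by transfer (simp add: add.assoc)
  show "f + g = g + f" by transfer (simp add: add.commute)
  show "0 + f = f" by transfer simp
  show "- f + f = 0" by transfer simp
  show "f - g = f + - g" by (rule minus_ell2_def)
  show "r *\<^sub>R (f + g) = r *\<^sub>R f + r *\<^sub>R g" by transfer (simp add: scaleR_add_right)
  show "(r + s) *\<^sub>R f = r *\<^sub>R f + s *\<^sub>R f" by transfer (simp add: scaleR_add_left)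
  show "r *\<^sub>R s *\<^sub>R f = (r * s) *\<^sub>R f" by transfer simp
  show "1 *\<^sub>R f = f" by transfer simp
  show "dist f g = norm (f - g)" by (rule dist_ell2_def)
  show "sgn f = scaleR (inverse (norm f)) f" by (rule sgn_ell2_def)
  show "uniformity = (INF e\<in>{0 <..}. principal {(f, g :: 'a ell2). dist f g < e})"
    by (rule uniformity_ell2_def)
  show "open U \<longleftrightarrow> (\<forall>x\<in>U. \<forall>\<^sub>F (x', y) in uniformity. x' = x \<longrightarrow> y \<in> U)" for U :: "'a ell2 set"
    by (rule open_ell2_def)
  show "inner f g = inner g f" by transfer (simp add: inner_commute)
  show "inner (f + g) h = inner f h + inner g h"
    by transfer (simp add: inner_add_left infsum_add l2_inner_summable)
  show "inner (r *\<^sub>R f) g = r * inner f g"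
    by transfer (simp add: infsum_cmult_right')
  show "0 \<le> inner f f" by transfer (simp add: infsum_nonneg)
  show "inner f f = 0 \<longleftrightarrow> f = 0"
  proof
    assume "inner f f = 0"
    then show "f = 0"
    proof transfer
      fix u :: "'a \<Rightarrow> complex"
      assume u: "u \<in> l2" "(\<Sum>\<^sub>\<infinity>i. inner (u i) (u i)) = 0"
      have "inner (u i) (u i) = 0" for i
        by (rule nonneg_infsum_le_0D[OF eq_refl[OF u(2)] l2_inner_summable[OF u(1) u(1)]]) simp_all
      then show "u = (\<lambda>_. 0)" by auto
    qed
  qed (transfer, simp)
  show "norm f = sqrt (inner f f)" by (rule norm_ell2_def)
qed

end

lemma coord_simps [simp]:
  "coord 0 i = 0" "coord (f + g) i = coord f i + coord g i" "coord (- f) i = - coord f i"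
  "coord (f - g) i = coord f i - coord g i" "coord (r *\<^sub>R f) i = r *\<^sub>R coord f i"
  unfolding minus_ell2_def by (transfer; simp)+

lemma coord_in_l2 [simp]: "coord f \<in> l2"
  using coord by auto

lemma norm_ell2_power2: "(norm f)\<^sup>2 = (\<Sum>\<^sub>\<infinity>i. (norm (coord f i))\<^sup>2)"
  unfolding power2_norm_eq_inner by transfer simp

lemma ell2_summable: "(\<lambda>i. (norm (coord f i))\<^sup>2) summable_on UNIV"
  using coord_in_l2[of f] by (simp add: l2_def)

lemma sum_coord_le_norm:
  assumes "finite F" shows "(\<Sum>i\<in>F. (norm (coord f i))\<^sup>2) \<le> (norm f)\<^sup>2"
  unfolding norm_ell2_power2 using assms by (intro finite_sum_le_infsum ell2_summable) auto

lemma norm_coord_le: "norm (coord f i) \<le> norm f"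
  by (rule power2_le_imp_le) (use sum_coord_le_norm[of "{i}" f] in simp_all)

lemma bounded_linear_coord: "bounded_linear (\<lambda>f. coord f i)"
  by (rule bounded_linear_intro[where K = 1]) (simp_all add: norm_coord_le)

instance ell2 :: (type) complete_space
proof
  fix X :: "nat \<Rightarrow> 'a ell2"
  assume C: "Cauchy X"
  have "Cauchy (\<lambda>n. coord (X n) i)" for i
    using C by (rule bounded_linear.Cauchy[OF bounded_linear_coord])
  then have "\<exists>l. (\<lambda>n. coord (X n) i) \<longlonglongrightarrow> l" for i
    using Cauchy_convergent_iff convergent_def by blast
  then obtain u where u: "\<And>i. (\<lambda>n. coord (X n) i) \<longlonglongrightarrow> u i" by metis
  \<comment> \<open>The Cauchy estimate is kept on finite partial sums, which pass to coordinatewise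
    limits.\<close>
  have ev: "\<exists>M. \<forall>m\<ge>M. \<forall>F. finite F \<longrightarrow> (\<Sum>i\<in>F. (norm (coord (X m) i - u i))\<^sup>2) \<le> e\<^sup>2"
    if "e > 0" for e
  proof -
    obtain M where M: "\<And>m n. m \<ge> M \<Longrightarrow> n \<ge> M \<Longrightarrow> norm (X m - X n) < e"
      using C \<open>e > 0\<close> by (meson CauchyD)
    have "(\<Sum>i\<in>F. (norm (coord (X m) i - u i))\<^sup>2) \<le> e\<^sup>2" if "m \<ge> M" "finite F" for m F
    proof (rule tendsto_upperbound)
      show "((\<lambda>n. \<Sum>i\<in>F. (norm (coord (X m) i - coord (X n) i))\<^sup>2)
          \<longlongrightarrow> (\<Sum>i\<in>F. (norm (coord (X m) i - u i))\<^sup>2)) sequentially"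
        by (intro tendsto_intros u)
      show "\<forall>\<^sub>F n in sequentially. (\<Sum>i\<in>F. (norm (coord (X m) i - coord (X n) i))\<^sup>2) \<le> e\<^sup>2"
      proof (rule eventually_sequentiallyI[of M])
        fix n assume "M \<le> n"
        have "(\<Sum>i\<in>F. (norm (coord (X m) i - coord (X n) i))\<^sup>2) \<le> (norm (X m - X n))\<^sup>2"
          using sum_coord_le_norm[OF \<open>finite F\<close>, of "X m - X n"] by simp
        also have "\<dots> \<le> e\<^sup>2"
          using M[OF \<open>m \<ge> M\<close> \<open>M \<le> n\<close>] by (intro power_mono) auto
        finally show "(\<Sum>i\<in>F. (norm (coord (X m) i - coord (X n) i))\<^sup>2) \<le> e\<^sup>2" .
      qed
    qed simp
    then show ?thesis by blast
  qed
  have "u \<in> l2"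
  proof -
    obtain M where M: "\<And>F. finite F \<Longrightarrow> (\<Sum>i\<in>F. (norm (coord (X M) i - u i))\<^sup>2) \<le> 1\<^sup>2"
      using ev[of 1] by auto
    have "(\<lambda>i. coord (X M) i - u i) \<in> l2" by (rule l2_finite_sumsI[OF M])
    then have "(\<lambda>i. - (coord (X M) i - u i)) \<in> l2" by (rule l2_dominated[where C = 1]) (simp add: norm_minus_commute)
    then have "(\<lambda>i. - (coord (X M) i - u i) + coord (X M) i) \<in> l2" by (rule l2_add) simp
    then show ?thesis by simp
  qed
  define L where "L = Abs_ell2 u"
  have L: "coord L = u" using \<open>u \<in> l2\<close> by (simp add: L_def Abs_ell2_inverse)
  have "X \<longlonglongrightarrow> L"
  proof (rule LIMSEQ_I)
    fix r :: real assume "r > 0"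
    obtain M where M: "\<And>m F. m \<ge> M \<Longrightarrow> finite F \<Longrightarrow> (\<Sum>i\<in>F. (norm (coord (X m) i - u i))\<^sup>2) \<le> (r/2)\<^sup>2"
      using ev[of "r/2"] \<open>r > 0\<close> by auto
    have "norm (X m - L) < r" if "m \<ge> M" for m
    proof -
      have "(norm (X m - L))\<^sup>2 \<le> (r/2)\<^sup>2"
        unfolding norm_ell2_power2 by (rule l2_finite_sumsI(2)) (simp add: L M that)
      then have "norm (X m - L) \<le> r/2" by (rule power2_le_imp_le) (use \<open>r > 0\<close> in simp)
      then show ?thesis using \<open>r > 0\<close> by simp
    qed
    then show "\<exists>M. \<forall>m\<ge>M. norm (X m - L) < r" by blast
  qed
  then show "convergent X" by (rule convergentI)
qed

lift_definition cscale :: "complex \<Rightarrow> 'i ell2 \<Rightarrow> 'i ell2" is "\<lambda>c u i. c * u i"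
  subgoal for c u by (rule l2_dominated[where C = "norm c" and u = u]) (simp_all add: norm_mult)
  done

lemma coord_cscale [simp]: "coord (cscale c f) i = c * coord f i"
  by transfer simp

lemma norm_cscale: "norm (cscale c f) = norm c * norm f"
proof -
  have "(norm (cscale c f))\<^sup>2 = (norm c)\<^sup>2 * (norm f)\<^sup>2"
    unfolding norm_ell2_power2 by (simp add: norm_mult power_mult_distrib infsum_cmult_right')
  then have "(norm (cscale c f))\<^sup>2 = (norm c * norm f)\<^sup>2" by (simp add: power_mult_distrib)
  then show ?thesis by (simp add: power2_eq_iff_nonneg)
qed

lemma ell2_eqI: "(\<And>i. coord f i = coord g i) \<Longrightarrow> f = g"
  by (metis coord_inject ext)

lemma inner_ell2_coord: "inner f g = (\<Sum>\<^sub>\<infinity>i. inner (coord f i) (coord g i))"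
  by transfer simp

section \<open>Two-sided Jacobi operators and their Green functions\<close>

lemma l2_shift:
  fixes u :: "int \<Rightarrow> complex"
  assumes "u \<in> l2" shows "(\<lambda>n. u (n + k)) \<in> l2"
proof -
  have "bij_betw (\<lambda>n. n + k) (UNIV :: int set) UNIV"
    by (rule bij_betwI[where g = "\<lambda>n. n - k"]) auto
  then show ?thesis using assms
    unfolding l2_def by (simp add: summable_on_reindex_bij_betw[where f = "\<lambda>n. (norm (u n))\<^sup>2"])
qed

lemma l2_bounded_mult:
  assumes "u \<in> l2" and "\<And>n. norm (c n) \<le> M" shows "(\<lambda>n. c n * u n) \<in> l2"
  by (rule l2_dominated[OF assms(1), where C = M]) (simp add: norm_mult assms(2) mult_right_mono)

lemma infsum_shift_int:
  fixes h :: "int \<Rightarrow> real" shows "(\<Sum>\<^sub>\<infinity>n. h (n + k)) = (\<Sum>\<^sub>\<infinity>n. h n)"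
proof -
  have "bij_betw (\<lambda>n. n + k) (UNIV :: int set) UNIV"
    by (rule bij_betwI[where g = "\<lambda>n. n - k"]) auto
  then show ?thesis by (rule infsum_reindex_bij_betw)
qed

text \<open>This is \<open>J - z\<close>. The \<open>Abs_ell2\<close> has its intended meaning once
  the coefficients are bounded (\<open>coord_jop\<close>).\<close>

definition jacobi_op :: "(int \<Rightarrow> real) \<Rightarrow> (int \<Rightarrow> real) \<Rightarrow> complex \<Rightarrow> int ell2 \<Rightarrow> int ell2" where
  "jacobi_op a b z f = Abs_ell2 (\<lambda>n. jac2 a b (coord f) n - z * coord f n)"

text \<open>Positivity of \<open>a\<close> is reserved for \<open>gap_jacobi\<close>, because these
  facts also serve the extended half-line operator, whose off-diagonal entries vanish on the
  left.\<close>

locale bounded_jacobi =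
  fixes a b :: "int \<Rightarrow> real" and M :: real
  assumes a_bound: "\<bar>a n\<bar> \<le> M" and b_bound: "\<bar>b n\<bar> \<le> M"
begin

lemma M_nonneg: "0 \<le> M"
  using a_bound[of 0] by simp

lemma norm_jac2_power2:
  "(norm (jac2 a b u n - z * u n))\<^sup>2 \<le>
    3 * (M + norm z)\<^sup>2 * ((norm (u (n - 1)))\<^sup>2 + (norm (u n))\<^sup>2 + (norm (u (n + 1)))\<^sup>2)"
proof -
  let ?K = "M + norm z"
  let ?p = "norm (u (n - 1))" and ?q = "norm (u n)" and ?r = "norm (u (n + 1))"
  have eq: "jac2 a b u n - z * u n = of_real (a (n - 1)) * u (n - 1) + (of_real (b n) - z) * u n
      + of_real (a n) * u (n + 1)" by (simp add: jac2_def algebra_simps)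
  have "norm (of_real (b n) - z) \<le> ?K"
    using norm_triangle_ineq4[of "of_real (b n)" z] b_bound[of n] by simp
  moreover have "\<bar>a k\<bar> \<le> ?K" for k using a_bound[of k] by (simp add: add_increasing2)
  ultimately have "norm (jac2 a b u n - z * u n) \<le> ?K * ?p + ?K * ?q + ?K * ?r"
    unfolding eq by (intro order_trans[OF norm_triangle_ineq] add_mono)
      (auto simp: norm_mult intro!: mult_right_mono)
  also have "\<dots> = ?K * (?p + ?q + ?r)" by (simp add: algebra_simps)
  finally have "(norm (jac2 a b u n - z * u n))\<^sup>2 \<le> (?K * (?p + ?q + ?r))\<^sup>2" by (rule power_mono) simp
  also have "\<dots> = ?K\<^sup>2 * (?p + ?q + ?r)\<^sup>2" by (simp add: power_mult_distrib)
  also have "\<dots> \<le> ?K\<^sup>2 * (3 * (?p\<^sup>2 + ?q\<^sup>2 + ?r\<^sup>2))"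
  proof (rule mult_left_mono)
    have "3 * (?p\<^sup>2 + ?q\<^sup>2 + ?r\<^sup>2) - (?p + ?q + ?r)\<^sup>2 = (?p - ?q)\<^sup>2 + (?q - ?r)\<^sup>2 + (?p - ?r)\<^sup>2"
      by (simp add: power2_eq_square algebra_simps)
    then show "(?p + ?q + ?r)\<^sup>2 \<le> 3 * (?p\<^sup>2 + ?q\<^sup>2 + ?r\<^sup>2)"
      using zero_le_power2[of "?p - ?q"] zero_le_power2[of "?q - ?r"] zero_le_power2[of "?p - ?r"] by linarith
  qed simp
  finally show ?thesis by (simp only: mult_ac)
qed

lemma jac2_sum_bound:
  assumes "finite F"
  shows "(\<Sum>n\<in>F. (norm (jac2 a b (coord f) n - z * coord f n))\<^sup>2) \<le> (3 * (M + norm z) * norm f)\<^sup>2"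
proof -
  let ?h = "\<lambda>n. (norm (coord f n))\<^sup>2"
  have sh: "(\<Sum>n\<in>F. ?h (n + k)) \<le> (norm f)\<^sup>2" for k
  proof -
    have "(\<Sum>n\<in>F. ?h (n + k)) = (\<Sum>n\<in>(\<lambda>n. n + k) ` F. ?h n)"
      by (subst sum.reindex) (auto simp: inj_on_def)
    also have "\<dots> \<le> (norm f)\<^sup>2" using assms by (intro sum_coord_le_norm) simp
    finally show ?thesis .
  qed
  have "(\<Sum>n\<in>F. (norm (jac2 a b (coord f) n - z * coord f n))\<^sup>2)
      \<le> (\<Sum>n\<in>F. 3 * (M + norm z)\<^sup>2 * (?h (n - 1) + ?h n + ?h (n + 1)))"
    by (intro sum_mono norm_jac2_power2)
  also have "\<dots> = 3 * (M + norm z)\<^sup>2 * ((\<Sum>n\<in>F. ?h (n + (-1))) + (\<Sum>n\<in>F. ?h (n + 0)) + (\<Sum>n\<in>F. ?h (n + 1)))"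
    by (simp add: sum.distrib sum_distrib_left[symmetric])
  also have "\<dots> \<le> 3 * (M + norm z)\<^sup>2 * ((norm f)\<^sup>2 + (norm f)\<^sup>2 + (norm f)\<^sup>2)"
    by (intro mult_left_mono add_mono sh) auto
  also have "\<dots> = (3 * (M + norm z) * norm f)\<^sup>2" unfolding power_mult_distrib by simp
  finally show ?thesis .
qed

lemma jac2_in_l2:
  assumes "u \<in> l2" shows "(\<lambda>n. jac2 a b u n - z * u n) \<in> l2"
  using l2_finite_sumsI(1)[OF jac2_sum_bound[of _ "Abs_ell2 u" z]] assms by (simp add: Abs_ell2_inverse)

lemma coord_jop [simp]: "coord (jacobi_op a b z f) n = jac2 a b (coord f) n - z * coord f n"
  unfolding jacobi_op_def by (subst Abs_ell2_inverse[OF jac2_in_l2]) simp_all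

lemma norm_jop_le: "norm (jacobi_op a b z f) \<le> norm f * (3 * (M + norm z))"
proof -
  have "(norm (jacobi_op a b z f))\<^sup>2 \<le> (3 * (M + norm z) * norm f)\<^sup>2"
    unfolding norm_ell2_power2[of "jacobi_op a b z f"]
    by (rule l2_finite_sumsI(2)) (unfold coord_jop, rule jac2_sum_bound)
  then have "norm (jacobi_op a b z f) \<le> 3 * (M + norm z) * norm f"
    by (rule power2_le_imp_le) (use M_nonneg in simp)
  then show ?thesis by (simp add: mult.commute)
qed

lemma bounded_linear_jop: "bounded_linear (jacobi_op a b z)"
  by (rule bounded_linear_intro[OF _ _ norm_jop_le])
     (auto intro!: ell2_eqI simp: jac2_def algebra_simps scaleR_conv_of_real)

lemma jop_cscale: "jacobi_op a b z (cscale c f) = cscale c (jacobi_op a b z f)"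
  by (rule ell2_eqI) (simp add: jac2_def algebra_simps)

lemma jop_shift: "jacobi_op a b z f = jacobi_op a b w f - cscale (z - w) f"
  by (rule ell2_eqI) (simp add: algebra_simps)

lemma jop_adjoint: "inner (jacobi_op a b z f) g = inner f (jacobi_op a b (cnj z) g)"
proof -
  let ?f = "coord f" and ?g = "coord g"
  have summ: "(\<lambda>n. inner (c n * u (n + k)) (v (n + l))) summable_on UNIV"
    if "u \<in> l2" "v \<in> l2" "\<And>n. norm (c n) \<le> C" for u v :: "int \<Rightarrow> complex" and c C k l
    by (rule l2_inner_summable[OF l2_bounded_mult[OF l2_shift[OF that(1)] that(3)] l2_shift[OF that(2)]])
  have na: "norm (complex_of_real (a (n + k))) \<le> M" for n k by (simp add: a_bound)
  have nb: "norm (complex_of_real (b n) - z) \<le> M + norm z" for n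
    using norm_triangle_ineq4[of "of_real (b n)" z] b_bound[of n] by simp
  define S1 where "S1 n = inner (complex_of_real (a (n + (-1))) * ?f (n + (-1))) (?g (n + 0))" for n
  define S2 where "S2 n = inner ((complex_of_real (b n) - z) * ?f (n + 0)) (?g (n + 0))" for n
  define S3 where "S3 n = inner (complex_of_real (a (n + 0)) * ?f (n + 1)) (?g (n + 0))" for n
  have s: "S1 summable_on UNIV" "S2 summable_on UNIV" "S3 summable_on UNIV"
    unfolding S1_def S2_def S3_def by (rule summ[OF _ _ na] summ[OF _ _ nb]; simp)+
  have s': "(\<lambda>n. S1 (n + 1)) summable_on UNIV" "(\<lambda>n. S3 (n + (-1))) summable_on UNIV"
    unfolding S1_def S3_def using summ[of ?f ?g "\<lambda>n. complex_of_real (a (n + 0))" M 0 1]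
      summ[of ?f ?g "\<lambda>n. complex_of_real (a (n + (-1)))" M 0 "-1"] a_bound by simp_all
  have "inner (jacobi_op a b z f) g = (\<Sum>\<^sub>\<infinity>n. S1 n + S2 n + S3 n)"
    unfolding inner_ell2_coord
    by (intro infsum_cong) (simp add: S1_def S2_def S3_def jac2_def inner_add_left inner_diff_left algebra_simps)
  also have "\<dots> = infsum S1 UNIV + infsum S2 UNIV + infsum S3 UNIV"
    by (simp add: infsum_add summable_on_add s)
  \<comment> \<open>Moving the index of \<open>S1\<close> up and that of \<open>S3\<close> down
    turns each off-diagonal term acting on \<open>f\<close> into the opposite one acting on
    \<open>g\<close>.\<close>
  also have "\<dots> = (\<Sum>\<^sub>\<infinity>n. S1 (n + 1)) + infsum S2 UNIV + (\<Sum>\<^sub>\<infinity>n. S3 (n + (-1)))"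
    by (simp only: infsum_shift_int)
  also have "\<dots> = (\<Sum>\<^sub>\<infinity>n. S1 (n + 1) + S2 n + S3 (n + (-1)))"
    by (simp only: infsum_add summable_on_add s s')
  also have "\<dots> = inner f (jacobi_op a b (cnj z) g)"
    unfolding inner_ell2_coord
    by (intro infsum_cong) (simp add: S1_def S2_def S3_def jac2_def inner_complex_def algebra_simps)
  finally show ?thesis .
qed

lemma bij_jop_iff: "bij (jacobi_op a b z) \<longleftrightarrow> z \<notin> spectrum2 a b"
proof -
  have bij: "bij_betw coord UNIV l2"
    by (rule bij_betwI[where g = Abs_ell2]) (auto simp: coord_inverse Abs_ell2_inverse)
  let ?T = "\<lambda>u n. jac2 a b u n - z * u n"
  have co: "coord \<circ> jacobi_op a b z = ?T \<circ> coord" by (auto simp: fun_eq_iff)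
  have "bij (jacobi_op a b z) \<longleftrightarrow> bij_betw (coord \<circ> jacobi_op a b z) UNIV l2"
    using bij_betw_comp_iff2[OF bij, of "jacobi_op a b z" UNIV] by simp
  also have "\<dots> \<longleftrightarrow> bij_betw ?T l2 l2"
    unfolding co using bij_betw_comp_iff[OF bij, of ?T l2] by simp
  finally show ?thesis by (simp add: spectrum2_def)
qed

end

lemma jac2_green:
  fixes f g :: "int \<Rightarrow> complex"
  assumes "m \<le> n + 1"
  shows "(\<Sum>k=m..n. f k * jac2 a b g k - g k * jac2 a b f k) =
    of_real (a n) * (f n * g (n + 1) - g n * f (n + 1)) -
    of_real (a (m - 1)) * (f (m - 1) * g m - g (m - 1) * f m)"
proof -
  have "m - 1 \<le> n" using assms by simp
  then show ?thesis
  proof (induction n rule: int_ge_induct)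
    case base
    then show ?case by simp
  next
    case (step n)
    have "{m..n + 1} = insert (n + 1) {m..n}" using step.hyps by auto
    then show ?case using step.IH by (simp add: jac2_def algebra_simps)
  qed
qed

lemma l2_tendsto_0:
  assumes "u \<in> l2" and "inj h"
  shows "(\<lambda>N::nat. u (h N)) \<longlonglongrightarrow> 0"
proof -
  have "(\<lambda>i. (norm (u i))\<^sup>2) summable_on range h"
    using assms(1) unfolding l2_def by (auto intro: summable_on_subset_banach)
  then have "(\<lambda>N. (norm (u (h N)))\<^sup>2) summable_on UNIV"
    using assms(2) by (simp add: summable_on_reindex o_def)
  then have "summable (\<lambda>N. (norm (u (h N)))\<^sup>2)" by (rule summable_on_imp_summable)
  then have "(\<lambda>N. (norm (u (h N)))\<^sup>2) \<longlonglongrightarrow> 0" by (rule summable_LIMSEQ_zero)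
  then have "(\<lambda>N. sqrt ((norm (u (h N)))\<^sup>2)) \<longlonglongrightarrow> sqrt 0" by (intro tendsto_intros)
  then show ?thesis by (simp add: tendsto_norm_zero_iff)
qed

lemma sum_symmetric_tendsto_infsum:
  fixes f :: "int \<Rightarrow> real"
  assumes "f summable_on UNIV"
  shows "(\<lambda>N::nat. \<Sum>k=-int N..int N. f k) \<longlonglongrightarrow> infsum f UNIV"
proof -
  have "filterlim (\<lambda>N::nat. {-int N..int N}) (finite_subsets_at_top UNIV) sequentially"
    unfolding filterlim_finite_subsets_at_top
  proof (intro allI impI)
    fix X :: "int set" assume "finite X \<and> X \<subseteq> UNIV"
    then have "\<bar>k\<bar> \<le> Max (abs ` X)" if "k \<in> X" for k using that by simp
    then obtain B where B: "\<And>k. k \<in> X \<Longrightarrow> \<bar>k\<bar> \<le> B" by blast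
    show "\<forall>\<^sub>F N::nat in sequentially. finite {-int N..int N} \<and> X \<subseteq> {-int N..int N} \<and> {-int N..int N} \<subseteq> UNIV"
      by (rule eventually_sequentiallyI[of "nat B"]) (use B in force)
  qed
  then show ?thesis
    using filterlim_compose[OF infsum_tendsto[OF assms]] by blast
qed

lemma l2_bounded:
  assumes "u \<in> l2" obtains C where "\<And>k. norm (u k) \<le> C"
  using norm_coord_le[of "Abs_ell2 u"] assms by (metis Abs_ell2_inverse)

lemma delta_in_l2: "(\<lambda>k. if k = n then 1 else 0) \<in> l2"
  by (rule l2_finite_sumsI(1)[where B = 1]) (simp add: if_distrib[of norm] if_distrib[of "\<lambda>x. x\<^sup>2"] sum.delta cong: if_cong)

context bounded_jacobi
begin

lemma wronskian_tendsto_0: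
  assumes "(\<lambda>N. f (h N)) \<longlonglongrightarrow> 0" "(\<lambda>N. f (h N + 1)) \<longlonglongrightarrow> 0"
    and "(\<lambda>N. g (h N)) \<longlonglongrightarrow> 0" "(\<lambda>N. g (h N + 1)) \<longlonglongrightarrow> 0"
  shows "(\<lambda>N::nat. of_real (a (h N)) * (f (h N) * g (h N + 1) - g (h N) * f (h N + 1)) :: complex) \<longlonglongrightarrow> 0"
proof (rule tendsto_0_le)
  have "(\<lambda>N. f (h N) * g (h N + 1) - g (h N) * f (h N + 1)) \<longlonglongrightarrow> 0 * 0 - 0 * 0"
    by (intro tendsto_intros assms)
  then show "(\<lambda>N. f (h N) * g (h N + 1) - g (h N) * f (h N + 1)) \<longlonglongrightarrow> 0" by simp
  show "\<forall>\<^sub>F N in sequentially. norm (of_real (a (h N)) * (f (h N) * g (h N + 1) - g (h N) * f (h N + 1)) :: complex)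
      \<le> norm (f (h N) * g (h N + 1) - g (h N) * f (h N + 1)) * M"
    using a_bound by (auto simp: norm_mult mult.commute[of _ M] intro!: mult_right_mono always_eventually)
qed

text \<open>One decaying factor suffices: both boundary Wronskians vanish when \<open>f\<close>
  tends to 0 and \<open>g\<close> is merely bounded. This is what later excludes bounded solutions
  off the spectrum.\<close>

lemma green_bounded_l2:
  fixes f g :: "int \<Rightarrow> complex"
  assumes "f \<in> l2" and g: "\<And>k. norm (g k) \<le> C"
  shows "(\<lambda>N::nat. \<Sum>k=-int N..int N. f k * jac2 a b g k - g k * jac2 a b f k) \<longlonglongrightarrow> 0"
proof -
  have bw: "(\<lambda>N::nat. of_real (a (h N)) * (f (h N) * g (h N + 1) - g (h N) * f (h N + 1))) \<longlonglongrightarrow> 0"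
    if "inj h" for h
  proof (rule tendsto_0_le)
    have "inj (\<lambda>N. h N + 1)" using that by (auto simp: inj_on_def)
    then have "(\<lambda>N. norm (f (h N)) + norm (f (h N + 1))) \<longlonglongrightarrow> norm (0::complex) + norm (0::complex)"
      by (intro tendsto_intros l2_tendsto_0[OF assms(1)] that)
    then show "(\<lambda>N. norm (f (h N)) + norm (f (h N + 1))) \<longlonglongrightarrow> 0" by simp
    have "norm (of_real (a (h N)) * (f (h N) * g (h N + 1) - g (h N) * f (h N + 1)))
        \<le> norm (norm (f (h N)) + norm (f (h N + 1))) * (M * C)" for N
    proof -
      have "norm (f (h N) * g (h N + 1) - g (h N) * f (h N + 1)) \<le> norm (f (h N)) * C + C * norm (f (h N + 1))"
        by (rule order_trans[OF norm_triangle_ineq4])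
           (auto simp: norm_mult intro!: add_mono mult_left_mono mult_right_mono g)
      then have "\<bar>a (h N)\<bar> * norm (f (h N) * g (h N + 1) - g (h N) * f (h N + 1))
          \<le> M * (norm (f (h N)) * C + C * norm (f (h N + 1)))"
        by (intro mult_mono a_bound) (auto simp: M_nonneg)
      moreover have "norm (norm (f (h N)) + norm (f (h N + 1))) * (M * C) =
          M * (norm (f (h N)) * C + C * norm (f (h N + 1)))" by (simp add: algebra_simps)
      ultimately show ?thesis by (simp only: norm_mult norm_of_real)
    qed
    then show "\<forall>\<^sub>F N in sequentially. norm (of_real (a (h N)) * (f (h N) * g (h N + 1) - g (h N) * f (h N + 1)))
        \<le> norm (norm (f (h N)) + norm (f (h N + 1))) * (M * C)" by simp
  qed
  have "inj int" "inj (\<lambda>N::nat. - int N - 1)" by (auto simp: inj_on_def)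
  from bw[OF this(1)] bw[OF this(2)]
  have "(\<lambda>N::nat. of_real (a (int N)) * (f (int N) * g (int N + 1) - g (int N) * f (int N + 1)) -
      of_real (a (- int N - 1)) * (f (- int N - 1) * g (- int N) - g (- int N - 1) * f (- int N))) \<longlonglongrightarrow> 0 - 0"
    by (intro tendsto_diff) simp_all
  then show ?thesis by (subst jac2_green) auto
qed

text \<open>The one-sided version keeps the Wronskian at 0, from which the left Weyl ratio is
  read.\<close>

lemma green_left:
  fixes f g :: "int \<Rightarrow> complex"
  assumes f: "(\<lambda>k. if k \<le> 0 then f k else 0) \<in> l2" and g: "(\<lambda>k. if k \<le> 0 then g k else 0) \<in> l2"
  shows "(\<lambda>N::nat. \<Sum>k=-int N..0. f k * jac2 a b g k - g k * jac2 a b f k)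
    \<longlonglongrightarrow> of_real (a 0) * (f 0 * g 1 - g 0 * f 1)"
proof -
  have "inj (\<lambda>N::nat. - int N - 1)" "inj (\<lambda>N::nat. - int N)" by (auto simp: inj_on_def)
  note l = l2_tendsto_0[OF f this(1)] l2_tendsto_0[OF f this(2)] l2_tendsto_0[OF g this(1)] l2_tendsto_0[OF g this(2)]
  have "(\<lambda>N::nat. of_real (a (- int N - 1)) * (f (- int N - 1) * g ((- int N - 1) + 1)
      - g (- int N - 1) * f ((- int N - 1) + 1)) :: complex) \<longlonglongrightarrow> 0"
    by (rule wronskian_tendsto_0) (use l in simp_all)
  then have "(\<lambda>N::nat. of_real (a 0) * (f 0 * g 1 - g 0 * f 1) -
      of_real (a (- int N - 1)) * (f (- int N - 1) * g (- int N) - g (- int N - 1) * f (- int N)))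
      \<longlonglongrightarrow> of_real (a 0) * (f 0 * g 1 - g 0 * f 1) - 0"
    by (intro tendsto_diff tendsto_const) simp
  then show ?thesis by (subst jac2_green) auto
qed

text \<open>Paired with the square summable \<open>w\<close> solving
  \<open>(J - z) w = delta_n\<close>, the solution \<open>u\<close> leaves \<open>- u n\<close> as
  the whole Lagrange sum, and that sum tends to 0.\<close>

lemma resolvent_bounded_solution_zero:
  fixes u :: "int \<Rightarrow> complex"
  assumes z: "z \<notin> spectrum2 a b" and u: "\<And>k. norm (u k) \<le> C" "\<And>k. jac2 a b u k = z * u k"
  shows "u n = 0"
proof -
  let ?d = "\<lambda>k. if k = n then 1 else 0 :: complex"
  have "?d \<in> l2" by (rule delta_in_l2)
  then have "?d \<in> (\<lambda>u n. jac2 a b u n - z * u n) ` l2"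
    using z unfolding spectrum2_def bij_betw_def by auto
  then obtain w where "w \<in> l2" and eq: "?d = (\<lambda>k. jac2 a b w k - z * w k)" by blast
  then have w: "w \<in> l2" "\<And>k. jac2 a b w k - z * w k = ?d k"
    by (simp_all add: fun_cong[OF eq, symmetric])
  have "w k * jac2 a b u k - u k * jac2 a b w k = - (if k = n then u n else 0)" for k
    using w(2)[of k] u(2)[of k] by (auto simp: algebra_simps diff_eq_eq)
  then have "(\<lambda>N::nat. \<Sum>k=-int N..int N. - (if k = n then u n else 0)) \<longlonglongrightarrow> 0"
    using green_bounded_l2[OF w(1), of u C] u(1) by simp
  moreover have "\<forall>\<^sub>F N::nat in sequentially. (\<Sum>k=-int N..int N. - (if k = n then u n else 0)) = - u n"
    by (rule eventually_sequentiallyI[of "nat \<bar>n\<bar>"]) (auto simp: sum_negf sum.delta)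
  ultimately have "(\<lambda>N::nat. - u n) \<longlonglongrightarrow> 0" using tendsto_cong by fastforce
  then show ?thesis by (simp add: LIMSEQ_const_iff)
qed

end

lemma cnj_jac2: "jac2 a b (\<lambda>k. cnj (u k)) n = cnj (jac2 a b u n)"
  by (simp add: jac2_def)

definition delta_vec :: "int \<Rightarrow> int ell2" where
  "delta_vec n = Abs_ell2 (\<lambda>k. if k = n then 1 else 0)"

lemma coord_delta_vec [simp]: "coord (delta_vec n) k = (if k = n then 1 else 0)"
  by (simp add: delta_vec_def Abs_ell2_inverse[OF delta_in_l2])

lemma norm_delta_vec_ge: "norm (delta_vec n) \<ge> 1"
  using norm_coord_le[of "delta_vec n" n] by simp

lemma inner_delta_vec: "inner f (delta_vec n) = Re (coord f n)"
proof -
  have "inner f (delta_vec n) = (\<Sum>\<^sub>\<infinity>k. inner (coord f k) (coord (delta_vec n) k))" by (rule inner_ell2_coord)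
  also have "\<dots> = (\<Sum>\<^sub>\<infinity>k\<in>{n}. inner (coord f k) (coord (delta_vec n) k))"
    by (rule infsum_cong_neutral) auto
  also have "\<dots> = Re (coord f n)" by (simp add: inner_complex_def)
  finally show ?thesis .
qed

section \<open>Green functions off the spectrum\<close>

locale gap_jacobi = bounded_jacobi +
  fixes e :: "real set"
  assumes a_pos: "0 < a n" and spec: "spectrum2 a b = complex_of_real ` e" and closed_e: "closed e"
begin

definition grn :: "int \<Rightarrow> complex \<Rightarrow> int ell2" where
  "grn n z = inv (jacobi_op a b z) (delta_vec n)"

abbreviation "G m n z \<equiv> coord (grn n z) m"

lemma not_spec_iff: "z \<notin> complex_of_real ` e \<longleftrightarrow> bij (jacobi_op a b z)"
  using bij_jop_iff spec by simp

lemma nonreal_not_spec: "Im z \<noteq> 0 \<Longrightarrow> z \<notin> complex_of_real ` e"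
  by auto

lemma cnj_not_spec: "z \<notin> complex_of_real ` e \<Longrightarrow> cnj z \<notin> complex_of_real ` e"
  by (metis complex_cnj_cnj complex_cnj_complex_of_real image_iff)

context
  fixes z assumes z: "z \<notin> complex_of_real ` e"
begin

lemma jop_grn: "jacobi_op a b z (grn n z) = delta_vec n"
  unfolding grn_def using z not_spec_iff by (metis bij_is_surj surj_f_inv_f)

lemma jop_unique: "jacobi_op a b z f = jacobi_op a b z g \<Longrightarrow> f = g"
  using z not_spec_iff by (metis bij_is_inj injD)

lemma jac2_grn: "jac2 a b (coord (grn n z)) k = z * G k n z + (if k = n then 1 else 0)"
  using arg_cong[OF jop_grn[of n], of "\<lambda>f. coord f k"] by (simp add: algebra_simps diff_eq_eq)

lemma green2_eq: "green2 a b n z = G n n z"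
proof -
  have "(THE u. u \<in> l2 \<and> (\<forall>k. jac2 a b u k - z * u k = (if k = n then 1 else 0))) = coord (grn n z)"
  proof (rule the_equality)
    show "coord (grn n z) \<in> l2 \<and> (\<forall>k. jac2 a b (coord (grn n z)) k - z * coord (grn n z) k = (if k = n then 1 else 0))"
      by (simp add: jac2_grn)
    fix u assume u: "u \<in> l2 \<and> (\<forall>k. jac2 a b u k - z * u k = (if k = n then 1 else 0))"
    then have c: "coord (Abs_ell2 u) = u" by (simp add: Abs_ell2_inverse)
    have "Abs_ell2 u = grn n z"
      by (rule jop_unique, rule ell2_eqI) (use u in \<open>simp add: c jop_grn\<close>)
    then show "u = coord (grn n z)" using c by simp
  qed
  then show ?thesis by (simp add: green2_def)
qed

text \<open>Lagrange identity for columns \<open>n\<close> and \<open>m\<close>: each delta picks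
  out one entry of the other column.\<close>

lemma G_sym: "G m n z = G n m z"
proof -
  let ?f = "coord (grn n z)" and ?g = "coord (grn m z)"
  obtain C where "\<And>k. norm (?g k) \<le> C" using l2_bounded[of ?g] by auto
  then have "(\<lambda>N::nat. \<Sum>k=-int N..int N. ?f k * jac2 a b ?g k - ?g k * jac2 a b ?f k) \<longlonglongrightarrow> 0"
    by (intro green_bounded_l2) auto
  moreover have "?f k * jac2 a b ?g k - ?g k * jac2 a b ?f k = (if k = m then ?f m else 0) - (if k = n then ?g n else 0)" for k
    by (auto simp: jac2_grn algebra_simps)
  ultimately have "(\<lambda>N::nat. \<Sum>k=-int N..int N. (if k = m then ?f m else 0) - (if k = n then ?g n else 0)) \<longlonglongrightarrow> 0" by simp
  moreover have "\<forall>\<^sub>F N::nat in sequentially. (\<Sum>k=-int N..int N. (if k = m then ?f m else 0) - (if k = n then ?g n else 0)) = ?f m - ?g n"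
    by (rule eventually_sequentiallyI[of "nat \<bar>n\<bar> + nat \<bar>m\<bar>"]) (auto simp: sum_subtractf sum.delta)
  ultimately have "(\<lambda>N::nat. ?f m - ?g n) \<longlonglongrightarrow> 0" using tendsto_cong by fastforce
  then show ?thesis by (simp add: LIMSEQ_const_iff)
qed

text \<open>Lagrange identity for a column and its complex conjugate.\<close>

lemma Im_G: "Im (G n n z) = Im z * (norm (grn n z))\<^sup>2"
proof -
  let ?f = "coord (grn n z)" let ?g = "\<lambda>k. cnj (?f k)"
  obtain C where "\<And>k. norm (?f k) \<le> C" using l2_bounded[of ?f] by auto
  then have lim: "(\<lambda>N::nat. \<Sum>k=-int N..int N. ?f k * jac2 a b ?g k - ?g k * jac2 a b ?f k) \<longlonglongrightarrow> 0"
    by (intro green_bounded_l2[where C = C]) auto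
  have "Im (?f k * jac2 a b ?g k - ?g k * jac2 a b ?f k) = 2 * (if k = n then Im (?f n) else 0) - 2 * (Im z * (norm (?f k))\<^sup>2)" for k
    unfolding cnj_jac2 jac2_grn cmod_power2 by (simp add: algebra_simps power2_eq_square)
  then have "(\<lambda>N::nat. \<Sum>k=-int N..int N. 2 * (if k = n then Im (?f n) else 0) - 2 * (Im z * (norm (?f k))\<^sup>2)) \<longlonglongrightarrow> 0"
    using tendsto_Im[OF lim] by simp
  moreover have "\<forall>\<^sub>F N::nat in sequentially. (\<Sum>k=-int N..int N. 2 * (if k = n then Im (?f n) else 0) - 2 * (Im z * (norm (?f k))\<^sup>2))
      = 2 * Im (?f n) - 2 * Im z * (\<Sum>k=-int N..int N. (norm (?f k))\<^sup>2)"
    by (rule eventually_sequentiallyI[of "nat \<bar>n\<bar>"]) (auto simp: sum_subtractf sum.delta sum_distrib_left[symmetric])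
  ultimately have "(\<lambda>N::nat. 2 * Im (?f n) - 2 * Im z * (\<Sum>k=-int N..int N. (norm (?f k))\<^sup>2)) \<longlonglongrightarrow> 0"
    using tendsto_cong by fastforce
  moreover have "(\<lambda>N::nat. 2 * Im (?f n) - 2 * Im z * (\<Sum>k=-int N..int N. (norm (?f k))\<^sup>2)) \<longlonglongrightarrow>
      2 * Im (?f n) - 2 * Im z * (norm (grn n z))\<^sup>2"
    unfolding norm_ell2_power2 by (intro tendsto_intros sum_symmetric_tendsto_infsum ell2_summable)
  ultimately show ?thesis using LIMSEQ_unique by fastforce
qed

lemma G_cnj: "G n n (cnj z) = cnj (G n n z)"
proof -
  define f where "f = Abs_ell2 (\<lambda>k. cnj (G k n z))"
  have "(\<lambda>k. cnj (G k n z)) \<in> l2" by (rule l2_dominated[where C = 1 and u = "coord (grn n z)"]) auto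
  then have f: "coord f = (\<lambda>k. cnj (G k n z))" by (simp add: f_def Abs_ell2_inverse)
  have "jacobi_op a b (cnj z) f = delta_vec n"
    by (rule ell2_eqI) (simp add: f cnj_jac2 jac2_grn)
  then have "grn n (cnj z) = f"
    unfolding grn_def using cnj_not_spec[OF z] not_spec_iff by (metis bij_is_inj inv_f_f)
  then show ?thesis by (simp add: f)
qed

lemma grn_norm_lower: "1 \<le> norm (grn n z) * (3 * (M + norm z))"
  using norm_jop_le[of z "grn n z"] norm_delta_vec_ge[of n] by (simp add: jop_grn)

end

lemma grn_norm_upper:
  assumes "Im z \<noteq> 0" shows "norm (grn n z) \<le> 1 / \<bar>Im z\<bar>"
proof -
  note z = nonreal_not_spec[OF assms]
  have "\<bar>Im z\<bar> * (norm (grn n z))\<^sup>2 = \<bar>Im (G n n z)\<bar>"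
    unfolding Im_G[OF z] by (simp add: abs_mult)
  also have "\<dots> \<le> norm (grn n z)"
    using abs_Im_le_cmod norm_coord_le by (rule order_trans)
  finally have "\<bar>Im z\<bar> * norm (grn n z) * norm (grn n z) \<le> 1 * norm (grn n z)"
    by (simp add: power2_eq_square mult.assoc)
  moreover have "norm (grn n z) > 0"
    using grn_norm_lower[OF z, of n] by (cases "grn n z = 0") auto
  ultimately have "\<bar>Im z\<bar> * norm (grn n z) \<le> 1" by (simp add: mult_le_cancel_right)
  then show ?thesis using assms by (simp add: field_simps)
qed

lemma G_upper: "Im z \<noteq> 0 \<Longrightarrow> norm (G n n z) \<le> 1 / \<bar>Im z\<bar>"
  using norm_coord_le grn_norm_upper by (rule order_trans)

text \<open>\<open>J - z\<close> has norm at most \<open>3 * (M + norm z)\<close> and sends the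
  column to a unit vector, so the column cannot be small. The linear decay in \<open>Im z\<close>
  limits the zeros of the Green function at a band edge, as \<open>G_upper\<close> limits its
  poles.\<close>

lemma Im_G_lower:
  assumes "Im z > 0" shows "Im z / (3 * (M + norm z))\<^sup>2 \<le> Im (G n n z)"
proof -
  have z: "z \<notin> complex_of_real ` e" using assms by (intro nonreal_not_spec) simp
  have K: "3 * (M + norm z) > 0"
    using assms M_nonneg by (intro mult_pos_pos add_nonneg_pos) auto
  have "1 / (3 * (M + norm z)) \<le> norm (grn n z)"
    using grn_norm_lower[OF z, of n] K by (subst pos_divide_le_eq) auto
  then have "(1 / (3 * (M + norm z)))\<^sup>2 \<le> (norm (grn n z))\<^sup>2" using K by (intro power_mono) auto
  then have "Im z * (1 / (3 * (M + norm z)))\<^sup>2 \<le> Im z * (norm (grn n z))\<^sup>2"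
    using assms by (intro mult_left_mono) auto
  then show ?thesis by (simp add: Im_G[OF z] power_divide)
qed

lemma Im_G_pos: "Im z > 0 \<Longrightarrow> Im (G n n z) > 0"
  using Im_G_lower[of z n] M_nonneg
  by (smt (verit) divide_pos_pos norm_ge_zero zero_less_power2 norm_le_zero_iff Im_G_lower zero_complex.simps(2))

lemma open_not_spec: "open (- complex_of_real ` e)"
proof -
  have "complex_of_real ` e = {z. Im z = 0} \<inter> Re -` e"
    by (auto simp: complex_eq_iff image_iff)
  moreover have "closed (Re -` e)"
    by (intro closed_vimage closed_e continuous_intros)
  ultimately show ?thesis by (simp add: open_closed closed_Int closed_halfspace_Im_eq)
qed

text \<open>The derivative is the \<open>n\<close>-th coordinate of \<open>q\<close>, the preimage
  of \<open>grn n z0\<close> under \<open>J - z0\<close>. The lower bound for \<open>J - z0\<close>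
  persists with half the constant when \<open>|z - z0| < c / 2\<close>.\<close>

lemma G_holomorphic: "(\<lambda>z. G n n z) holomorphic_on (- complex_of_real ` e)"
  unfolding holomorphic_on_open[OF open_not_spec]
proof
  fix z0 assume "z0 \<in> - complex_of_real ` e"
  then have z0: "z0 \<notin> complex_of_real ` e" by simp
  have surj: "surj (jacobi_op a b z0)" using z0 not_spec_iff bij_is_surj by blast
  have "surj (jacobi_op a b (cnj z0))" using cnj_not_spec[OF z0] not_spec_iff bij_is_surj by blast
  then obtain c where c: "c > 0" "\<And>f. c * norm f \<le> norm (jacobi_op a b z0 f)"
    using surj_adjoint_bounded_below[of "jacobi_op a b z0" "jacobi_op a b (cnj z0)"] jop_adjoint by blast
  obtain q where q: "jacobi_op a b z0 q = grn n z0" using surj by (metis surjD)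
  obtain r where r: "r > 0" "\<And>z. dist z z0 < r \<Longrightarrow> z \<notin> complex_of_real ` e"
    using open_not_spec \<open>z0 \<in> _\<close> unfolding open_dist by (metis ComplD)
  define s where "s = min r (c / 2)"
  have "s > 0" using r c by (simp add: s_def)
  have bd: "norm ((G n n z - G n n z0) / (z - z0) - coord q n) \<le> 2 / c * norm q * norm (z - z0)"
    if "dist z z0 < s" "z \<noteq> z0" for z
  proof -
    have zr: "z \<notin> complex_of_real ` e" using r(2) that by (simp add: s_def)
    have zc: "norm (z - z0) < c / 2" using that by (simp add: s_def dist_norm)
    \<comment> \<open>The second-order remainder of the column; \<open>J - z\<close> maps it to
      \<open>(z - z0)^2 q\<close>.\<close>
    define d where "d = grn n z - grn n z0 - cscale (z - z0) q"
    have low: "c / 2 * norm f \<le> norm (jacobi_op a b z f)" for f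
    proof -
      have "c * norm f \<le> norm (jacobi_op a b z f + cscale (z - z0) f)"
        using c(2)[of f] jop_shift[of z f z0] by simp
      also have "\<dots> \<le> norm (jacobi_op a b z f) + norm (z - z0) * norm f"
        by (metis norm_triangle_ineq norm_cscale)
      also have "\<dots> \<le> norm (jacobi_op a b z f) + c / 2 * norm f"
        using zc by (intro add_left_mono mult_right_mono) auto
      finally show ?thesis by (simp add: algebra_simps)
    qed
    have e0: "jacobi_op a b z (grn n z0) = delta_vec n - cscale (z - z0) (grn n z0)"
      unfolding jop_shift[of z _ z0] jop_grn[OF z0] ..
    have eq: "jacobi_op a b z q = grn n z0 - cscale (z - z0) q"
      unfolding jop_shift[of z _ z0] q ..
    have "jacobi_op a b z d = cscale ((z - z0)\<^sup>2) q"
      unfolding d_def linear_diff[OF bounded_linear.linear[OF bounded_linear_jop]] jop_grn[OF zr] e0 jop_cscale eq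
      by (rule ell2_eqI) (simp add: algebra_simps power2_eq_square)
    then have "c / 2 * norm d \<le> (norm (z - z0))\<^sup>2 * norm q"
      using low[of d] by (simp add: norm_cscale norm_power)
    then have nd: "norm d \<le> 2 / c * norm q * (norm (z - z0))\<^sup>2" using c by (simp add: field_simps)
    have "(G n n z - G n n z0) / (z - z0) - coord q n = coord d n / (z - z0)"
      using that by (simp add: d_def field_simps)
    then have "norm ((G n n z - G n n z0) / (z - z0) - coord q n) = norm (coord d n) / norm (z - z0)"
      by (simp add: norm_divide)
    also have "\<dots> \<le> (2 / c * norm q * (norm (z - z0))\<^sup>2) / norm (z - z0)"
      using nd norm_coord_le[of d n] by (intro divide_right_mono) auto
    also have "\<dots> = 2 / c * norm q * norm (z - z0)" using that by (simp add: power2_eq_square)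
    finally show ?thesis .
  qed
  have "((\<lambda>z. (G n n z - G n n z0) / (z - z0) - coord q n) \<longlongrightarrow> 0) (at z0)"
  proof (rule Lim_null_comparison)
    show "\<forall>\<^sub>F z in at z0. norm ((G n n z - G n n z0) / (z - z0) - coord q n) \<le> 2 / c * norm q * norm (z - z0)"
      unfolding eventually_at using bd \<open>s > 0\<close> by blast
    have "((\<lambda>z. 2 / c * norm q * norm (z - z0)) \<longlongrightarrow> 2 / c * norm q * norm (z0 - z0)) (at z0)"
      by (intro tendsto_intros)
    then show "((\<lambda>z. 2 / c * norm q * norm (z - z0)) \<longlongrightarrow> 0) (at z0)" by simp
  qed
  then have "((\<lambda>z. (G n n z - G n n z0) / (z - z0)) \<longlongrightarrow> coord q n) (at z0)"
    by (rule LIM_zero_cancel)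
  then show "\<exists>D. ((\<lambda>z. G n n z) has_field_derivative D) (at z0)"
    by (auto simp: has_field_derivative_iff)
qed

end

section \<open>Reflection across imaginary boundary values\<close>

abbreviation (input) ray :: "real \<Rightarrow> real \<Rightarrow> complex" where
  "ray x t \<equiv> complex_of_real x + \<i> * complex_of_real t"

lemma tendsto_vertical_seq:
  "(\<lambda>n. z + \<i> * complex_of_real (inverse (real (Suc n)))) \<longlonglongrightarrow> z"
proof -
  have "(\<lambda>n. z + \<i> * complex_of_real (inverse (real (Suc n)))) \<longlonglongrightarrow> z + \<i> * complex_of_real 0"
    by (intro tendsto_intros LIMSEQ_inverse_real_of_nat)
  then show ?thesis by simp
qed

text \<open>The function \<open>B = 1 / (g + i)\<close> is bounded, so its primitive is Lipschitz up to the real axis; the real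
  part of the primitive is constant on the interval by dominated convergence, and the Schwarz
  reflection principle applies to the primitive. The maximum principle keeps the extension of \<open>B\<close>
  inside the open disc that is the image of the upper half plane.\<close>

lemma holomorphic_imaginary_boundary_reflection:
  fixes g :: "complex \<Rightarrow> complex" and c d :: real
  assumes hol: "g holomorphic_on {z. 0 < Im z}" and pos: "\<And>z. 0 < Im z \<Longrightarrow> 0 < Im (g z)"
    and "c < d"
    and bdry: "AE x in lborel. x \<in> {c<..<d} \<longrightarrow>
      (\<exists>L. ((\<lambda>eps. g (ray x eps)) \<longlongrightarrow> L) (at_right 0) \<and> Re L = 0)"
  obtains h where "h holomorphic_on {z. Re z \<in> {c<..<d}}"
    "\<And>z. Re z \<in> {c<..<d} \<Longrightarrow> 0 < Im z \<Longrightarrow> h z = g z"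
    "\<And>z. Re z \<in> {c<..<d} \<Longrightarrow> h (cnj z) = - cnj (h z)"
    "\<And>z. Re z \<in> {c<..<d} \<Longrightarrow> 0 < Im (h z)"
proof -
  define U where "U = {z::complex. 0 < Im z}"
  define S where "S = {z::complex. Re z \<in> {c<..<d}}"
  define B where "B z = 1 / (g z + \<i>)" for z
  have U: "open U" "convex U"
    by (auto simp: U_def open_halfspace_Im_gt convex_halfspace_Im_gt)
  have "S = {z. c < Re z} \<inter> {z. Re z < d}" by (auto simp: S_def)
  then have S: "open S" "convex S"
    by (auto intro!: open_Int convex_Int open_halfspace_Re_gt open_halfspace_Re_lt
        convex_halfspace_Re_gt convex_halfspace_Re_lt)
  have conS: "connected S" using S(2) by (rule convex_connected)
  have nz: "g z + \<i> \<noteq> 0" if "z \<in> U" for z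
    using pos[of z] that by (auto simp: U_def complex_eq_iff)
  have holB: "B holomorphic_on U"
    unfolding B_def using hol nz by (intro holomorphic_intros) (auto simp: U_def)
  \<comment> \<open>Inversion carries \<open>Im w > 1\<close> into the disc of radius 1/2 about
    \<open>- i / 2\<close>; in terms of \<open>w\<close> this says that \<open>w\<close> is closer
    to \<open>2 i\<close> than to 0.\<close>
  have Bball: "norm (B z + \<i>/2) < 1/2" if "z \<in> U" for z
  proof -
    define w where "w = g z + \<i>"
    have "Im w > 1" using pos[of z] that by (simp add: w_def U_def)
    then have "w \<noteq> 0" by auto
    have "(norm (w - 2 * \<i>))\<^sup>2 < (norm w)\<^sup>2"
      using \<open>Im w > 1\<close> unfolding cmod_power2 by (simp add: power2_eq_square algebra_simps)
    then have lt: "norm (w - 2 * \<i>) < norm w" by (rule power2_less_imp_less) simp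
    have "B z = 1 / w" by (simp add: B_def w_def)
    then have "B z + \<i>/2 = (\<i> / 2) * ((w - 2 * \<i>) / w)"
      using \<open>w \<noteq> 0\<close> by (simp add: field_simps)
    then have "norm (B z + \<i>/2) = 1/2 * (norm (w - 2 * \<i>) / norm w)"
      by (simp add: norm_mult norm_divide)
    also have "\<dots> < 1/2" using lt \<open>w \<noteq> 0\<close> by simp
    finally show ?thesis .
  qed
  have Bnorm: "norm (B z) \<le> 1" if "z \<in> U" for z
  proof -
    have "norm (B z) \<le> norm (B z + \<i>/2) + norm (\<i>/2)"
      using norm_triangle_ineq4[of "B z + \<i>/2" "\<i>/2"] by simp
    then show ?thesis using Bball[OF that] by (simp add: norm_divide)
  qed
  obtain P where P: "\<And>z. z \<in> U \<Longrightarrow> (P has_field_derivative B z) (at z within U)"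
    using holomorphic_convex_primitive'[OF U(2) U(1) holB] by blast
  then have P': "(P has_field_derivative B z) (at z)" if "z \<in> U" for z
    using that U(1) by (metis at_within_open)
  have lip: "norm (P z - P w) \<le> 1 * norm (z - w)" if "z \<in> U" "w \<in> U" for z w
    by (rule field_differentiable_bound[OF U(2) P Bnorm that])
  have "uniformly_continuous_on U P"
    unfolding uniformly_continuous_on_def
  proof (intro allI impI)
    fix e :: real assume "e > 0"
    have "dist (P z) (P w) < e" if "z \<in> U" "w \<in> U" "dist z w < e" for z w
      using lip[OF that(1,2)] that(3) by (simp add: dist_norm)
    then show "\<exists>d>0. \<forall>x\<in>U. \<forall>x'\<in>U. dist x' x < d \<longrightarrow> dist (P x') (P x) < e"
      using \<open>e > 0\<close> by blast
  qed
  then obtain Q where Q: "uniformly_continuous_on (closure U) Q" "\<And>z. z \<in> U \<Longrightarrow> P z = Q z"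
    by (metis uniformly_continuous_on_extension_on_closure)
  have upU: "z + \<i> * complex_of_real (inverse (real (Suc n))) \<in> U" if "0 \<le> Im z" for z n
    using that by (simp add: U_def add_nonneg_pos)
  have clU: "{z. 0 \<le> Im z} \<subseteq> closure U"
  proof
    fix z :: complex assume "z \<in> {z. 0 \<le> Im z}"
    then show "z \<in> closure U"
      unfolding closure_sequential using upU[of z] tendsto_vertical_seq[of z]
      by (intro exI[of _ "\<lambda>n. z + \<i> * complex_of_real (inverse (real (Suc n)))"]) auto
  qed
  have contQ: "continuous_on {z. 0 \<le> Im z} Q"
    using Q(1) clU by (meson continuous_on_subset uniformly_continuous_imp_continuous)
  have Qlim: "(\<lambda>n. P (z + \<i> * complex_of_real (inverse (real (Suc n))))) \<longlonglongrightarrow> Q z"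
    if "0 \<le> Im z" for z
  proof -
    have "(\<lambda>n. Q (z + \<i> * complex_of_real (inverse (real (Suc n))))) \<longlonglongrightarrow> Q z"
      by (rule continuous_on_tendsto_compose[OF contQ tendsto_vertical_seq])
         (use that in \<open>auto intro!: always_eventually\<close>)
    then show ?thesis using Q(2) upU[OF that] by simp
  qed
  \<comment> \<open>Fundamental theorem of calculus on the horizontal segments at height
    \<open>1 / (n + 1)\<close>. The integrand \<open>Re B\<close> tends to 0 almost everywhere,
    because \<open>1 / (L + i)\<close> is imaginary for imaginary \<open>L\<close>, and
    \<open>|B| \<le> 1\<close> dominates.\<close>
  have Reconst: "Re (Q (complex_of_real x2)) = Re (Q (complex_of_real x1))"
    if x: "c < x1" "x1 \<le> x2" "x2 < d" for x1 x2
  proof -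
    define p where "p n t = complex_of_real t + \<i> * complex_of_real (inverse (real (Suc n)))" for n t
    define f where "f n t = indicator {x1..x2} t *\<^sub>R Re (B (p n t))" for n t
    have pU: "p n t \<in> U" for n t using upU[of "complex_of_real t" n] by (simp add: p_def)
    have contp: "continuous_on A (p n)" for A n unfolding p_def by (intro continuous_intros)
    have contB: "continuous_on A (\<lambda>t. B (p n t))" for A n
      by (rule continuous_on_compose2[OF holomorphic_on_imp_continuous_on[OF holB] contp])
         (use pU in auto)
    have int: "integral\<^sup>L lborel (f n) = Re (P (p n x2)) - Re (P (p n x1))" for n
      unfolding f_def
    proof (rule integral_FTC_atLeastAtMost)
      fix t assume "x1 \<le> t" "t \<le> x2"
      have "(p n has_vector_derivative 1) (at t)"
        unfolding p_def by (auto intro!: derivative_eq_intros)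
      then have "((P \<circ> p n) has_vector_derivative (1 * B (p n t))) (at t)"
        by (rule field_vector_diff_chain_at) (rule P'[OF pU])
      then have "((\<lambda>t. P (p n t)) has_vector_derivative B (p n t)) (at t within {x1..x2})"
        by (simp add: o_def has_vector_derivative_at_within)
      then show "((\<lambda>t. Re (P (p n t))) has_vector_derivative Re (B (p n t))) (at t within {x1..x2})"
        by (rule bounded_linear.has_vector_derivative[OF bounded_linear_Re])
    qed (use x in \<open>auto intro!: continuous_intros contB\<close>)
    have "(\<lambda>n. integral\<^sup>L lborel (f n)) \<longlonglongrightarrow> integral\<^sup>L lborel (\<lambda>_::real. 0::real)"
    proof (rule integral_dominated_convergence[where w = "indicator {x1..x2}"])
      show "f n \<in> borel_measurable lborel" for n
      proof -
        have "(\<lambda>t. indicator {x1..x2} t *\<^sub>R Re (B (p n t))) \<in> borel_measurable borel"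
          by (intro borel_measurable_continuous_on_indicator continuous_intros contB) simp
        then show ?thesis by (simp add: f_def[abs_def])
      qed
      show "integrable lborel (indicator {x1..x2} :: real \<Rightarrow> real)"
        by (simp add: integrable_indicator_iff emeasure_lborel_Icc_eq)
      show "AE t in lborel. norm (f n t) \<le> indicator {x1..x2} t" for n
      proof (rule AE_I2)
        fix t show "norm (f n t) \<le> indicator {x1..x2} t"
          using abs_Re_le_cmod[of "B (p n t)"] Bnorm[OF pU, of n t]
          by (auto simp: f_def indicator_def)
      qed
      show "AE t in lborel. (\<lambda>n. f n t) \<longlonglongrightarrow> 0"
        using bdry
      proof (rule AE_mp, intro AE_I2 impI)
        fix t
        assume a: "t \<in> {c<..<d} \<longrightarrow>
          (\<exists>L. ((\<lambda>eps. g (complex_of_real t + \<i> * complex_of_real eps)) \<longlongrightarrow> L) (at_right 0) \<and> Re L = 0)"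
        show "(\<lambda>n. f n t) \<longlonglongrightarrow> 0"
        proof (cases "t \<in> {x1..x2}")
          case True
          then obtain L where L: "((\<lambda>eps. g (complex_of_real t + \<i> * complex_of_real eps)) \<longlongrightarrow> L) (at_right 0)" "Re L = 0"
            using a x by auto
          have "filterlim (\<lambda>n. inverse (real (Suc n))) (at_right 0) sequentially"
            unfolding filterlim_at using LIMSEQ_inverse_real_of_nat by auto
          then have gl: "(\<lambda>n. g (p n t)) \<longlonglongrightarrow> L"
            unfolding p_def by (rule filterlim_compose[OF L(1)])
          have "Im L \<ge> 0"
            by (rule tendsto_lowerbound[OF tendsto_Im[OF gl]])
               (use pos pU in \<open>auto simp: U_def less_imp_le\<close>)
          then have "L + \<i> \<noteq> 0" by (auto simp: complex_eq_iff)
          then have "(\<lambda>n. Re (B (p n t))) \<longlonglongrightarrow> Re (1 / (L + \<i>))"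
            unfolding B_def by (intro tendsto_intros gl)
          moreover have "Re (1 / (L + \<i>)) = 0" using L(2) by (simp add: Re_divide)
          ultimately show ?thesis using True by (simp add: f_def)
        qed (simp add: f_def)
      qed
    qed simp_all
    then have "(\<lambda>n. Re (P (p n x2)) - Re (P (p n x1))) \<longlonglongrightarrow> 0" by (simp add: int)
    moreover have "(\<lambda>n. Re (P (p n x2)) - Re (P (p n x1))) \<longlonglongrightarrow>
        Re (Q (complex_of_real x2)) - Re (Q (complex_of_real x1))"
      unfolding p_def by (intro tendsto_intros Qlim) auto
    ultimately show ?thesis using LIMSEQ_unique by fastforce
  qed
  define x0 where "x0 = complex_of_real ((c + d) / 2)"
  \<comment> \<open>Rotation by \<open>i\<close> turns the constancy of \<open>Re Q\<close> on the
    interval into real boundary values, as Schwarz reflection requires.\<close>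
  define f where "f z = \<i> * (Q z - Q x0)" for z
  define F where "F z = (if 0 \<le> Im z then f z else cnj (f (cnj z)))" for z
  have freal: "f z \<in> \<real>" if "z \<in> S" "z \<in> \<real>" for z
  proof -
    obtain x where x: "z = complex_of_real x" using \<open>z \<in> \<real>\<close> by (auto elim: Reals_cases)
    then have "c < x" "x < d" using \<open>z \<in> S\<close> by (auto simp: S_def)
    then have "Re (Q z) = Re (Q x0)"
      using Reconst[of x "(c+d)/2"] Reconst[of "(c+d)/2" x] \<open>c < d\<close> unfolding x x0_def
      by (cases "x \<le> (c+d)/2") auto
    then show ?thesis by (simp add: f_def complex_is_Real_iff)
  qed
  have Qder: "(Q has_field_derivative B z) (at z)" if "z \<in> U" for z
    using has_field_derivative_transform_within_open[OF P'[OF that] U(1) that Q(2)] by blast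
  have fder: "(f has_field_derivative \<i> * B z) (at z)" if "z \<in> U" for z
    unfolding f_def using Qder[OF that] by (auto intro!: derivative_eq_intros)
  have Fder: "(F has_field_derivative \<i> * B z) (at z)" if "z \<in> U" for z
    by (rule has_field_derivative_transform_within_open[OF fder[OF that] U(1) that])
       (auto simp: F_def U_def)
  have Fhol: "F holomorphic_on S"
    unfolding F_def
  proof (rule Schwarz_reflection[OF S(1)])
    show "cnj ` S \<subseteq> S" by (auto simp: S_def)
    show "f holomorphic_on S \<inter> {z. 0 < Im z}"
      using fder U_def by (meson IntD2 field_differentiable_at_within field_differentiable_def holomorphic_onI)
    show "continuous_on (S \<inter> {z. 0 \<le> Im z}) f"
      unfolding f_def by (intro continuous_intros continuous_on_subset[OF contQ]) auto
  qed (rule freal)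
  \<comment> \<open>Undoes the rotation: \<open>F' = i B\<close> above the axis, so \<open>b\<close>
    continues \<open>B\<close> to the whole strip.\<close>
  define b where "b z = - \<i> * deriv F z" for z
  have bhol: "b holomorphic_on S"
    unfolding b_def by (intro holomorphic_intros holomorphic_deriv Fhol S)
  have bB: "b z = B z" if "z \<in> U" for z
    using DERIV_imp_deriv[OF Fder[OF that]] by (simp add: b_def)
  have Fcnj: "F (cnj z) = cnj (F z)" if "z \<in> S" for z
  proof -
    consider "Im z > 0" | "Im z < 0" | "Im z = 0" by linarith
    then show ?thesis
    proof cases
      case 3
      then have "z \<in> \<real>" by (simp add: complex_is_Real_iff)
      then have "cnj z = z" "f z \<in> \<real>" using freal[OF that] Reals_cnj_iff by auto
      then show ?thesis by (simp add: F_def 3 Reals_cnj_iff)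
    qed (auto simp: F_def)
  qed
  have cnjS: "cnj z \<in> S" if "z \<in> S" for z using that by (simp add: S_def)
  have bcnj: "b (cnj z) = - cnj (b z)" if "z \<in> S" for z
  proof -
    have "(F has_field_derivative deriv F z) (at z)"
      by (rule holomorphic_derivI[OF Fhol S(1) that])
    then have "((cnj \<circ> F \<circ> cnj) has_field_derivative cnj (deriv F z)) (at (cnj z))"
      using has_field_derivative_cnj_cnj[of F "deriv F z" "cnj z"] by simp
    then have "(F has_field_derivative cnj (deriv F z)) (at (cnj z))"
      by (rule has_field_derivative_transform_within_open[OF _ S(1) cnjS[OF that]])
         (use Fcnj cnjS in fastforce)
    then show ?thesis by (simp add: b_def DERIV_imp_deriv)
  qed
  have ble: "norm (b z + \<i>/2) \<le> 1/2" if "z \<in> S" for z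
  proof -
    consider "Im z > 0" | "Im z < 0" | "Im z = 0" by linarith
    then show ?thesis
    proof cases
      case 1
      then show ?thesis using Bball[of z] bB[of z] by (simp add: U_def)
    next
      case 2
      then have "cnj z \<in> U" by (simp add: U_def)
      have "b z + \<i>/2 = - cnj (b (cnj z) + \<i>/2)"
        using bcnj[OF cnjS[OF that]] by simp
      then have "norm (b z + \<i>/2) = norm (b (cnj z) + \<i>/2)"
        by (metis complex_mod_cnj norm_minus_cancel)
      then show ?thesis using Bball[OF \<open>cnj z \<in> U\<close>] bB[OF \<open>cnj z \<in> U\<close>] by simp
    next
      case 3
      let ?z = "\<lambda>n. z + \<i> * complex_of_real (inverse (real (Suc n)))"
      have "(\<lambda>n. b (?z n)) \<longlonglongrightarrow> b z"
        by (rule continuous_on_tendsto_compose[OF holomorphic_on_imp_continuous_on[OF bhol] tendsto_vertical_seq])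
           (use that in \<open>auto simp: S_def\<close>)
      then have "(\<lambda>n. norm (b (?z n) + \<i>/2)) \<longlonglongrightarrow> norm (b z + \<i>/2)"
        by (intro tendsto_intros)
      then show ?thesis
      proof (rule tendsto_upperbound)
        have "norm (b (?z n) + \<i>/2) \<le> 1/2" for n
          using Bball[OF upU[of z n]] bB[OF upU[of z n]] 3 by simp
        then show "\<forall>\<^sub>F n in sequentially. norm (b (?z n) + \<i>/2) \<le> 1/2" by simp
      qed simp
    qed
  qed
  \<comment> \<open>Equality at one point would make \<open>b\<close> constant with
    \<open>|b + i / 2| = 1 / 2\<close>, but in the upper half plane the inequality is strict.
    Strictness yields both \<open>b z \<noteq> 0\<close> and \<open>Im (h z) > 0\<close>.\<close>
  have blt: "norm (b z + \<i>/2) < 1/2" if "z \<in> S" for z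
  proof (rule ccontr)
    assume "\<not> norm (b z + \<i>/2) < 1/2"
    then have eq: "norm (b z + \<i>/2) = 1/2" using ble[OF that] by simp
    have "(\<lambda>z. b z + \<i>/2) constant_on S"
    proof (rule maximum_modulus_principle[OF _ S(1) conS S(1) order_refl that])
      show "(\<lambda>z. b z + \<i>/2) holomorphic_on S" by (intro holomorphic_intros bhol)
      show "norm (b w + \<i>/2) \<le> norm (b z + \<i>/2)" if "w \<in> S" for w
        unfolding eq by (rule ble[OF that])
    qed
    then obtain k where k: "\<And>z. z \<in> S \<Longrightarrow> b z + \<i>/2 = k" by (auto simp: constant_on_def)
    have "x0 + \<i> \<in> S" "x0 + \<i> \<in> U" using \<open>c < d\<close> by (auto simp: S_def U_def x0_def field_simps)
    then show False using Bball[of "x0 + \<i>"] bB[of "x0 + \<i>"] k[of "x0 + \<i>"] k[OF that] eq by simp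
  qed
  have bnz: "b z \<noteq> 0" if "z \<in> S" for z
    using blt[OF that] by (auto simp: norm_divide)
  define h where "h z = 1 / b z - \<i>" for z
  show ?thesis
  proof (rule that[of h])
    show "h holomorphic_on {z. Re z \<in> {c<..<d}}"
      unfolding S_def[symmetric] h_def using bnz by (intro holomorphic_intros bhol) auto
    fix z assume "Re z \<in> {c<..<d}"
    then have z: "z \<in> S" by (simp add: S_def)
    show "h z = g z" if "0 < Im z"
      using that bB[of z] nz[of z] by (simp add: h_def B_def U_def)
    show "h (cnj z) = - cnj (h z)"
      using bcnj[OF z] by (simp add: h_def)
    define w where "w = b z"
    have "w \<noteq> 0" using bnz[OF z] by (simp add: w_def)
    have "(norm (w + \<i>/2))\<^sup>2 < (1/2)\<^sup>2"
      using blt[OF z] by (intro power_strict_mono) (auto simp: w_def)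
    then have "(norm w)\<^sup>2 < - Im w"
      unfolding cmod_power2 by (simp add: power2_eq_square algebra_simps)
    moreover have "Im (1 / w) = - Im w / (norm w)\<^sup>2"
      by (simp add: Im_divide cmod_power2)
    moreover have "(norm w)\<^sup>2 > 0" using \<open>w \<noteq> 0\<close> by simp
    ultimately have "Im (1 / w) > 1" by (metis less_divide_eq_1_pos)
    then show "0 < Im (h z)" by (simp add: h_def w_def)
  qed
qed

text \<open>On the circle of radius \<open>\<rho>\<close> about a real centre \<open>c\<close> the factor \<open>(w - c)\<^sup>2 - \<rho>\<^sup>2\<close> has modulus
  \<open>2 \<rho> |Im w|\<close>, which cancels the singular bound at the two real points of the circle.\<close>

lemma pole_bound_from_distance_to_reals:
  fixes R :: "complex \<Rightarrow> complex" and x \<delta> :: real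
  assumes "\<delta> > 0" and hol: "R holomorphic_on ball (complex_of_real x) \<delta> - {complex_of_real x}"
    and bd: "\<And>z. z \<in> ball (complex_of_real x) \<delta> \<Longrightarrow> Im z \<noteq> 0 \<Longrightarrow> norm (R z) \<le> 1 / (Im z)\<^sup>2"
    and z: "z \<noteq> complex_of_real x" "dist z (complex_of_real x) < \<delta> / 2"
  shows "norm ((z - complex_of_real x)\<^sup>2 * R z) \<le> 16"
proof -
  define r where "r = norm (z - complex_of_real x)"
  have r: "0 < r" "r < \<delta> / 2" using z by (auto simp: r_def dist_norm)
  have Rz: "norm (R z) \<le> 16 / r\<^sup>2"
  \<comment> \<open>Away from the axis the hypothesis suffices; near it the maximum principle is
    applied on a disc with real centre.\<close>
  proof (cases "r / 4 \<le> \<bar>Im z\<bar>")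
    case True
    have "norm (R z) \<le> 1 / (Im z)\<^sup>2"
      using True r z by (intro bd) (auto simp: dist_commute)
    also have "(r / 4)\<^sup>2 \<le> (Im z)\<^sup>2"
      using power_mono[OF True, of 2] r by simp
    then have "1 / (Im z)\<^sup>2 \<le> 1 / (r / 4)\<^sup>2"
      using r by (intro divide_left_mono) (auto intro!: mult_pos_pos simp: zero_less_power2 dest: order_trans)
    also have "\<dots> = 16 / r\<^sup>2" by (simp add: power_divide)
    finally show ?thesis .
  next
    case False
    define c where "c = complex_of_real (Re z)"
    \<comment> \<open>As \<open>|Im z| < r / 4\<close>, the centre \<open>c\<close> is more than
      \<open>3 r / 4\<close> away from \<open>x\<close>, so a disc of radius \<open>r / 2\<close>
      misses \<open>x\<close>; \<open>r < \<delta> / 2\<close> keeps it in the ball. The factor in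
      \<open>f\<close> is squared to match the bound \<open>1 / (Im z)\<^sup>2\<close>.\<close>
    define \<rho> where "\<rho> = r / 2"
    define f where "f w = R w * ((w - c)\<^sup>2 - complex_of_real (\<rho>\<^sup>2))\<^sup>2" for w
    have "\<rho> > 0" using r by (simp add: \<rho>_def)
    have zc: "z - c = \<i> * complex_of_real (Im z)" by (simp add: c_def complex_eq_iff)
    then have nzc: "norm (z - c) = \<bar>Im z\<bar>" by (simp add: norm_mult)
    have rc: "r \<le> norm (c - complex_of_real x) + \<bar>Im z\<bar>"
      using norm_triangle_ineq[of "z - c" "c - complex_of_real x"] nzc by (simp add: r_def)
    have sub: "cball c \<rho> \<subseteq> ball (complex_of_real x) \<delta> - {complex_of_real x}"
    proof
      fix w assume "w \<in> cball c \<rho>"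
      then have w: "norm (w - c) \<le> \<rho>" by (simp add: dist_norm norm_minus_commute)
      have "norm (c - complex_of_real x) \<le> r"
        using abs_Re_le_cmod[of "z - complex_of_real x"]
        by (simp add: r_def c_def norm_of_real flip: of_real_diff)
      then have "norm (w - complex_of_real x) < \<delta>"
        using norm_triangle_ineq[of "w - c" "c - complex_of_real x"] w r by (simp add: \<rho>_def)
      moreover have "w \<noteq> complex_of_real x"
        using rc w False r by (auto simp: \<rho>_def norm_minus_commute)
      ultimately show "w \<in> ball (complex_of_real x) \<delta> - {complex_of_real x}"
        by (simp add: dist_norm norm_minus_commute)
    qed
    have holf: "f holomorphic_on cball c \<rho>"
      unfolding f_def by (intro holomorphic_intros holomorphic_on_subset[OF hol sub])
    have "norm (f z) \<le> 4 * \<rho>\<^sup>2"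
    proof (rule maximum_modulus_frontier[of f "cball c \<rho>"])
      show "f holomorphic_on interior (cball c \<rho>)"
        using holf interior_subset by (rule holomorphic_on_subset)
      show "continuous_on (closure (cball c \<rho>)) f"
        using holf by (simp add: holomorphic_on_imp_continuous_on)
      show "z \<in> cball c \<rho>"
        using nzc False r by (simp add: dist_norm norm_minus_commute \<rho>_def)
      fix w assume "w \<in> frontier (cball c \<rho>)"
      then have w: "norm (w - c) = \<rho>" using \<open>\<rho> > 0\<close>
        by (simp add: frontier_cball dist_norm norm_minus_commute)
      define v where "v = w - c"
      have v: "(Re v)\<^sup>2 + (Im v)\<^sup>2 = \<rho>\<^sup>2" "Im v = Im w"
        using w unfolding cmod_power2[symmetric] by (auto simp: v_def c_def)
      have "v\<^sup>2 - complex_of_real (\<rho>\<^sup>2) = 2 * \<i> * complex_of_real (Im w) * v"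
        unfolding v(1)[symmetric] v(2)[symmetric] by (simp add: complex_eq_iff power2_eq_square)
      then have fac: "norm (v\<^sup>2 - complex_of_real (\<rho>\<^sup>2)) = 2 * \<bar>Im w\<bar> * \<rho>"
        using w by (simp add: norm_mult v_def)
      then have nf: "norm (f w) = norm (R w) * (Im w)\<^sup>2 * (4 * \<rho>\<^sup>2)"
        by (simp add: f_def v_def norm_mult norm_power power_mult_distrib)
      show "norm (f w) \<le> 4 * \<rho>\<^sup>2"
      proof (cases "Im w = 0")
        case True then show ?thesis using nf by simp
      next
        case False
        have "w \<in> cball c \<rho>" using w by (simp add: dist_norm norm_minus_commute)
        then have "norm (R w) \<le> 1 / (Im w)\<^sup>2" using sub False by (intro bd) auto
        then have "norm (R w) * (Im w)\<^sup>2 \<le> 1" using False by (simp add: field_simps)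
        then have "norm (R w) * (Im w)\<^sup>2 * (4 * \<rho>\<^sup>2) \<le> 1 * (4 * \<rho>\<^sup>2)"
          by (intro mult_right_mono) auto
        then show ?thesis using nf by simp
      qed
    qed simp
    moreover have "norm (f z) = norm (R z) * ((Im z)\<^sup>2 + \<rho>\<^sup>2)\<^sup>2"
    proof -
      have "(z - c)\<^sup>2 - complex_of_real (\<rho>\<^sup>2) = - complex_of_real ((Im z)\<^sup>2 + \<rho>\<^sup>2)"
        unfolding zc by (simp add: power_mult_distrib)
      then have "norm ((z - c)\<^sup>2 - complex_of_real (\<rho>\<^sup>2)) = (Im z)\<^sup>2 + \<rho>\<^sup>2"
        by (metis abs_of_nonneg norm_minus_cancel norm_of_real sum_power2_ge_zero)
      then show ?thesis by (simp add: f_def norm_mult norm_power)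
    qed
    moreover have "norm (R z) * (\<rho>\<^sup>2)\<^sup>2 \<le> norm (R z) * ((Im z)\<^sup>2 + \<rho>\<^sup>2)\<^sup>2"
      by (intro mult_left_mono power_mono) auto
    ultimately have "norm (R z) * (\<rho>\<^sup>2)\<^sup>2 \<le> 4 * \<rho>\<^sup>2" by linarith
    then have "(norm (R z) * \<rho>\<^sup>2) * \<rho>\<^sup>2 \<le> 4 * \<rho>\<^sup>2"
      by (simp only: power2_eq_square[of "\<rho>\<^sup>2"] mult.assoc)
    then have "norm (R z) * \<rho>\<^sup>2 \<le> 4"
      by (rule mult_right_le_imp_le) (use \<open>\<rho> > 0\<close> in simp)
    then show ?thesis using r by (simp add: \<rho>_def power_divide field_simps)
  qed
  have "norm ((z - complex_of_real x)\<^sup>2 * R z) = r\<^sup>2 * norm (R z)"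
    by (simp add: norm_mult norm_power r_def)
  also have "\<dots> \<le> r\<^sup>2 * (16 / r\<^sup>2)" using Rz by (intro mult_left_mono) auto
  also have "\<dots> = 16" using r by simp
  finally show ?thesis .
qed

section \<open>Local form of the squared Green function at a band edge\<close>

lemma holomorphic_factor_nonzero:
  assumes hol: "H holomorphic_on ball \<xi> \<delta>" and "\<delta> > 0" and "\<exists>z\<in>ball \<xi> \<delta>. H z \<noteq> 0"
  obtains k r \<eta> where "0 < r" "r \<le> \<delta>" "\<eta> holomorphic_on ball \<xi> r" "\<eta> \<xi> \<noteq> 0"
    "\<And>w. w \<in> ball \<xi> r \<Longrightarrow> H w = (w - \<xi>) ^ k * \<eta> w"
proof (cases "H \<xi> = 0")
  case False
  then show ?thesis using assms by (intro that[of \<delta> H 0]) auto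
next
  case True
  have "\<not> H constant_on ball \<xi> \<delta>"
    using True assms(2,3) by (auto simp: constant_on_def) (metis centre_in_ball mem_ball)
  then obtain g r n where g: "0 < n" "0 < r" "ball \<xi> r \<subseteq> ball \<xi> \<delta>" "g holomorphic_on ball \<xi> r"
    "\<And>w. w \<in> ball \<xi> r \<Longrightarrow> H w = (w - \<xi>) ^ n * g w" "\<And>w. w \<in> ball \<xi> r \<Longrightarrow> g w \<noteq> 0"
    using holomorphic_factor_zero_nonconstant[OF hol open_ball connected_ball _ True] assms(2)
    by (metis centre_in_ball)
  show ?thesis
  proof (rule that[of "min r \<delta>" g n])
    show "g holomorphic_on ball \<xi> (min r \<delta>)" using g(4) by (rule holomorphic_on_subset) auto
    show "H w = (w - \<xi>) ^ n * g w" if "w \<in> ball \<xi> (min r \<delta>)" for w using g(5) that by auto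
  qed (use g assms in auto)
qed

text \<open>The band lies in the direction \<open>\<sigma>\<close>. Continuing \<open>G\<close>
  through the band gives \<open>h\<close>, which equals \<open>- G\<close> below the axis, whereas
  through the gap \<open>G\<close> continues as itself; so it is the square that is single-valued
  around \<open>x\<close>. It has pole order and zero order at most 2, and its sign changes between
  gap and band, so its order is odd; \<open>k\<close> is that order plus 2.\<close>

lemma edge_factorization:
  fixes G h :: "complex \<Rightarrow> complex" and x \<delta> \<sigma> \<kappa> :: real
  assumes "\<delta> > 0" and \<sigma>: "\<sigma> = 1 \<or> \<sigma> = - 1"
    and Ghol: "G holomorphic_on {z. Im z \<noteq> 0 \<or> 0 < \<sigma> * (x - Re z) \<and> \<sigma> * (x - Re z) < \<delta>}"
    and Gcnj: "\<And>z. Im z \<noteq> 0 \<or> 0 < \<sigma> * (x - Re z) \<and> \<sigma> * (x - Re z) < \<delta> \<Longrightarrow> G (cnj z) = cnj (G z)"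
    and Gbd: "\<And>z. Im z \<noteq> 0 \<Longrightarrow> norm (G z) \<le> 1 / \<bar>Im z\<bar>"
    and "\<kappa> > 0"
    and Glow: "\<And>eps. 0 < eps \<Longrightarrow> eps < \<delta> \<Longrightarrow> \<kappa> * eps \<le> norm (G (ray x eps))"
    and hhol: "h holomorphic_on {z. 0 < \<sigma> * (Re z - x) \<and> \<sigma> * (Re z - x) < \<delta>}"
    and hG: "\<And>z. 0 < \<sigma> * (Re z - x) \<Longrightarrow> \<sigma> * (Re z - x) < \<delta> \<Longrightarrow> 0 < Im z \<Longrightarrow> h z = G z"
    and hcnj: "\<And>z. 0 < \<sigma> * (Re z - x) \<Longrightarrow> \<sigma> * (Re z - x) < \<delta> \<Longrightarrow> h (cnj z) = - cnj (h z)"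
  obtains k r \<eta> where "k = 1 \<or> k = (3::nat)" "0 < r" "\<eta> holomorphic_on ball (complex_of_real x) r"
    "\<eta> (complex_of_real x) \<noteq> 0"
    "\<And>eps. 0 < eps \<Longrightarrow> eps < r \<Longrightarrow>
      (\<i> * complex_of_real eps)\<^sup>2 * (G (ray x eps))\<^sup>2 =
      (\<i> * complex_of_real eps) ^ k * \<eta> (ray x eps)"
proof -
  let ?x = "complex_of_real x"
  define E where "E = {z. 0 < \<sigma> * (Re z - x) \<and> \<sigma> * (Re z - x) < \<delta>}"
  define D where "D = {z. Im z \<noteq> 0 \<or> 0 < \<sigma> * (x - Re z) \<and> \<sigma> * (x - Re z) < \<delta>}"
  define R where "R z = (if z \<in> E then (h z)\<^sup>2 else (G z)\<^sup>2)" for z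
  have "open E" "open D"
    unfolding E_def D_def
    by (intro open_Collect_conj open_Collect_disj open_Collect_less open_Collect_neq continuous_intros)+
  have RD: "R z = (G z)\<^sup>2" if "z \<in> D" for z
  proof (cases "z \<in> E")
    case True
    then have E: "0 < \<sigma> * (Re z - x)" "\<sigma> * (Re z - x) < \<delta>" by (auto simp: E_def)
    have "\<sigma> * (x - Re z) = - (\<sigma> * (Re z - x))" by (simp add: algebra_simps)
    then have "Im z \<noteq> 0" using that E by (auto simp: D_def)
    show ?thesis
    proof (cases "Im z > 0")
      case True then show ?thesis using hG[OF E] \<open>z \<in> E\<close> by (simp add: R_def)
    next
      case False
      then have "Im z < 0" using \<open>Im z \<noteq> 0\<close> by simp
      then have "h (cnj z) = G (cnj z)" using hG[of "cnj z"] E by simp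
      moreover have "G (cnj z) = cnj (G z)" using \<open>Im z \<noteq> 0\<close> by (intro Gcnj) simp
      moreover have "h z = - cnj (h (cnj z))" using hcnj[of "cnj z"] E by simp
      ultimately show ?thesis using \<open>z \<in> E\<close> by (simp add: R_def)
    qed
  qed (simp add: R_def)
  have "R holomorphic_on E"
    by (rule holomorphic_transform[of "\<lambda>z. (h z)\<^sup>2"])
       (auto simp: R_def E_def intro!: holomorphic_intros hhol)
  moreover have "R holomorphic_on D"
    by (rule holomorphic_transform[of "\<lambda>z. (G z)\<^sup>2"])
       (auto simp: RD intro!: holomorphic_intros Ghol[folded D_def])
  ultimately have "R holomorphic_on (E \<union> D)"
    using \<open>open E\<close> \<open>open D\<close> by (rule holomorphic_on_Un)
  moreover have "ball ?x \<delta> - {?x} \<subseteq> E \<union> D"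
  proof
    fix z assume z: "z \<in> ball ?x \<delta> - {?x}"
    have "\<bar>Re z - x\<bar> < \<delta>"
      using z abs_Re_le_cmod[of "z - ?x"] by (simp add: dist_norm norm_minus_commute)
    moreover have "Re z \<noteq> x \<or> Im z \<noteq> 0" using z by (auto simp: complex_eq_iff)
    ultimately show "z \<in> E \<union> D" using \<sigma> by (auto simp: E_def D_def abs_if split: if_splits)
  qed
  ultimately have Rhol: "R holomorphic_on ball ?x \<delta> - {?x}" by (rule holomorphic_on_subset)
  have Rbd: "norm (R z) \<le> 1 / (Im z)\<^sup>2" if "Im z \<noteq> 0" for z
  proof -
    have "norm (R z) = (norm (G z))\<^sup>2" using RD[of z] that by (simp add: D_def norm_power)
    also have "\<dots> \<le> (1 / \<bar>Im z\<bar>)\<^sup>2" using Gbd[OF that] by (intro power_mono) auto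
    finally show ?thesis by (simp add: power_divide)
  qed
  have "\<forall>\<^sub>F z in at ?x. norm ((z - ?x)\<^sup>2 * R z) \<le> 16"
    unfolding eventually_at
  proof (intro exI conjI ballI impI)
    show "\<delta> / 2 > 0" using \<open>\<delta> > 0\<close> by simp
    fix z assume "z \<noteq> ?x \<and> dist z ?x < \<delta> / 2"
    then show "norm ((z - ?x)\<^sup>2 * R z) \<le> 16"
      using Rbd by (intro pole_bound_from_distance_to_reals[OF \<open>\<delta> > 0\<close> Rhol]) auto
  qed
  then have "\<exists>H. H holomorphic_on ball ?x \<delta> \<and> (\<forall>z\<in>ball ?x \<delta> - {?x}. H z = (z - ?x)\<^sup>2 * R z)"
    using \<open>\<delta> > 0\<close> by (subst holomorphic_on_extend_bounded) (auto intro!: holomorphic_intros Rhol)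
  then obtain H where H: "H holomorphic_on ball ?x \<delta>"
    "\<And>z. z \<in> ball ?x \<delta> \<Longrightarrow> z \<noteq> ?x \<Longrightarrow> H z = (z - ?x)\<^sup>2 * R z" by auto
  have vert: "ray x eps \<in> ball ?x r \<and> ray x eps \<in> D
      \<and> ray x eps \<noteq> ?x" if "0 < eps" "eps < r" for eps r
    using that by (simp add: dist_norm norm_mult D_def)
  have Hv: "H (ray x eps) =
      (\<i> * complex_of_real eps)\<^sup>2 * (G (ray x eps))\<^sup>2" if "0 < eps" "eps < \<delta>" for eps
    using H(2) RD vert[OF that] by simp
  have Hlow: "\<kappa>\<^sup>2 * eps ^ 4 \<le> norm (H (ray x eps))" if "0 < eps" "eps < \<delta>" for eps
  proof -
    have "\<kappa>\<^sup>2 * eps ^ 4 = eps\<^sup>2 * (\<kappa> * eps)\<^sup>2" by (simp add: power_mult_distrib power2_eq_square numeral_eq_Suc)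
    also have "\<dots> \<le> eps\<^sup>2 * (norm (G (ray x eps)))\<^sup>2"
      using Glow[OF that] \<open>\<kappa> > 0\<close> that by (intro mult_left_mono power_mono) auto
    also have "\<dots> = norm (H (ray x eps))"
      unfolding Hv[OF that] by (simp add: norm_mult norm_power)
    finally show ?thesis .
  qed
  have "H (?x + \<i> * complex_of_real (\<delta>/2)) \<noteq> 0"
    using Hlow[of "\<delta>/2"] \<open>\<delta> > 0\<close> \<open>\<kappa> > 0\<close> zero_less_mult_iff[of "\<kappa>\<^sup>2" "(\<delta>/2)^4"] by fastforce
  moreover have "?x + \<i> * complex_of_real (\<delta>/2) \<in> ball ?x \<delta>" using vert[of "\<delta>/2" \<delta>] \<open>\<delta> > 0\<close> by simp
  ultimately have "\<exists>z\<in>ball ?x \<delta>. H z \<noteq> 0" by blast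
  then obtain k r \<eta> where r: "0 < r" "r \<le> \<delta>" and \<eta>: "\<eta> holomorphic_on ball ?x r" "\<eta> ?x \<noteq> 0"
    and fac: "\<And>w. w \<in> ball ?x r \<Longrightarrow> H w = (w - ?x) ^ k * \<eta> w"
    using holomorphic_factor_nonzero[OF H(1) \<open>\<delta> > 0\<close>] by metis
  have cont\<eta>: "continuous_on (ball ?x r) \<eta>" using \<eta>(1) by (rule holomorphic_on_imp_continuous_on)
  then have is\<eta>: "isCont \<eta> ?x" using r by (simp add: continuous_on_eq_continuous_at)
  \<comment> \<open>On the vertical ray \<open>|H|\<close> is at least
    \<open>\<kappa>\<^sup>2 * eps ^ 4\<close>, so a zero of order above 4 would force
    \<open>\<kappa> = 0\<close>.\<close>
  have "k \<le> 4"
  proof (rule ccontr)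
    assume "\<not> k \<le> 4"
    have ev: "\<forall>\<^sub>F eps in at_right 0. \<kappa>\<^sup>2 \<le> eps ^ (k - 4) * norm (\<eta> (ray x eps))"
    proof (rule eventually_at_rightI[of 0 r])
      fix eps assume "eps \<in> {0<..<r}"
      then have eps: "0 < eps" "eps < r" "eps < \<delta>" using r by auto
      have "\<kappa>\<^sup>2 * eps ^ 4 \<le> norm ((\<i> * complex_of_real eps) ^ k * \<eta> (ray x eps))"
        using Hlow[OF eps(1,3)] fac vert[OF eps(1,2)] by simp
      also have "\<dots> = eps ^ k * norm (\<eta> (ray x eps))"
        using eps by (simp add: norm_mult norm_power)
      also have "eps ^ k = eps ^ (k - 4) * eps ^ 4"
        using \<open>\<not> k \<le> 4\<close> by (simp flip: power_add)
      finally have "\<kappa>\<^sup>2 * eps ^ 4 \<le> (eps ^ (k - 4) * norm (\<eta> (ray x eps))) * eps ^ 4"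
        by (simp add: mult_ac)
      then show "\<kappa>\<^sup>2 \<le> eps ^ (k - 4) * norm (\<eta> (ray x eps))"
        using eps(1) by (simp add: mult_le_cancel_right_pos)
    qed (use r in auto)
    have "((\<lambda>eps. eps ^ (k - 4) * norm (\<eta> (ray x eps))) \<longlongrightarrow>
        0 ^ (k - 4) * norm (\<eta> (?x + \<i> * complex_of_real 0))) (at_right 0)"
      using is\<eta> by (intro tendsto_intros isCont_tendsto_compose[of _ \<eta>]) simp_all
    then have "((\<lambda>eps. eps ^ (k - 4) * norm (\<eta> (ray x eps))) \<longlongrightarrow> 0) (at_right 0)"
      using \<open>\<not> k \<le> 4\<close> by (simp add: zero_power)
    then have "\<kappa>\<^sup>2 \<le> 0" by (rule tendsto_lowerbound[OF _ ev]) simp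
    then show False using \<open>\<kappa> > 0\<close> by simp
  qed
  \<comment> \<open>For even \<open>k\<close> the values of \<open>\<eta>\<close> on the real axis
    have the sign of \<open>R\<close>: nonnegative on the gap side, where \<open>G\<close> is real,
    nonpositive on the band side, where \<open>h\<close> is imaginary. In the limit
    \<open>\<eta>\<close> would vanish at \<open>x\<close>.\<close>
  moreover have "odd k"
  proof
    assume "even k"
    have lim: "((\<lambda>t. \<eta> (complex_of_real (x + s * t))) \<longlongrightarrow> \<eta> ?x) (at_right 0)" for s :: real
    proof (rule isCont_tendsto_compose[OF is\<eta>])
      have "((\<lambda>t. complex_of_real (x + s * t)) \<longlongrightarrow> complex_of_real (x + s * 0)) (at_right 0)"
        by (intro tendsto_intros)
      then show "((\<lambda>t. complex_of_real (x + s * t)) \<longlongrightarrow> ?x) (at_right 0)" by simp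
    qed
    have val: "\<eta> (complex_of_real (x + s * t)) = complex_of_real (t\<^sup>2 / t ^ k) * R (complex_of_real (x + s * t))"
      if "s = 1 \<or> s = - 1" "0 < t" "t < r" for s t
    proof -
      let ?y = "complex_of_real (x + s * t)"
      have y: "?y \<in> ball ?x r" "?y \<in> ball ?x \<delta>" "?y \<noteq> ?x"
        using that r by (auto simp: dist_norm norm_mult simp flip: of_real_minus)
      have "(?y - ?x) ^ k = complex_of_real (t ^ k)" "(?y - ?x)\<^sup>2 = complex_of_real (t\<^sup>2)"
        using that(1) \<open>even k\<close> by auto
      then have "complex_of_real (t\<^sup>2) * R ?y = complex_of_real (t ^ k) * \<eta> ?y"
        using fac[OF y(1)] H(2)[OF y(2,3)] by simp
      then show ?thesis using that by (simp add: field_simps)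
    qed
    have gap: "Re (\<eta> (complex_of_real (x + (-\<sigma>) * t))) \<ge> 0 \<and> Im (\<eta> (complex_of_real (x + (-\<sigma>) * t))) = 0"
      if "0 < t" "t < r" for t
    proof -
      let ?y = "complex_of_real (x + (-\<sigma>) * t)"
      have "?y \<in> D" using \<sigma> that r by (auto simp: D_def)
      then have "R ?y = (G ?y)\<^sup>2" "G (cnj ?y) = cnj (G ?y)"
        using RD[of ?y] Gcnj[of ?y] unfolding D_def mem_Collect_eq by blast+
      then have "Im (G ?y) = 0" "R ?y = (G ?y)\<^sup>2"
        by (simp_all only: complex_cnj_complex_of_real) (simp add: complex_eq_iff)
      then have "R ?y = complex_of_real ((Re (G ?y))\<^sup>2)" by (simp add: complex_eq_iff)
      moreover have "- \<sigma> = 1 \<or> - \<sigma> = - 1" using \<sigma> by auto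
      ultimately show ?thesis using val[of "-\<sigma>" t] that by simp
    qed
    have band: "Re (\<eta> (complex_of_real (x + \<sigma> * t))) \<le> 0 \<and> Im (\<eta> (complex_of_real (x + \<sigma> * t))) = 0"
      if "0 < t" "t < r" for t
    proof -
      let ?y = "complex_of_real (x + \<sigma> * t)"
      have E: "?y \<in> E" using \<sigma> that r by (auto simp: E_def)
      then have "h (cnj ?y) = - cnj (h ?y)" by (intro hcnj) (auto simp: E_def)
      then have "Re (h ?y) = 0" by (simp add: complex_eq_iff)
      then have "R ?y = complex_of_real (- (Im (h ?y))\<^sup>2)"
        using E by (simp add: R_def complex_eq_iff power2_eq_square)
      then show ?thesis using val[OF \<sigma> that] that by (simp add: divide_nonneg_pos)
    qed
    have ev: "\<forall>\<^sub>F t in at_right (0::real). 0 < t \<and> t < r"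
      using r by (auto simp: eventually_at_right_field)
    have "Re (\<eta> ?x) \<ge> 0"
      by (rule tendsto_lowerbound[OF tendsto_Re[OF lim[of "-\<sigma>"]]])
         (use ev gap in \<open>auto elim: eventually_mono\<close>)
    moreover have "Re (\<eta> ?x) \<le> 0"
      by (rule tendsto_upperbound[OF tendsto_Re[OF lim[of "\<sigma>"]]])
         (use ev band in \<open>auto elim: eventually_mono\<close>)
    moreover have "Im (\<eta> ?x) = 0"
    proof (rule tendsto_unique[OF _ tendsto_Im[OF lim[of "\<sigma>"]]])
      show "((\<lambda>t. Im (\<eta> (complex_of_real (x + \<sigma> * t)))) \<longlongrightarrow> 0) (at_right 0)"
        by (rule tendsto_eventually) (use ev band in \<open>auto elim: eventually_mono\<close>)
    qed simp
    ultimately show False using \<eta>(2) by (simp add: complex_eq_iff)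
  qed
  ultimately have "k = 1 \<or> k = 3" by (auto elim!: oddE)
  then show ?thesis
  proof (rule that[OF _ r(1) \<eta>])
    fix eps :: real assume eps: "0 < eps" "eps < r"
    then show "(\<i> * complex_of_real eps)\<^sup>2 * (G (ray x eps))\<^sup>2 =
      (\<i> * complex_of_real eps) ^ k * \<eta> (ray x eps)"
      using Hv[of eps] fac[of "ray x eps"] vert[OF eps] r by simp
  qed
qed

section \<open>Solutions square summable at minus infinity\<close>

text \<open>The clause on \<open>\<alpha>\<close> and \<open>\<beta>\<close> says that no band
  containing \<open>x\<close> extends to its right. Combined with its mirror image it excludes
  isolated points, since bands are nondegenerate.\<close>

lemma finite_gap_set_right_side:
  fixes \<alpha> \<beta> :: "nat \<Rightarrow> real" and l :: nat
  defines "e \<equiv> \<Union>j\<le>l. {\<alpha> j..\<beta> j}"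
  shows "\<exists>\<delta>>0. {x<..<x + \<delta>} \<subseteq> e \<or> ({x<..<x + \<delta>} \<inter> e = {} \<and> (\<forall>j\<le>l. \<alpha> j \<le> x \<longrightarrow> \<beta> j \<le> x))"
proof (cases "\<exists>j\<le>l. \<alpha> j \<le> x \<and> x < \<beta> j")
  case True
  then obtain j where j: "j \<le> l" "\<alpha> j \<le> x" "x < \<beta> j" by blast
  then have "{x<..<x + (\<beta> j - x)} \<subseteq> e" by (force simp: e_def)
  then show ?thesis using j by (intro exI[of _ "\<beta> j - x"]) auto
next
  case False
  \<comment> \<open>The element 1 keeps the minimum defined when no band starts to the right of
    \<open>x\<close>.\<close>
  define S where "S = insert 1 ((\<lambda>j. \<alpha> j - x) ` {j. j \<le> l \<and> x < \<alpha> j})"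
  have S: "finite S" "S \<noteq> {}" by (auto simp: S_def)
  have "Min S > 0" using S by (subst Min_gr_iff) (auto simp: S_def)
  moreover have "{x<..<x + Min S} \<inter> e = {}"
  proof (rule ccontr)
    assume "\<not> ?thesis"
    then obtain y j where y: "x < y" "y < x + Min S" "j \<le> l" "\<alpha> j \<le> y" "y \<le> \<beta> j" by (auto simp: e_def)
    then have "x < \<alpha> j" using False by force
    then have "\<alpha> j - x \<in> S" using y by (auto simp: S_def)
    then have "Min S \<le> \<alpha> j - x" using S by simp
    then show False using y by linarith
  qed
  ultimately show ?thesis using False by (intro exI[of _ "Min S"]) (auto simp: not_less)
qed

lemma finite_gap_set_left_side:
  fixes \<alpha> \<beta> :: "nat \<Rightarrow> real" and l :: nat
  defines "e \<equiv> \<Union>j\<le>l. {\<alpha> j..\<beta> j}"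
  shows "\<exists>\<delta>>0. {x - \<delta><..<x} \<subseteq> e \<or> ({x - \<delta><..<x} \<inter> e = {} \<and> (\<forall>j\<le>l. x \<le> \<beta> j \<longrightarrow> x \<le> \<alpha> j))"
proof -
  define e' where "e' = (\<Union>j\<le>l. {- \<beta> j..- \<alpha> j})"
  obtain \<delta> where "\<delta> > 0" and \<delta>: "{- x<..<- x + \<delta>} \<subseteq> e' \<or>
      ({- x<..<- x + \<delta>} \<inter> e' = {} \<and> (\<forall>j\<le>l. - \<beta> j \<le> - x \<longrightarrow> - \<alpha> j \<le> - x))"
    using finite_gap_set_right_side[where x = "- x" and l = l and \<alpha> = "\<lambda>j. - \<beta> j" and \<beta> = "\<lambda>j. - \<alpha> j"] unfolding e'_def by blast
  have mem: "y \<in> e \<longleftrightarrow> - y \<in> e'" for y by (auto simp: e_def e'_def)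
  have int: "y \<in> {x - \<delta><..<x} \<longleftrightarrow> - y \<in> {- x<..<- x + \<delta>}" for y by auto
  from \<delta> have "{x - \<delta><..<x} \<subseteq> e \<or> ({x - \<delta><..<x} \<inter> e = {} \<and> (\<forall>j\<le>l. x \<le> \<beta> j \<longrightarrow> x \<le> \<alpha> j))"
  proof
    assume "{- x<..<- x + \<delta>} \<subseteq> e'"
    then have "{x - \<delta><..<x} \<subseteq> e" using mem int by blast
    then show ?thesis ..
  next
    assume "{- x<..<- x + \<delta>} \<inter> e' = {} \<and> (\<forall>j\<le>l. - \<beta> j \<le> - x \<longrightarrow> - \<alpha> j \<le> - x)"
    then show ?thesis using mem int by (intro disjI2) (auto simp del: greaterThanLessThan_iff)
  qed
  then show ?thesis using \<open>\<delta> > 0\<close> by blast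
qed

text \<open>\<open>\<sigma>\<close> is \<open>1\<close> at a left endpoint of a band and
  \<open>- 1\<close> at a right one, so that both kinds of edge are handled by one argument.\<close>

lemma finite_gap_set_local:
  assumes "finite_gap_set e" "x \<in> e"
  obtains \<delta> where "\<delta> > 0" "{x - \<delta><..<x + \<delta>} \<subseteq> e"
  | \<delta> \<sigma> where "\<delta> > 0" "\<sigma> = 1 \<or> \<sigma> = - 1"
      "\<And>y. 0 < \<sigma> * (y - x) \<Longrightarrow> \<sigma> * (y - x) < \<delta> \<Longrightarrow> y \<in> e"
      "\<And>y. 0 < \<sigma> * (x - y) \<Longrightarrow> \<sigma> * (x - y) < \<delta> \<Longrightarrow> y \<notin> e"
proof -
  obtain l :: nat and \<alpha> \<beta> :: "nat \<Rightarrow> real" where lt: "\<forall>j\<le>l. \<alpha> j < \<beta> j" and e: "e = (\<Union>j\<le>l. {\<alpha> j..\<beta> j})"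
    using assms(1) unfolding finite_gap_set_def by blast
  obtain d1 where d1: "d1 > 0" "{x<..<x + d1} \<subseteq> e \<or> ({x<..<x + d1} \<inter> e = {} \<and> (\<forall>j\<le>l. \<alpha> j \<le> x \<longrightarrow> \<beta> j \<le> x))"
    using finite_gap_set_right_side[where x = x and l = l and \<alpha> = \<alpha> and \<beta> = \<beta>] unfolding e by blast
  obtain d2 where d2: "d2 > 0" "{x - d2<..<x} \<subseteq> e \<or> ({x - d2<..<x} \<inter> e = {} \<and> (\<forall>j\<le>l. x \<le> \<beta> j \<longrightarrow> x \<le> \<alpha> j))"
    using finite_gap_set_left_side[where x = x and l = l and \<alpha> = \<alpha> and \<beta> = \<beta>] unfolding e by blast
  obtain j where j: "j \<le> l" "\<alpha> j \<le> x" "x \<le> \<beta> j" using assms(2) e by auto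
  define \<delta> where "\<delta> = min d1 d2"
  have \<delta>: "\<delta> > 0" "\<delta> \<le> d1" "\<delta> \<le> d2" using d1 d2 by (auto simp: \<delta>_def)
  consider "{x<..<x + d1} \<subseteq> e" "{x - d2<..<x} \<subseteq> e" | "{x<..<x + d1} \<subseteq> e" "{x - d2<..<x} \<inter> e = {}"
    | "{x<..<x + d1} \<inter> e = {}" "{x - d2<..<x} \<subseteq> e"
    | "\<forall>j\<le>l. \<alpha> j \<le> x \<longrightarrow> \<beta> j \<le> x" "\<forall>j\<le>l. x \<le> \<beta> j \<longrightarrow> x \<le> \<alpha> j" using d1(2) d2(2) by blast
  then show ?thesis
  proof cases
    case 1
    have "{x - \<delta><..<x + \<delta>} \<subseteq> e"
    proof
      fix y assume "y \<in> {x - \<delta><..<x + \<delta>}"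
      then have "y = x \<or> y \<in> {x<..<x + d1} \<or> y \<in> {x - d2<..<x}" using \<delta> by auto
      then show "y \<in> e" using 1 assms(2) by blast
    qed
    then show ?thesis using that(1) \<delta> by blast
  next
    case 2
    have "y \<in> e" if "0 < y - x" "y - x < \<delta>" for y
      using 2(1) that \<delta> by (intro subsetD[OF 2(1)]) auto
    moreover have "y \<notin> e" if "0 < x - y" "x - y < \<delta>" for y
    proof -
      have "y \<in> {x - d2<..<x}" using that \<delta> by auto
      then show ?thesis using 2(2) by blast
    qed
    ultimately show ?thesis using that(2)[of \<delta> 1] \<delta> by simp
  next
    case 3
    have "y \<in> e" if "0 < x - y" "x - y < \<delta>" for y
      using that \<delta> by (intro subsetD[OF 3(2)]) auto
    moreover have "y \<notin> e" if "0 < y - x" "y - x < \<delta>" for y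
    proof -
      have "y \<in> {x<..<x + d1}" using that \<delta> by auto
      then show ?thesis using 3(1) by blast
    qed
    ultimately show ?thesis using that(2)[of \<delta> "-1"] \<delta> by simp
  next
    case 4
    then show ?thesis using j lt by fastforce
  qed
qed

lemma finite_gap_set_closed: "finite_gap_set e \<Longrightarrow> closed e"
  unfolding finite_gap_set_def by auto

text \<open>\<open>k = 1\<close> and \<open>k = 3\<close> mean that \<open>g\<^sup>2\<close> has a simple pole respectively a simple zero. When both squares have a
  pole, squaring the relation gives \<open>2 s\<^sup>3 t g\<^sub>0 = q\<^sub>0 + O(\<epsilon>)\<close> with \<open>t = i\<epsilon>\<close>, although the left side is
  exactly of order \<open>\<epsilon>\<^bsup>1/2\<^esup>\<close>.\<close>

lemma edge_orders_inconsistent: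
  fixes g0 g1 s :: "real \<Rightarrow> complex" and \<eta>0 \<eta>1 :: "complex \<Rightarrow> complex"
  assumes "r > 0" "c \<noteq> (0::complex)"
    and rel: "\<And>eps. 0 < eps \<Longrightarrow> eps < r \<Longrightarrow> c * g1 eps = s eps * (1 + s eps * g0 eps)"
    and s: "\<And>eps. 0 < eps \<Longrightarrow> eps < r \<Longrightarrow> norm (s eps - s0) \<le> eps * C"
    and k: "k0 = 1 \<or> k0 = (3::nat)" "k1 = 1 \<or> k1 = (3::nat)"
    and d: "(\<eta>0 has_field_derivative d0) (at \<xi>)" "(\<eta>1 has_field_derivative d1) (at \<xi>)"
    and nz: "\<eta>0 \<xi> \<noteq> 0" "\<eta>1 \<xi> \<noteq> 0"
    and f0: "\<And>eps. 0 < eps \<Longrightarrow> eps < r \<Longrightarrow>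
      (\<i> * complex_of_real eps)\<^sup>2 * (g0 eps)\<^sup>2 = (\<i> * complex_of_real eps) ^ k0 * \<eta>0 (\<xi> + \<i> * complex_of_real eps)"
    and f1: "\<And>eps. 0 < eps \<Longrightarrow> eps < r \<Longrightarrow>
      (\<i> * complex_of_real eps)\<^sup>2 * (g1 eps)\<^sup>2 = (\<i> * complex_of_real eps) ^ k1 * \<eta>1 (\<xi> + \<i> * complex_of_real eps)"
  shows False
proof -
  let ?F = "at_right (0::real)"
  define t where "t eps = \<i> * complex_of_real eps" for eps
  define h0 where "h0 eps = \<eta>0 (\<xi> + t eps)" for eps
  define h1 where "h1 eps = \<eta>1 (\<xi> + t eps)" for eps
  define N0 where "N0 eps = (norm (g0 eps))\<^sup>2" for eps
  define N1 where "N1 eps = (norm (g1 eps))\<^sup>2" for eps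
  have ev: "\<forall>\<^sub>F eps in ?F. 0 < eps \<and> eps < r"
    using \<open>r > 0\<close> by (auto simp: eventually_at_right_field)
  have id: "((\<lambda>eps. eps) \<longlongrightarrow> 0) ?F" by (rule tendsto_ident_at)
  have t0: "(t \<longlongrightarrow> 0) ?F"
  proof -
    have "((\<lambda>eps. \<i> * complex_of_real eps) \<longlongrightarrow> \<i> * complex_of_real 0) ?F" by (intro tendsto_intros)
    then show ?thesis by (simp add: t_def[abs_def])
  qed
  have xt: "((\<lambda>eps. \<xi> + t eps) \<longlongrightarrow> \<xi>) ?F" using tendsto_add[OF tendsto_const t0, of \<xi>] by simp
  have h: "(h0 \<longlongrightarrow> \<eta>0 \<xi>) ?F" "(h1 \<longlongrightarrow> \<eta>1 \<xi>) ?F"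
    unfolding h0_def[abs_def] h1_def[abs_def]
    by (rule isCont_tendsto_compose[OF DERIV_isCont xt], rule d)+
  have sl: "(s \<longlongrightarrow> s0) ?F"
  proof (rule LIM_zero_cancel, rule Lim_null_comparison)
    show "\<forall>\<^sub>F eps in ?F. norm (s eps - s0) \<le> eps * C" using ev s by (auto elim: eventually_mono)
    show "((\<lambda>eps. eps * C) \<longlongrightarrow> 0) ?F" using tendsto_mult_left_zero[OF id] by simp
  qed
  have sq: "((\<lambda>eps. sqrt eps) \<longlongrightarrow> 0) ?F" using tendsto_real_sqrt[OF id] by simp
  have n0: "eps\<^sup>2 * N0 eps = eps ^ k0 * norm (h0 eps)" and n1: "eps\<^sup>2 * N1 eps = eps ^ k1 * norm (h1 eps)"
    if "0 < eps" "eps < r" for eps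
    using arg_cong[OF f0[OF that], of norm] arg_cong[OF f1[OF that], of norm] that
    by (simp_all add: norm_mult norm_power N0_def N1_def h0_def h1_def t_def)
  have e3N0: "((\<lambda>eps. eps ^ 3 * N0 eps) \<longlongrightarrow> 0) ?F"
  proof -
    have "((\<lambda>eps. eps * (eps ^ k0 * norm (h0 eps))) \<longlongrightarrow> 0 * (0 ^ k0 * norm (\<eta>0 \<xi>))) ?F"
      by (intro tendsto_intros h id)
    then have "((\<lambda>eps. eps * (eps ^ k0 * norm (h0 eps))) \<longlongrightarrow> 0) ?F" by simp
    moreover have "\<forall>\<^sub>F eps in ?F. eps * (eps ^ k0 * norm (h0 eps)) = eps ^ 3 * N0 eps"
      using ev by (rule eventually_mono) (simp add: n0[symmetric] power2_eq_square power3_eq_cube)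
    ultimately show ?thesis by (rule Lim_transform_eventually)
  qed
  \<comment> \<open>\<open>g1\<close> squared vanishes at most to first order, so \<open>N1\<close>
    is not \<open>o(eps)\<close>. This is what the case \<open>s0 = 0\<close> contradicts.\<close>
  have notN1: "\<not> ((\<lambda>eps. N1 eps / eps) \<longlongrightarrow> 0) ?F"
  proof
    assume "((\<lambda>eps. N1 eps / eps) \<longlongrightarrow> 0) ?F"
    then have "((\<lambda>eps. eps ^ (3 - k1) * (N1 eps / eps)) \<longlongrightarrow> 0 ^ (3 - k1) * 0) ?F"
      by (intro tendsto_intros id)
    then have "((\<lambda>eps. eps ^ (3 - k1) * (N1 eps / eps)) \<longlongrightarrow> 0) ?F" by simp
    moreover have "\<forall>\<^sub>F eps in ?F. eps ^ (3 - k1) * (N1 eps / eps) = norm (h1 eps)"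
      using ev
    proof (rule eventually_mono)
      fix eps assume eps: "0 < eps \<and> eps < r"
      then show "eps ^ (3 - k1) * (N1 eps / eps) = norm (h1 eps)"
        using k(2) n1[of eps] by (auto simp: power2_eq_square power3_eq_cube field_simps)
    qed
    ultimately have "((\<lambda>eps. norm (h1 eps)) \<longlongrightarrow> 0) ?F" by (rule Lim_transform_eventually)
    then show False using tendsto_unique[OF _ tendsto_norm[OF h(2)]] nz by fastforce
  qed
  show False
  proof (cases "s0 = 0")
    \<comment> \<open>Here \<open>s = O(eps)\<close>, so
      \<open>c * g1 = O(eps) (1 + O(eps) g0)\<close>; since \<open>eps ^ 3 * N0\<close> tends to 0,
      \<open>N1\<close> would be \<open>o(eps)\<close>.\<close>
    case True
    have "((\<lambda>eps. N1 eps / eps) \<longlongrightarrow> 0) ?F"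
    proof (rule Lim_null_comparison)
      show "\<forall>\<^sub>F eps in ?F. norm (N1 eps / eps) \<le> 2 / (norm c)\<^sup>2 * (eps * C\<^sup>2 + eps ^ 3 * N0 eps * C ^ 4)"
        using ev
      proof (rule eventually_mono)
        fix eps assume eps: "0 < eps \<and> eps < r"
        have sb: "norm (s eps) \<le> eps * C" using s[of eps] eps True by simp
        have "(norm (1 + s eps * g0 eps))\<^sup>2 \<le> (1 + norm (s eps * g0 eps))\<^sup>2"
          using norm_triangle_ineq[of 1 "s eps * g0 eps"] by (intro power_mono) auto
        also have "\<dots> \<le> 2 * (1 + (norm (s eps * g0 eps))\<^sup>2)"
          using sum_squares_bound[of 1 "norm (s eps * g0 eps)"] by (simp add: power2_sum)
        finally have b1: "(norm (1 + s eps * g0 eps))\<^sup>2 \<le> 2 * (1 + (norm (s eps))\<^sup>2 * N0 eps)"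
          by (simp add: norm_mult power_mult_distrib N0_def)
        have s2: "(norm (s eps))\<^sup>2 \<le> eps\<^sup>2 * C\<^sup>2"
          using power_mono[OF sb, of 2] by (simp add: power_mult_distrib)
        have "(norm c)\<^sup>2 * N1 eps = (norm (s eps))\<^sup>2 * (norm (1 + s eps * g0 eps))\<^sup>2"
          using arg_cong[OF rel[of eps], of "\<lambda>w. (norm w)\<^sup>2"] eps
          by (simp add: norm_mult power_mult_distrib N1_def)
        also have "\<dots> \<le> (norm (s eps))\<^sup>2 * (2 * (1 + (norm (s eps))\<^sup>2 * N0 eps))"
          using b1 by (intro mult_left_mono) auto
        also have "\<dots> \<le> (eps\<^sup>2 * C\<^sup>2) * (2 * (1 + (eps\<^sup>2 * C\<^sup>2) * N0 eps))"
          using s2 by (intro mult_mono add_left_mono mult_left_mono mult_right_mono) (auto simp: N0_def)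
        finally have "(norm c)\<^sup>2 * N1 eps \<le> eps * (2 * (eps * C\<^sup>2 + eps ^ 3 * N0 eps * C ^ 4))"
          by (simp add: power2_eq_square numeral_eq_Suc algebra_simps)
        then have "N1 eps / eps \<le> 2 / (norm c)\<^sup>2 * (eps * C\<^sup>2 + eps ^ 3 * N0 eps * C ^ 4)"
          using eps \<open>c \<noteq> 0\<close> by (simp add: field_simps)
        moreover have "N1 eps / eps \<ge> 0" using eps by (simp add: N1_def)
        ultimately show "norm (N1 eps / eps) \<le> 2 / (norm c)\<^sup>2 * (eps * C\<^sup>2 + eps ^ 3 * N0 eps * C ^ 4)" by simp
      qed
      have "((\<lambda>eps. 2 / (norm c)\<^sup>2 * (eps * C\<^sup>2 + eps ^ 3 * N0 eps * C ^ 4)) \<longlongrightarrow> 2 / (norm c)\<^sup>2 * (0 * C\<^sup>2 + 0 * C ^ 4)) ?F"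
        by (intro tendsto_intros id e3N0)
      then show "((\<lambda>eps. 2 / (norm c)\<^sup>2 * (eps * C\<^sup>2 + eps ^ 3 * N0 eps * C ^ 4)) \<longlongrightarrow> 0) ?F" by simp
    qed
    then show False using notN1 by simp
  next
    case False
    have small: "((\<lambda>eps. eps * norm (\<eta> eps)) \<longlongrightarrow> 0) ?F" if "(\<eta> \<longlongrightarrow> L) ?F" for \<eta> :: "real \<Rightarrow> complex" and L
      using tendsto_mult[OF id tendsto_norm[OF that]] by simp
    have tend0: "(g \<longlongrightarrow> 0) ?F" if "\<And>eps. 0 < eps \<Longrightarrow> eps < r \<Longrightarrow> (norm (g eps))\<^sup>2 = eps * norm (\<eta> eps)" "(\<eta> \<longlongrightarrow> L) ?F"
      for g \<eta> :: "real \<Rightarrow> complex" and L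
    proof -
      have "((\<lambda>eps. sqrt (eps * norm (\<eta> eps))) \<longlongrightarrow> sqrt 0) ?F" by (intro tendsto_real_sqrt small[OF that(2)])
      moreover have "\<forall>\<^sub>F eps in ?F. sqrt (eps * norm (\<eta> eps)) = norm (g eps)"
        using ev by (rule eventually_mono) (simp add: that(1)[symmetric])
      ultimately have "((\<lambda>eps. norm (g eps)) \<longlongrightarrow> 0) ?F" by (simp add: Lim_transform_eventually)
      then show ?thesis by (rule tendsto_norm_zero_cancel)
    qed
    have three0: "(norm (g0 eps))\<^sup>2 = eps * norm (h0 eps)" if "k0 = 3" "0 < eps" "eps < r" for eps
      using n0[OF that(2,3)] that by (simp add: N0_def power2_eq_square power3_eq_cube)
    have three1: "(norm (g1 eps))\<^sup>2 = eps * norm (h1 eps)" if "k1 = 3" "0 < eps" "eps < r" for eps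
      using n1[OF that(2,3)] that by (simp add: N1_def power2_eq_square power3_eq_cube)
    have one: "(L::complex) = 0" if "(g \<longlongrightarrow> G) ?F" "(\<eta> \<longlongrightarrow> L) ?F"
      "\<And>eps. 0 < eps \<Longrightarrow> eps < r \<Longrightarrow> eps\<^sup>2 * (norm (g eps))\<^sup>2 = eps ^ 1 * norm (\<eta> eps)" for g \<eta> :: "real \<Rightarrow> complex" and L G
    proof -
      have "((\<lambda>eps. eps * (norm (g eps))\<^sup>2) \<longlongrightarrow> 0 * (norm G)\<^sup>2) ?F" by (intro tendsto_intros id that)
      then have "((\<lambda>eps. eps * (norm (g eps))\<^sup>2) \<longlongrightarrow> 0) ?F" by simp
      moreover have "\<forall>\<^sub>F eps in ?F. eps * (norm (g eps))\<^sup>2 = norm (\<eta> eps)"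
        using ev
      proof (rule eventually_mono)
        fix eps assume "0 < eps \<and> eps < r"
        then have "eps * (eps * (norm (g eps))\<^sup>2) = eps * norm (\<eta> eps)" using that(3)[of eps] by (simp add: power2_eq_square)
        then show "eps * (norm (g eps))\<^sup>2 = norm (\<eta> eps)" using \<open>0 < eps \<and> eps < r\<close> by simp
      qed
      ultimately have "((\<lambda>eps. norm (\<eta> eps)) \<longlongrightarrow> 0) ?F" by (rule Lim_transform_eventually)
      then show ?thesis using tendsto_unique[OF _ tendsto_norm[OF that(2)]] by fastforce
    qed
    consider "k0 = 3" | "k0 = 1" "k1 = 3" | "k0 = 1" "k1 = 1" using k by blast
    then show False
    proof cases
      \<comment> \<open>As \<open>g0\<close> tends to 0, the relation sends \<open>g1\<close> to
        \<open>s0 / c\<close>, finite and nonzero, which fits neither a zero nor a pole.\<close>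
      case 1
      have g0: "(g0 \<longlongrightarrow> 0) ?F" by (rule tend0[OF three0[OF 1] h(1)])
      have "((\<lambda>eps. s eps * (1 + s eps * g0 eps) / c) \<longlongrightarrow> s0 * (1 + s0 * 0) / c) ?F"
        by (intro tendsto_intros sl g0 \<open>c \<noteq> 0\<close>)
      moreover have "\<forall>\<^sub>F eps in ?F. s eps * (1 + s eps * g0 eps) / c = g1 eps"
        using ev by (rule eventually_mono) (use rel \<open>c \<noteq> 0\<close> in \<open>simp add: rel[symmetric]\<close>)
      ultimately have g1: "(g1 \<longlongrightarrow> s0 / c) ?F" by (simp add: Lim_transform_eventually)
      show False
      proof (cases "k1 = 3")
        case True
        then have "s0 / c = 0"
          using tendsto_unique[OF _ g1 tend0[OF three1[OF True] h(2)]] by simp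
        then show False using False \<open>s0 \<noteq> 0\<close> \<open>c \<noteq> 0\<close> by simp
      next
        case F: False
        then have "k1 = 1" using k by simp
        then show False using one[OF g1 h(2)] n1 nz by (simp add: N1_def)
      qed
    next
      \<comment> \<open>As \<open>g1\<close> tends to 0, solving the relation for \<open>g0\<close>
        gives a finite limit, which excludes a pole.\<close>
      case 2
      have g1: "(g1 \<longlongrightarrow> 0) ?F" by (rule tend0[OF three1[OF 2(2)] h(2)])
      have "((\<lambda>eps. (c * g1 eps - s eps) / (s eps)\<^sup>2) \<longlongrightarrow> (c * 0 - s0) / s0\<^sup>2) ?F"
        by (intro tendsto_intros sl g1) (use False in simp)
      moreover have "\<forall>\<^sub>F eps in ?F. (c * g1 eps - s eps) / (s eps)\<^sup>2 = g0 eps"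
        using ev tendsto_imp_eventually_ne[OF sl False]
        by eventually_elim (simp add: rel field_simps power2_eq_square)
      ultimately have g0: "(g0 \<longlongrightarrow> (c * 0 - s0) / s0\<^sup>2) ?F" by (rule Lim_transform_eventually)
      show False using one[OF g0 h(1)] n0 nz 2 by (simp add: N0_def)
    next
      case 3
      \<comment> \<open>In the squared relation multiplied by \<open>t\<close>, the terms
        \<open>t * g0\<^sup>2\<close> and \<open>t * g1\<^sup>2\<close> become the analytic factors
        \<open>h0\<close> and \<open>h1\<close>; \<open>Q\<close> collects everything but the cross
        term.\<close>
      define Q where "Q eps = c\<^sup>2 * h1 eps - (s eps) ^ 4 * h0 eps - t eps * (s eps)\<^sup>2" for eps
      have Qeq: "Q eps = 2 * (s eps) ^ 3 * (t eps * g0 eps)" if "0 < eps" "eps < r" for eps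
      proof -
        have "t eps \<noteq> 0" using that by (simp add: t_def)
        then have h01: "t eps * (g0 eps)\<^sup>2 = h0 eps" "t eps * (g1 eps)\<^sup>2 = h1 eps"
          using f0[OF that] f1[OF that] 3
          by (simp_all add: t_def[symmetric] h0_def h1_def power2_eq_square)
        have "c\<^sup>2 * h1 eps = t eps * (c * g1 eps)\<^sup>2"
          unfolding h01(2)[symmetric] by (simp add: power_mult_distrib)
        also have "\<dots> = t eps * (s eps * (1 + s eps * g0 eps))\<^sup>2" by (simp only: rel[OF that])
        also have "\<dots> = t eps * (s eps)\<^sup>2 + 2 * (s eps) ^ 3 * (t eps * g0 eps) + (s eps) ^ 4 * (t eps * (g0 eps)\<^sup>2)"
          by (simp add: power2_eq_square numeral_eq_Suc algebra_simps)
        finally show ?thesis unfolding h01 Q_def by simp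
      qed
      have Qn: "norm (Q eps / complex_of_real (sqrt eps)) = 2 * (norm (s eps)) ^ 3 * sqrt (norm (h0 eps))"
        if "0 < eps" "eps < r" for eps
      proof -
        have "eps * (eps * (norm (g0 eps))\<^sup>2) = eps * norm (h0 eps)"
          using n0[OF that] 3 by (simp add: N0_def power2_eq_square)
        then have "norm (h0 eps) = eps * (norm (g0 eps))\<^sup>2" using that by simp
        then have sh: "sqrt (norm (h0 eps)) = sqrt eps * norm (g0 eps)" by (simp add: real_sqrt_mult)
        have "norm (t eps) / sqrt eps = sqrt eps" using that by (simp add: t_def norm_mult real_div_sqrt)
        moreover have "norm (Q eps / complex_of_real (sqrt eps)) =
            2 * (norm (s eps)) ^ 3 * ((norm (t eps) / sqrt eps) * norm (g0 eps))"
          unfolding Qeq[OF that] using that by (simp add: norm_mult norm_divide norm_power)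
        ultimately show ?thesis by (simp only: sh)
      qed
      have Qlim: "((\<lambda>eps. norm (Q eps / complex_of_real (sqrt eps))) \<longlongrightarrow> 2 * (norm s0) ^ 3 * sqrt (norm (\<eta>0 \<xi>))) ?F"
      proof (rule Lim_transform_eventually)
        show "((\<lambda>eps. 2 * (norm (s eps)) ^ 3 * sqrt (norm (h0 eps))) \<longlongrightarrow> 2 * (norm s0) ^ 3 * sqrt (norm (\<eta>0 \<xi>))) ?F"
          by (intro tendsto_intros sl h)
        show "\<forall>\<^sub>F eps in ?F. 2 * (norm (s eps)) ^ 3 * sqrt (norm (h0 eps)) = norm (Q eps / complex_of_real (sqrt eps))"
          using ev by (rule eventually_mono) (simp add: Qn)
      qed
      define q0 where "q0 = c\<^sup>2 * \<eta>1 \<xi> - s0 ^ 4 * \<eta>0 \<xi>"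
      \<comment> \<open>The norm of \<open>Q / sqrt eps\<close> has a finite limit, so
        \<open>Q\<close> itself tends to 0 and its constant term vanishes.\<close>
      have "q0 = 0"
      proof -
        have "(Q \<longlongrightarrow> c\<^sup>2 * \<eta>1 \<xi> - s0 ^ 4 * \<eta>0 \<xi> - 0 * s0\<^sup>2) ?F"
          unfolding Q_def[abs_def] by (intro tendsto_intros sl h t0)
        moreover have "((\<lambda>eps. sqrt eps * norm (Q eps / complex_of_real (sqrt eps))) \<longlongrightarrow> 0 * (2 * (norm s0) ^ 3 * sqrt (norm (\<eta>0 \<xi>)))) ?F"
          by (intro tendsto_mult sq Qlim)
        then have lim: "((\<lambda>eps. sqrt eps * norm (Q eps / complex_of_real (sqrt eps))) \<longlongrightarrow> 0) ?F" by simp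
        have "((\<lambda>eps. norm (Q eps)) \<longlongrightarrow> 0) ?F"
        proof (rule Lim_transform_eventually[OF lim eventually_mono[OF ev]])
          show "sqrt eps * norm (Q eps / complex_of_real (sqrt eps)) = norm (Q eps)" if "0 < eps \<and> eps < r" for eps
            using that by (simp add: norm_divide)
        qed
        then have "(Q \<longlongrightarrow> 0) ?F" by (rule tendsto_norm_zero_cancel)
        ultimately show ?thesis unfolding q0_def using tendsto_unique[of ?F Q] by fastforce
      qed
      \<comment> \<open>Every ingredient of \<open>Q\<close> differs from its limit by
        \<open>O(eps)\<close>, so \<open>Q / sqrt eps\<close> tends to 0; by \<open>Qlim\<close> its
        norm tends to a nonzero number.\<close>
      have tsq: "((\<lambda>eps. t eps / complex_of_real (sqrt eps)) \<longlongrightarrow> 0) ?F"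
      proof (rule tendsto_norm_zero_cancel, rule Lim_transform_eventually[OF sq])
        show "\<forall>\<^sub>F eps in ?F. sqrt eps = norm (t eps / complex_of_real (sqrt eps))"
          using ev by (rule eventually_mono) (simp add: t_def norm_mult norm_divide real_div_sqrt)
      qed
      have ssq: "((\<lambda>eps. (s eps - s0) / complex_of_real (sqrt eps)) \<longlongrightarrow> 0) ?F"
      proof (rule Lim_null_comparison)
        show "\<forall>\<^sub>F eps in ?F. norm ((s eps - s0) / complex_of_real (sqrt eps)) \<le> sqrt eps * C"
          using ev
        proof (rule eventually_mono)
          fix eps assume eps: "0 < eps \<and> eps < r"
          have "norm ((s eps - s0) / complex_of_real (sqrt eps)) = norm (s eps - s0) / sqrt eps"
            using eps by (simp add: norm_divide)
          also have "\<dots> \<le> (eps * C) / sqrt eps" using s[of eps] eps by (intro divide_right_mono) auto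
          also have "\<dots> = (eps / sqrt eps) * C" by simp
          also have "eps / sqrt eps = sqrt eps" using eps by (simp add: real_div_sqrt)
          finally show "norm ((s eps - s0) / complex_of_real (sqrt eps)) \<le> sqrt eps * C" .
        qed
        show "((\<lambda>eps. sqrt eps * C) \<longlongrightarrow> 0) ?F" using tendsto_mult_left_zero[OF sq] by simp
      qed
      have hsq: "((\<lambda>eps. (\<eta> (\<xi> + t eps) - \<eta> \<xi>) / complex_of_real (sqrt eps)) \<longlongrightarrow> 0) ?F"
        if "(\<eta> has_field_derivative D) (at \<xi>)" for \<eta> D
      proof -
        have "filterlim (\<lambda>eps. t eps) (at 0) ?F"
          unfolding filterlim_at using t0 ev by (auto simp: t_def elim: eventually_mono)
        then have "((\<lambda>eps. (\<eta> (\<xi> + t eps) - \<eta> \<xi>) / t eps) \<longlongrightarrow> D) ?F"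
          using that unfolding DERIV_def by (rule filterlim_compose[rotated])
        then have "((\<lambda>eps. (\<eta> (\<xi> + t eps) - \<eta> \<xi>) / t eps * (t eps / complex_of_real (sqrt eps))) \<longlongrightarrow> D * 0) ?F"
          by (intro tendsto_mult tsq)
        then have lim: "((\<lambda>eps. (\<eta> (\<xi> + t eps) - \<eta> \<xi>) / t eps * (t eps / complex_of_real (sqrt eps))) \<longlongrightarrow> 0) ?F"
          by simp
        show ?thesis
        proof (rule Lim_transform_eventually[OF lim eventually_mono[OF ev]])
          show "(\<eta> (\<xi> + t eps) - \<eta> \<xi>) / t eps * (t eps / complex_of_real (sqrt eps)) = (\<eta> (\<xi> + t eps) - \<eta> \<xi>) / complex_of_real (sqrt eps)"
            if "0 < eps \<and> eps < r" for eps using that by (simp add: t_def)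
        qed
      qed
      have "((\<lambda>eps. c\<^sup>2 * ((\<eta>1 (\<xi> + t eps) - \<eta>1 \<xi>) / complex_of_real (sqrt eps))
          - (s eps - s0) / complex_of_real (sqrt eps) * (((s eps) ^ 3 + (s eps)\<^sup>2 * s0 + s eps * s0\<^sup>2 + s0 ^ 3) * h0 eps)
          - s0 ^ 4 * ((\<eta>0 (\<xi> + t eps) - \<eta>0 \<xi>) / complex_of_real (sqrt eps))
          - t eps / complex_of_real (sqrt eps) * (s eps)\<^sup>2)
        \<longlongrightarrow> c\<^sup>2 * 0 - 0 * ((s0 ^ 3 + s0\<^sup>2 * s0 + s0 * s0\<^sup>2 + s0 ^ 3) * \<eta>0 \<xi>) - s0 ^ 4 * 0 - 0 * s0\<^sup>2) ?F"
        by (intro tendsto_intros hsq[OF d(1)] hsq[OF d(2)] ssq tsq sl h)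
      moreover have "c\<^sup>2 * ((\<eta>1 (\<xi> + t eps) - \<eta>1 \<xi>) / w)
          - (s eps - s0) / w * (((s eps) ^ 3 + (s eps)\<^sup>2 * s0 + s eps * s0\<^sup>2 + s0 ^ 3) * h0 eps)
          - s0 ^ 4 * ((\<eta>0 (\<xi> + t eps) - \<eta>0 \<xi>) / w)
          - t eps / w * (s eps)\<^sup>2 = Q eps / w" for eps w
      proof -
        have "c\<^sup>2 * (\<eta>1 (\<xi> + t eps) - \<eta>1 \<xi>)
          - (s eps - s0) * (((s eps) ^ 3 + (s eps)\<^sup>2 * s0 + s eps * s0\<^sup>2 + s0 ^ 3) * h0 eps)
          - s0 ^ 4 * (\<eta>0 (\<xi> + t eps) - \<eta>0 \<xi>)
          - t eps * (s eps)\<^sup>2 = Q eps - q0"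
          unfolding Q_def q0_def h0_def h1_def by (simp add: algebra_simps power2_eq_square numeral_eq_Suc)
        then have "Q eps = c\<^sup>2 * (\<eta>1 (\<xi> + t eps) - \<eta>1 \<xi>)
          - (s eps - s0) * (((s eps) ^ 3 + (s eps)\<^sup>2 * s0 + s eps * s0\<^sup>2 + s0 ^ 3) * h0 eps)
          - s0 ^ 4 * (\<eta>0 (\<xi> + t eps) - \<eta>0 \<xi>)
          - t eps * (s eps)\<^sup>2" using \<open>q0 = 0\<close> by simp
        moreover have "E * (A / w) - B / w * P - E' * (B' / w) - D / w * P' =
            (E * A - B * P - E' * B' - D * P') / w" for A B B' D E E' P P' :: complex
          by (simp add: diff_divide_distrib)
        ultimately show ?thesis by (simp only:)
      qed
      ultimately have "((\<lambda>eps. Q eps / complex_of_real (sqrt eps)) \<longlongrightarrow> 0) ?F" by simp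
      then have "((\<lambda>eps. norm (Q eps / complex_of_real (sqrt eps))) \<longlongrightarrow> 0) ?F" by (rule tendsto_norm_zero)
      then have "2 * (norm s0) ^ 3 * sqrt (norm (\<eta>0 \<xi>)) = 0"
        using tendsto_unique[OF _ Qlim] by fastforce
      then show False using False nz by simp
    qed
  qed
qed

section \<open>The left Weyl ratio and the contradiction on the bands\<close>

context gap_jacobi
begin

text \<open>The witness is \<open>s = a 0 * v 1 / v 0\<close>, with \<open>v\<close> the column of
  the Green function at 1, a solution on \<open>k \<le> 0\<close>. The Wronskian of \<open>u\<close>
  and \<open>v\<close> is \<open>i eps\<close> times the sum of \<open>u k * v k\<close>, hence at
  most \<open>eps * sqrt (U * V)\<close>. Since \<open>V = |v 0|^2 Im s / eps\<close> and
  \<open>Im s \<le> |s - s0|\<close>, one factor \<open>|s - s0|\<close> cancels and the error is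
  linear in \<open>eps\<close>. The relation for the diagonal entries is the Wronskian of columns 0
  and 1.\<close>

lemma left_weyl_ratio:
  fixes u :: "int \<Rightarrow> real"
  assumes u: "\<And>k. k \<le> 0 \<Longrightarrow> jac2 a b (\<lambda>k. complex_of_real (u k)) k = complex_of_real (x * u k)"
    and "u 0 \<noteq> 0" and U: "\<And>F. finite F \<Longrightarrow> F \<subseteq> {..0} \<Longrightarrow> (\<Sum>k\<in>F. (u k)\<^sup>2) \<le> U"
    and "eps > 0" and zdef: "z = ray x eps"
  shows "\<exists>s. norm (s - complex_of_real (a 0 * u 1 / u 0)) \<le> eps * (U / (u 0)\<^sup>2) \<and>
    complex_of_real ((a 0)\<^sup>2) * G 1 1 z = s * (1 + s * G 0 0 z)"
proof -
  let ?u = "\<lambda>k. complex_of_real (u k)"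
  define v where "v = coord (grn 1 z)"
  define f where "f = coord (grn 0 z)"
  define A where "A = complex_of_real (a 0)"
  have Imz: "Im z = eps" by (simp add: zdef)
  have z: "z \<notin> complex_of_real ` e" using \<open>eps > 0\<close> Imz by (intro nonreal_not_spec) simp
  have "A \<noteq> 0" using a_pos[of 0] by (simp add: A_def)
  have cut: "(\<lambda>k. if k \<le> 0 then w k else 0) \<in> l2" if "w \<in> l2" for w :: "int \<Rightarrow> complex"
    using that by (rule l2_dominated[where C = 1]) simp
  have vl: "(\<lambda>k. if k \<le> 0 then v k else 0) \<in> l2" and fl: "(\<lambda>k. if k \<le> 0 then f k else 0) \<in> l2"
    by (auto intro!: cut simp: v_def f_def)
  have cvl: "(\<lambda>k. if k \<le> 0 then cnj (v k) else 0) \<in> l2"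
    using vl by (rule l2_dominated[where C = 1]) simp
  have ul: "(\<lambda>k. if k \<le> 0 then ?u k else 0) \<in> l2"
  proof (rule l2_finite_sumsI(1))
    fix F :: "int set" assume "finite F"
    have "(\<Sum>i\<in>F. (norm (if i \<le> 0 then ?u i else 0))\<^sup>2) = (\<Sum>i\<in>F \<inter> {..0}. (u i)\<^sup>2)"
      using \<open>finite F\<close> by (subst sum.inter_restrict) (auto intro!: sum.cong)
    also have "\<dots> \<le> U" using \<open>finite F\<close> by (intro U) auto
    finally show "(\<Sum>i\<in>F. (norm (if i \<le> 0 then ?u i else 0))\<^sup>2) \<le> U" .
  qed
  have jv: "jac2 a b v k = z * v k" if "k \<le> 0" for k
    using jac2_grn[OF z, of 1 k] that by (simp add: v_def)
  have jf: "jac2 a b f k = z * f k + (if k = 0 then 1 else 0)" for k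
    using jac2_grn[OF z, of 0 k] by (simp add: f_def)
  define S where "S N = (\<Sum>k=-int N..0. (norm (v k))\<^sup>2)" for N :: nat
  \<comment> \<open>The sum of \<open>|v k|^2\<close> over \<open>k \<le> 0\<close>, evaluated
    through the Wronskian of \<open>v\<close> and its conjugate.\<close>
  define V where "V = a 0 * Im (cnj (v 0) * v 1) / eps"
  have SV: "S \<longlonglongrightarrow> V"
  proof -
    have "(\<lambda>N::nat. \<Sum>k=-int N..0. v k * jac2 a b (\<lambda>k. cnj (v k)) k - cnj (v k) * jac2 a b v k)
        \<longlonglongrightarrow> of_real (a 0) * (v 0 * cnj (v 1) - cnj (v 0) * v 1)"
      using green_left[OF vl cvl] .
    moreover have "(\<Sum>k=-int N..0. v k * jac2 a b (\<lambda>k. cnj (v k)) k - cnj (v k) * jac2 a b v k)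
        = - 2 * \<i> * complex_of_real (eps * S N)" for N
      unfolding S_def sum_distrib_left of_real_sum
    proof (rule sum.cong)
      fix k assume "k \<in> {- int N..0}"
      then have "k \<le> 0" by simp
      then show "v k * jac2 a b (\<lambda>k. cnj (v k)) k - cnj (v k) * jac2 a b v k
          = - 2 * \<i> * complex_of_real (eps * (norm (v k))\<^sup>2)"
        unfolding cnj_jac2 jv[OF \<open>k \<le> 0\<close>] cmod_power2 Imz[symmetric]
        by (simp add: complex_eq_iff power2_eq_square algebra_simps)
    qed simp
    ultimately have "(\<lambda>N. - 2 * \<i> * complex_of_real (eps * S N)) \<longlonglongrightarrow> of_real (a 0) * (v 0 * cnj (v 1) - cnj (v 0) * v 1)"
      by simp
    from tendsto_Im[OF this] have "(\<lambda>N. - 2 * (eps * S N)) \<longlonglongrightarrow> - 2 * (a 0 * Im (cnj (v 0) * v 1))"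
      by (simp add: algebra_simps)
    then have "(\<lambda>N. - 2 * (eps * S N) / (- 2 * eps)) \<longlonglongrightarrow> - 2 * (a 0 * Im (cnj (v 0) * v 1)) / (- 2 * eps)"
      by (rule tendsto_divide[OF _ tendsto_const]) (use \<open>eps > 0\<close> in simp)
    then show ?thesis using \<open>eps > 0\<close> by (simp add: V_def)
  qed
  have "incseq S"
    unfolding S_def by (intro incseq_SucI sum_mono2) auto
  then have SleV: "S N \<le> V" for N using SV by (rule incseq_le)
  \<comment> \<open>If \<open>v 0 = 0\<close>, then \<open>V = 0\<close> forces
    \<open>v (-1) = 0\<close> and the recursion at 0 gives \<open>v 1 = 0\<close>, against
    \<open>Im (G 1 1 z) > 0\<close>.\<close>
  have "v 0 \<noteq> 0"
  proof
    assume v0: "v 0 = 0"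
    then have "S 1 \<le> 0" using SleV[of 1] by (simp add: V_def)
    moreover have "(norm (v (-1)))\<^sup>2 \<le> S 1"
      unfolding S_def by (rule member_le_sum) auto
    ultimately have "(norm (v (-1)))\<^sup>2 \<le> 0" by linarith
    then have "v (-1) = 0" by simp
    then have "A * v 1 = 0" using jv[of 0] v0 by (simp add: jac2_def A_def)
    then have "v 1 = 0" using \<open>A \<noteq> 0\<close> by simp
    then show False using Im_G_pos[of z 1] \<open>eps > 0\<close> Imz by (simp add: v_def)
  qed
  define s where "s = A * v 1 / v 0"
  define s0 where "s0 = complex_of_real (a 0 * u 1 / u 0)"
  have ims: "V = (norm (v 0))\<^sup>2 * Im s / eps"
  proof -
    have "v 1 = s * v 0 / A" using \<open>v 0 \<noteq> 0\<close> \<open>A \<noteq> 0\<close> by (simp add: s_def)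
    then have "A * (cnj (v 0) * v 1) = s * (v 0 * cnj (v 0))" using \<open>A \<noteq> 0\<close> by simp
    also have "v 0 * cnj (v 0) = complex_of_real ((norm (v 0))\<^sup>2)" by (rule complex_norm_square[symmetric])
    finally have "Im (A * (cnj (v 0) * v 1)) = Im s * (norm (v 0))\<^sup>2" by simp
    then show ?thesis by (simp add: V_def A_def)
  qed
  have W: "norm (A * (?u 0 * v 1 - v 0 * ?u 1)) \<le> eps * sqrt (U * V)"
  proof (rule tendsto_upperbound)
    show "(\<lambda>N::nat. norm (\<Sum>k=-int N..0. ?u k * jac2 a b v k - v k * jac2 a b ?u k))
        \<longlonglongrightarrow> norm (A * (?u 0 * v 1 - v 0 * ?u 1))"
      unfolding A_def by (intro tendsto_norm green_left ul vl)
    have "norm (\<Sum>k=-int N..0. ?u k * jac2 a b v k - v k * jac2 a b ?u k) \<le> eps * sqrt (U * V)" for N :: nat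
    proof -
      have "(\<Sum>k=-int N..0. ?u k * jac2 a b v k - v k * jac2 a b ?u k) = (\<Sum>k=-int N..0. \<i> * complex_of_real eps * (?u k * v k))"
        by (intro sum.cong) (auto simp: u jv zdef algebra_simps)
      then have "norm (\<Sum>k=-int N..0. ?u k * jac2 a b v k - v k * jac2 a b ?u k) \<le> (\<Sum>k=-int N..0. eps * (\<bar>u k\<bar> * norm (v k)))"
        using \<open>eps > 0\<close> by (auto intro!: order_trans[OF norm_sum] sum_mono simp: norm_mult)
      also have "\<dots> = eps * (\<Sum>k=-int N..0. \<bar>u k\<bar> * norm (v k))" by (simp add: sum_distrib_left)
      also have "(\<Sum>k=-int N..0. \<bar>u k\<bar> * norm (v k)) \<le> sqrt (U * V)"
      proof (rule real_le_rsqrt)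
        have "(\<Sum>k=-int N..0. \<bar>u k\<bar> * norm (v k))\<^sup>2 \<le> (\<Sum>k=-int N..0. \<bar>u k\<bar>\<^sup>2) * (\<Sum>k=-int N..0. (norm (v k))\<^sup>2)"
          by (rule Cauchy_Schwarz_ineq_sum)
        also have "\<dots> \<le> U * V"
          using U[of "{-int N..0}"] SleV[of N]
          by (intro mult_mono) (auto simp: S_def intro!: sum_nonneg order_trans[OF sum_nonneg U[of "{-int N..0}"]])
        finally show "(\<Sum>k=-int N..0. \<bar>u k\<bar> * norm (v k))\<^sup>2 \<le> U * V" .
      qed
      finally show ?thesis using \<open>eps > 0\<close> by (simp add: mult_left_mono)
    qed
    then show "\<forall>\<^sub>F N in sequentially. norm (\<Sum>k=-int N..0. ?u k * jac2 a b v k - v k * jac2 a b ?u k) \<le> eps * sqrt (U * V)"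
      by simp
  qed simp
  have "V \<ge> 0" using SleV[of 0] by (simp add: S_def order_trans[OF zero_le_power2])
  have "U \<ge> 0" using U[of "{}"] by simp
  define D where "D = norm (s - s0)"
  have "norm (A * (?u 0 * v 1 - v 0 * ?u 1)) = D * (\<bar>u 0\<bar> * norm (v 0))"
  proof -
    have "A * (?u 0 * v 1 - v 0 * ?u 1) = (s - s0) * (?u 0 * v 0)"
      using \<open>v 0 \<noteq> 0\<close> \<open>u 0 \<noteq> 0\<close> by (simp add: s_def s0_def A_def field_simps)
    then show ?thesis by (simp add: D_def norm_mult)
  qed
  then have "(D * (\<bar>u 0\<bar> * norm (v 0)))\<^sup>2 \<le> (eps * sqrt (U * V))\<^sup>2"
    using W by (intro power_mono) (auto simp: D_def)
  then have "D\<^sup>2 * (u 0)\<^sup>2 * (norm (v 0))\<^sup>2 \<le> eps\<^sup>2 * (U * V)"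
    using \<open>U \<ge> 0\<close> \<open>V \<ge> 0\<close> by (simp add: power_mult_distrib mult_ac)
  also have "\<dots> = (eps * U * Im s) * (norm (v 0))\<^sup>2"
    unfolding ims using \<open>eps > 0\<close> by (simp add: power2_eq_square)
  finally have "D\<^sup>2 * (u 0)\<^sup>2 \<le> eps * U * Im s"
    by (rule mult_right_le_imp_le) (use \<open>v 0 \<noteq> 0\<close> in simp)
  also have "\<dots> \<le> eps * U * D"
  proof (rule mult_left_mono)
    \<comment> \<open>\<open>s0\<close> is real, so \<open>Im s\<close> is bounded by the very
      distance being estimated.\<close>
    have "Im s = Im (s - s0)" by (simp add: s0_def)
    also have "\<dots> \<le> D" unfolding D_def using abs_Im_le_cmod[of "s - s0"] by linarith
    finally show "Im s \<le> D" .
  qed (use \<open>eps > 0\<close> \<open>U \<ge> 0\<close> in simp)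
  finally have DD: "D * (D * (u 0)\<^sup>2) \<le> D * (eps * U)" by (simp add: power2_eq_square mult_ac)
  have "D * (u 0)\<^sup>2 \<le> eps * U"
  proof (cases "D = 0")
    case True then show ?thesis using \<open>eps > 0\<close> \<open>U \<ge> 0\<close> by simp
  next
    case False
    then have "D > 0" by (simp add: D_def)
    then show ?thesis using DD by simp
  qed
  then have Dle: "D \<le> eps * (U / (u 0)\<^sup>2)" using \<open>u 0 \<noteq> 0\<close> by (simp add: field_simps)
  have "A * (f 0 * v 1 - v 0 * f 1) = - v 0"
  proof -
    have "(\<lambda>N::nat. \<Sum>k=-int N..0. f k * jac2 a b v k - v k * jac2 a b f k) \<longlonglongrightarrow> A * (f 0 * v 1 - v 0 * f 1)"
      unfolding A_def by (rule green_left[OF fl vl])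
    moreover have "(\<Sum>k=-int N..0. f k * jac2 a b v k - v k * jac2 a b f k) = - v 0" for N :: nat
    proof -
      have "(\<Sum>k=-int N..0. f k * jac2 a b v k - v k * jac2 a b f k) = (\<Sum>k=-int N..0. if k = 0 then - v 0 else 0)"
        by (intro sum.cong) (auto simp: jv jf algebra_simps)
      then show ?thesis by (simp add: sum.delta)
    qed
    ultimately show ?thesis by (simp add: LIMSEQ_const_iff)
  qed
  moreover have "f 1 = v 0" using G_sym[OF z, of 1 0] by (simp add: f_def v_def)
  ultimately have "v 0 * (A * v 0) = v 0 * (1 + f 0 * s)"
    using \<open>v 0 \<noteq> 0\<close> by (simp add: s_def algebra_simps)
  then have "A * v 0 = 1 + f 0 * s" using \<open>v 0 \<noteq> 0\<close> by simp
  moreover have "A * v 1 = s * v 0" using \<open>v 0 \<noteq> 0\<close> by (simp add: s_def)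
  ultimately have "A\<^sup>2 * v 1 = s * (1 + s * f 0)"
    by (simp add: power2_eq_square mult.assoc)
  then have "complex_of_real ((a 0)\<^sup>2) * G 1 1 z = s * (1 + s * G 0 0 z)"
    by (simp add: A_def v_def f_def)
  then show ?thesis using Dle unfolding D_def s0_def by blast
qed

end

context gap_jacobi
begin

lemma band_reflection:
  assumes refl: "reflectionless e a b" and "c < d" "{c<..<d} \<subseteq> e"
  obtains h where "h holomorphic_on {z. Re z \<in> {c<..<d}}"
    "\<And>z. Re z \<in> {c<..<d} \<Longrightarrow> 0 < Im z \<Longrightarrow> h z = G n n z"
    "\<And>z. Re z \<in> {c<..<d} \<Longrightarrow> h (cnj z) = - cnj (h z)"
    "\<And>z. Re z \<in> {c<..<d} \<Longrightarrow> 0 < Im (h z)"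
proof -
  have hol: "(\<lambda>z. G n n z) holomorphic_on {z. 0 < Im z}"
    by (rule holomorphic_on_subset[OF G_holomorphic]) auto
  have "AE x in lborel. x \<in> e \<longrightarrow> (\<exists>L. ((\<lambda>eps. green2 a b n (ray x eps)) \<longlongrightarrow> L)
      (at_right 0) \<and> Re L = 0)"
    using refl unfolding reflectionless_def by blast
  then have bdry: "AE x in lborel. x \<in> {c<..<d} \<longrightarrow>
      (\<exists>L. ((\<lambda>eps. G n n (ray x eps)) \<longlongrightarrow> L) (at_right 0) \<and> Re L = 0)"
  proof (rule AE_mp, intro AE_I2 impI)
    fix x
    assume "x \<in> e \<longrightarrow> (\<exists>L. ((\<lambda>eps. green2 a b n (ray x eps)) \<longlongrightarrow> L)
        (at_right 0) \<and> Re L = 0)" "x \<in> {c<..<d}"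
    then obtain L where L: "((\<lambda>eps. green2 a b n (ray x eps)) \<longlongrightarrow> L) (at_right 0)" "Re L = 0"
      using assms(3) by blast
    have "\<forall>\<^sub>F eps in at_right (0::real). green2 a b n (ray x eps) =
        G n n (ray x eps)"
      using eventually_at_right_less[of 0]
      by (rule eventually_mono) (rule green2_eq, rule nonreal_not_spec, simp)
    then have "((\<lambda>eps. G n n (ray x eps)) \<longlongrightarrow> L) (at_right 0)"
      by (rule Lim_transform_eventually[OF L(1)])
    then show "\<exists>L. ((\<lambda>eps. G n n (ray x eps)) \<longlongrightarrow> L) (at_right 0) \<and> Re L = 0"
      using L(2) by blast
  qed
  show thesis
    by (rule holomorphic_imaginary_boundary_reflection[OF hol Im_G_pos assms(2) bdry that])
qed

lemma no_left_l2_solution: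
  fixes u :: "int \<Rightarrow> real"
  assumes gap: "finite_gap_set e" and rl: "reflectionless e a b" and "x \<in> e"
    and u: "\<And>k. k \<le> 0 \<Longrightarrow> jac2 a b (\<lambda>k. complex_of_real (u k)) k = complex_of_real (x * u k)"
    and "u 0 \<noteq> 0" and U: "\<And>F. finite F \<Longrightarrow> F \<subseteq> {..0} \<Longrightarrow> (\<Sum>k\<in>F. (u k)\<^sup>2) \<le> U"
  shows False
proof -
  let ?x = "complex_of_real x"
  define s0 where "s0 = complex_of_real (a 0 * u 1 / u 0)"
  define C where "C = U / (u 0)\<^sup>2"
  define c where "c = complex_of_real ((a 0)\<^sup>2)"
  have "c \<noteq> 0" using a_pos[of 0] by (simp add: c_def)
  have "\<forall>eps. \<exists>s. eps > 0 \<longrightarrow> norm (s - s0) \<le> eps * C \<and>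
      c * G 1 1 (ray x eps) = s * (1 + s * G 0 0 (ray x eps))"
    unfolding s0_def C_def c_def
  proof
    fix eps :: real
    show "\<exists>s. eps > 0 \<longrightarrow> norm (s - complex_of_real (a 0 * u 1 / u 0)) \<le> eps * (U / (u 0)\<^sup>2) \<and>
      complex_of_real ((a 0)\<^sup>2) * G 1 1 (ray x eps) =
        s * (1 + s * G 0 0 (ray x eps))"
    proof (cases "eps > 0")
      case True
      show ?thesis using left_weyl_ratio[OF u \<open>u 0 \<noteq> 0\<close> U True refl] by blast
    qed blast
  qed
  then obtain s where s: "\<And>eps. eps > 0 \<Longrightarrow> norm (s eps - s0) \<le> eps * C"
    and rel: "\<And>eps. eps > 0 \<Longrightarrow> c * G 1 1 (ray x eps) =
      s eps * (1 + s eps * G 0 0 (ray x eps))" by metis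
  have ev: "\<forall>\<^sub>F eps in at_right (0::real). 0 < eps" by (rule eventually_at_right_less)
  from gap \<open>x \<in> e\<close> show False
  proof (cases rule: finite_gap_set_local)
    case (1 \<delta>)
    have val: "\<exists>q>0. ((\<lambda>eps. G n n (ray x eps)) \<longlongrightarrow> \<i> * complex_of_real q) (at_right 0)" for n
    proof -
      have "x - \<delta> < x + \<delta>" using 1 by simp
      then obtain h where h: "h holomorphic_on {z. Re z \<in> {x - \<delta><..<x + \<delta>}}"
        "\<And>z. Re z \<in> {x - \<delta><..<x + \<delta>} \<Longrightarrow> 0 < Im z \<Longrightarrow> h z = G n n z"
        "\<And>z. Re z \<in> {x - \<delta><..<x + \<delta>} \<Longrightarrow> h (cnj z) = - cnj (h z)"
        "\<And>z. Re z \<in> {x - \<delta><..<x + \<delta>} \<Longrightarrow> 0 < Im (h z)"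
        using band_reflection[OF rl _ 1(2)] by blast
      have "h (cnj ?x) = - cnj (h ?x)" by (rule h(3)) (use 1 in simp)
      then have "Re (h ?x) = 0" by (simp add: complex_eq_iff)
      moreover have pos: "Im (h ?x) > 0" by (rule h(4)) (use 1 in simp)
      ultimately have hx: "h ?x = \<i> * complex_of_real (Im (h ?x))" by (simp add: complex_eq_iff)
      have "((\<lambda>eps. ray x eps) \<longlongrightarrow> ?x + \<i> * complex_of_real 0) (at_right 0)"
        by (intro tendsto_intros)
      then have "((\<lambda>eps. h (ray x eps)) \<longlongrightarrow> h ?x) (at_right 0)"
        by (intro continuous_on_tendsto_compose[OF holomorphic_on_imp_continuous_on[OF h(1)]])
           (use 1 in auto)
      moreover have "\<forall>\<^sub>F eps in at_right 0. h (ray x eps) = G n n (ray x eps)"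
        using ev by (rule eventually_mono) (use 1 in \<open>auto intro!: h(2)\<close>)
      ultimately have "((\<lambda>eps. G n n (ray x eps)) \<longlongrightarrow> h ?x) (at_right 0)"
        by (rule Lim_transform_eventually)
      then show ?thesis using pos hx by metis
    qed
    obtain q0 where q0: "q0 > 0" "((\<lambda>eps. G 0 0 (ray x eps)) \<longlongrightarrow> \<i> * complex_of_real q0) (at_right 0)"
      using val by blast
    obtain q1 where q1: "q1 > 0" "((\<lambda>eps. G 1 1 (ray x eps)) \<longlongrightarrow> \<i> * complex_of_real q1) (at_right 0)"
      using val by blast
    have sl: "(s \<longlongrightarrow> s0) (at_right 0)"
    proof (rule LIM_zero_cancel, rule Lim_null_comparison)
      show "\<forall>\<^sub>F eps in at_right 0. norm (s eps - s0) \<le> eps * C" using ev s by (auto elim: eventually_mono)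
      have "((\<lambda>eps::real. eps * C) \<longlongrightarrow> 0 * C) (at_right 0)" by (intro tendsto_intros)
      then show "((\<lambda>eps::real. eps * C) \<longlongrightarrow> 0) (at_right 0)" by simp
    qed
    have "((\<lambda>eps. s eps * (1 + s eps * G 0 0 (ray x eps))) \<longlongrightarrow>
        s0 * (1 + s0 * (\<i> * complex_of_real q0))) (at_right 0)"
      by (intro tendsto_intros sl q0)
    moreover have "\<forall>\<^sub>F eps in at_right 0. s eps * (1 + s eps * G 0 0 (ray x eps)) =
        c * G 1 1 (ray x eps)"
      using ev by (rule eventually_mono) (simp add: rel)
    ultimately have "((\<lambda>eps. c * G 1 1 (ray x eps)) \<longlongrightarrow>
        s0 * (1 + s0 * (\<i> * complex_of_real q0))) (at_right 0)" by (rule Lim_transform_eventually)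
    moreover have "((\<lambda>eps. c * G 1 1 (ray x eps)) \<longlongrightarrow> c * (\<i> * complex_of_real q1)) (at_right 0)"
      by (intro tendsto_intros q1)
    ultimately have eq: "s0 * (1 + s0 * (\<i> * complex_of_real q0)) = c * (\<i> * complex_of_real q1)"
      by (rule tendsto_unique[rotated]) simp
    \<comment> \<open>Apart from the real number \<open>s0\<close> every term is imaginary, so
      \<open>s0 = 0\<close>; the imaginary parts then contradict \<open>q1 > 0\<close>.\<close>
    then have "Re s0 = 0" by (simp add: complex_eq_iff c_def s0_def)
    then have "s0 = 0" by (simp add: s0_def)
    then show False using eq \<open>c \<noteq> 0\<close> q1(1) by simp
  next
    case (2 \<delta> \<sigma>)
    \<comment> \<open>Makes \<open>Im_G_lower\<close> a bound linear in \<open>eps\<close> along the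
      ray, where \<open>|x + i eps| \<le> |x| + \<delta>\<close>.\<close>
    define \<kappa> where "\<kappa> = 1 / (3 * (M + \<bar>x\<bar> + \<delta>))\<^sup>2"
    have "M + \<bar>x\<bar> + \<delta> > 0" using 2(1) M_nonneg by linarith
    then have "\<kappa> > 0" by (simp add: \<kappa>_def)
    have fac: "\<exists>k r \<eta> D. (k = 1 \<or> k = (3::nat)) \<and> 0 < r \<and> (\<eta> has_field_derivative D) (at ?x) \<and> \<eta> ?x \<noteq> 0 \<and>
        (\<forall>eps. 0 < eps \<longrightarrow> eps < r \<longrightarrow> (\<i> * complex_of_real eps)\<^sup>2 * (G n n (ray x eps))\<^sup>2 =
          (\<i> * complex_of_real eps) ^ k * \<eta> (ray x eps))" for n
    proof -
      define c1 where "c1 = min x (x + \<sigma> * \<delta>)"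
      define d1 where "d1 = max x (x + \<sigma> * \<delta>)"
      have E: "y \<in> {c1<..<d1} \<longleftrightarrow> 0 < \<sigma> * (y - x) \<and> \<sigma> * (y - x) < \<delta>" for y
        using 2(1,2) by (auto simp: c1_def d1_def)
      have "c1 < d1" using 2(1,2) by (auto simp: c1_def d1_def)
      moreover have "{c1<..<d1} \<subseteq> e" using E 2(3) by blast
      ultimately obtain h where h: "h holomorphic_on {z. Re z \<in> {c1<..<d1}}"
        "\<And>z. Re z \<in> {c1<..<d1} \<Longrightarrow> 0 < Im z \<Longrightarrow> h z = G n n z"
        "\<And>z. Re z \<in> {c1<..<d1} \<Longrightarrow> h (cnj z) = - cnj (h z)"
        using band_reflection[OF rl] by metis
      have D: "z \<notin> complex_of_real ` e" if "Im z \<noteq> 0 \<or> 0 < \<sigma> * (x - Re z) \<and> \<sigma> * (x - Re z) < \<delta>" for z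
        using that 2(4)[of "Re z"] by auto
      have hol: "(\<lambda>z. G n n z) holomorphic_on {z. Im z \<noteq> 0 \<or> 0 < \<sigma> * (x - Re z) \<and> \<sigma> * (x - Re z) < \<delta>}"
        by (rule holomorphic_on_subset[OF G_holomorphic]) (use D in blast)
      have cnj: "G n n (cnj z) = cnj (G n n z)" if "Im z \<noteq> 0 \<or> 0 < \<sigma> * (x - Re z) \<and> \<sigma> * (x - Re z) < \<delta>" for z
        by (rule G_cnj[OF D[OF that]])
      have upper: "norm (G n n z) \<le> 1 / \<bar>Im z\<bar>" if "Im z \<noteq> 0" for z using that by (rule G_upper)
      have low: "\<kappa> * eps \<le> norm (G n n (ray x eps))" if eps: "0 < eps" "eps < \<delta>" for eps
      proof -
        let ?z = "ray x eps"
        have nz: "norm ?z \<le> \<bar>x\<bar> + \<delta>"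
          using norm_triangle_ineq[of ?x "\<i> * complex_of_real eps"] eps by (simp add: norm_mult)
        have "?z \<noteq> 0" using eps by (simp add: complex_eq_iff)
        then have "3 * (M + norm ?z) > 0" using M_nonneg by (simp add: add_nonneg_pos)
        then have "\<kappa> \<le> 1 / (3 * (M + norm ?z))\<^sup>2"
          unfolding \<kappa>_def using nz by (intro divide_left_mono power_mono mult_pos_pos) auto
        then have "\<kappa> * eps \<le> 1 / (3 * (M + norm ?z))\<^sup>2 * eps"
          by (rule mult_right_mono) (use eps in simp)
        then have "\<kappa> * eps \<le> Im ?z / (3 * (M + norm ?z))\<^sup>2" by simp
        also have "\<dots> \<le> Im (G n n ?z)" using eps by (intro Im_G_lower) simp
        also have "\<dots> \<le> norm (G n n ?z)" using abs_Im_le_cmod[of "G n n ?z"] by linarith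
        finally show ?thesis .
      qed
      have hh1: "h holomorphic_on {z. 0 < \<sigma> * (Re z - x) \<and> \<sigma> * (Re z - x) < \<delta>}"
        using h(1) by (simp only: E)
      have hh2: "h z = G n n z" if "0 < \<sigma> * (Re z - x)" "\<sigma> * (Re z - x) < \<delta>" "0 < Im z" for z
        by (rule h(2)) (use that E in \<open>simp_all only:\<close>)
      have hh3: "h (cnj z) = - cnj (h z)" if "0 < \<sigma> * (Re z - x)" "\<sigma> * (Re z - x) < \<delta>" for z
        by (rule h(3)) (use that E in \<open>simp_all only:\<close>)
      obtain k r \<eta> where k: "k = 1 \<or> k = (3::nat)" "0 < r" "\<eta> holomorphic_on ball ?x r" "\<eta> ?x \<noteq> 0"
        "\<And>eps. 0 < eps \<Longrightarrow> eps < r \<Longrightarrow> (\<i> * complex_of_real eps)\<^sup>2 * (G n n (ray x eps))\<^sup>2 =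
          (\<i> * complex_of_real eps) ^ k * \<eta> (ray x eps)"
      proof -
        show thesis
          by (rule edge_factorization[of \<delta> \<sigma> "\<lambda>z. G n n z" x \<kappa> h,
                OF 2(1) 2(2) hol cnj upper \<open>\<kappa> > 0\<close> low hh1 hh2 hh3 that])
      qed
      moreover have "(\<eta> has_field_derivative deriv \<eta> ?x) (at ?x)"
        by (rule holomorphic_derivI[OF k(3)]) (use k(2) in auto)
      ultimately show ?thesis by blast
    qed
    obtain k0 r0 \<eta>0 D0 where f0: "k0 = 1 \<or> k0 = (3::nat)" "0 < r0" "(\<eta>0 has_field_derivative D0) (at ?x)" "\<eta>0 ?x \<noteq> 0"
      "\<And>eps. 0 < eps \<Longrightarrow> eps < r0 \<Longrightarrow> (\<i> * complex_of_real eps)\<^sup>2 * (G 0 0 (ray x eps))\<^sup>2 =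
          (\<i> * complex_of_real eps) ^ k0 * \<eta>0 (ray x eps)" using fac[of 0] by blast
    obtain k1 r1 \<eta>1 D1 where f1: "k1 = 1 \<or> k1 = (3::nat)" "0 < r1" "(\<eta>1 has_field_derivative D1) (at ?x)" "\<eta>1 ?x \<noteq> 0"
      "\<And>eps. 0 < eps \<Longrightarrow> eps < r1 \<Longrightarrow> (\<i> * complex_of_real eps)\<^sup>2 * (G 1 1 (ray x eps))\<^sup>2 =
          (\<i> * complex_of_real eps) ^ k1 * \<eta>1 (ray x eps)" using fac[of 1] by blast
    show False
    proof (rule edge_orders_inconsistent[of "min r0 r1" c "\<lambda>eps. G 1 1 (ray x eps)" s
          "\<lambda>eps. G 0 0 (ray x eps)" s0 C k0 k1 \<eta>0 D0 ?x \<eta>1 D1])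
      show "min r0 r1 > 0" using f0(2) f1(2) by simp
      fix eps :: real assume eps: "0 < eps" "eps < min r0 r1"
      show "(\<i> * complex_of_real eps)\<^sup>2 * (G 0 0 (ray x eps))\<^sup>2 =
          (\<i> * complex_of_real eps) ^ k0 * \<eta>0 (ray x eps)"
        by (rule f0(5)) (use eps in auto)
      show "(\<i> * complex_of_real eps)\<^sup>2 * (G 1 1 (ray x eps))\<^sup>2 =
          (\<i> * complex_of_real eps) ^ k1 * \<eta>1 (ray x eps)"
        by (rule f1(5)) (use eps in auto)
      show "c * G 1 1 (ray x eps) = s eps * (1 + s eps * G 0 0 (ray x eps))"
        by (rule rel[OF eps(1)])
      show "norm (s eps - s0) \<le> eps * C" by (rule s[OF eps(1)])
    qed (rule \<open>c \<noteq> 0\<close> f0(1) f1(1) f0(3) f1(3) f0(4) f1(4))+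
  qed
qed

end

section \<open>The half-line operator\<close>

text \<open>The half-line operator is realised on the whole line: the off-diagonal entries vanish for \<open>n \<le> 0\<close>,
  so the left half decouples and acts as multiplication by the free parameter \<open>\<beta>\<close>.\<close>

definition ext_a :: "(nat \<Rightarrow> real) \<Rightarrow> int \<Rightarrow> real" where
  "ext_a a n = (if n \<ge> 1 then a (nat n) else 0)"

definition ext_b :: "real \<Rightarrow> (nat \<Rightarrow> real) \<Rightarrow> int \<Rightarrow> real" where
  "ext_b \<beta> b n = (if n \<ge> 1 then b (nat n) else \<beta>)"

definition embed_half :: "(nat \<Rightarrow> complex) \<Rightarrow> int \<Rightarrow> complex" where
  "embed_half f n = (if n \<ge> 1 then f (nat n) else 0)"

definition restrict_half :: "(int \<Rightarrow> complex) \<Rightarrow> nat \<Rightarrow> complex" where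
  "restrict_half g n = (if n = 0 then 0 else g (int n))"

lemma embed_half_l2:
  assumes "f \<in> l2" shows "embed_half f \<in> l2"
proof (rule l2_finite_sumsI(1))
  fix F :: "int set" assume "finite F"
  have inj: "inj_on nat (F \<inter> {1..})" by (auto simp: inj_on_def)
  have "(\<Sum>i\<in>F. (norm (embed_half f i))\<^sup>2) = (\<Sum>i\<in>F \<inter> {1..}. (norm (f (nat i)))\<^sup>2)"
    using \<open>finite F\<close> by (subst sum.inter_restrict) (auto intro!: sum.cong simp: embed_half_def)
  also have "\<dots> = (\<Sum>n\<in>nat ` (F \<inter> {1..}). (norm (f n))\<^sup>2)"
    by (simp add: sum.reindex[OF inj])
  also have "\<dots> \<le> (\<Sum>\<^sub>\<infinity>n. (norm (f n))\<^sup>2)"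
    using assms \<open>finite F\<close> by (intro finite_sum_le_infsum) (auto simp: l2_def)
  finally show "(\<Sum>i\<in>F. (norm (embed_half f i))\<^sup>2) \<le> (\<Sum>\<^sub>\<infinity>n. (norm (f n))\<^sup>2)" .
qed

lemma restrict_half_l2:
  assumes "g \<in> l2" shows "restrict_half g \<in> l2_half"
proof -
  have "(\<lambda>n. (norm (g n))\<^sup>2) summable_on range int"
    using assms unfolding l2_def by (auto intro: summable_on_subset_banach)
  then have "(\<lambda>n. g (int n)) \<in> l2"
    by (simp add: l2_def summable_on_reindex o_def)
  then have "restrict_half g \<in> l2"
    by (rule l2_dominated[where C = 1]) (simp add: restrict_half_def)
  then show ?thesis by (simp add: l2_half_def restrict_half_def)
qed

lemma restrict_embed: "f \<in> l2_half \<Longrightarrow> restrict_half (embed_half f) = f"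
  by (auto simp: restrict_half_def embed_half_def l2_half_def)

lemma jac2_embed_half:
  assumes "f 0 = 0"
  shows "jac2 (ext_a a) (ext_b \<beta> b) (embed_half f) n = embed_half (jac_half a b f) n"
proof -
  have "nat (n - 1) = nat n - 1" "nat (n + 1) = Suc (nat n)" if "n \<ge> 1" using that by auto
  then show ?thesis
    using assms by (auto simp: jac2_def ext_a_def ext_b_def embed_half_def jac_half_def)
qed

lemma jac_half_restrict:
  "jac_half a b (restrict_half g) n = restrict_half (jac2 (ext_a a) (ext_b \<beta> b) g) n"
proof (cases n)
  case (Suc m)
  have *: "int m \<ge> 1 \<longleftrightarrow> m \<noteq> 0" by auto
  show ?thesis unfolding Suc
    by (auto simp: jac2_def ext_a_def ext_b_def restrict_half_def jac_half_def nat_add_distrib * add.commute)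
qed (simp add: jac_half_def restrict_half_def)

locale half_jacobi =
  fixes a b :: "nat \<Rightarrow> real" and M :: real
  assumes a_le: "\<bar>a n\<bar> \<le> M" and b_le: "\<bar>b n\<bar> \<le> M"
begin

lemma bounded_ext: "bounded_jacobi (ext_a a) (ext_b \<beta> b) (max M \<bar>\<beta>\<bar>)"
  using a_le b_le a_le[of 0] by unfold_locales (auto simp: ext_a_def ext_b_def max_def intro: order_trans)

text \<open>Since \<open>ext_a\<close> vanishes at 0, the two halves are mapped separately;
  embedding transports injectivity and restriction transports surjectivity.\<close>

lemma not_spectrum_half_if_bij:
  assumes "bij (jacobi_op (ext_a a) (ext_b \<beta> b) z)"
  shows "z \<notin> spectrum_half a b"
proof -
  interpret bounded_jacobi "ext_a a" "ext_b \<beta> b" "max M \<bar>\<beta>\<bar>" by (rule bounded_ext)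
  let ?A = "ext_a a" and ?B = "ext_b \<beta> b"
  let ?T = "\<lambda>u n. jac_half a b u n - z * u n"
  let ?S = "\<lambda>u n. jac2 ?A ?B u n - z * u n"
  have bij: "bij_betw ?S l2 l2" using assms bij_jop_iff by (simp add: spectrum2_def)
  have emb: "?S (embed_half f) = embed_half (?T f)" if "f \<in> l2_half" for f
    using that jac2_embed_half[of f a \<beta> b] by (auto simp: fun_eq_iff l2_half_def embed_half_def)
  have res: "?T (restrict_half g) = restrict_half (?S g)" for g
    using jac_half_restrict[of a b g _ \<beta>] by (auto simp: fun_eq_iff restrict_half_def)
  have l2e: "embed_half f \<in> l2" if "f \<in> l2_half" for f
    using that by (auto simp: l2_half_def intro: embed_half_l2)
  have "bij_betw ?T l2_half l2_half"
    unfolding bij_betw_def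
  proof (intro conjI inj_onI set_eqI iffI)
    fix f g assume fg: "f \<in> l2_half" "g \<in> l2_half" "?T f = ?T g"
    then have "?S (embed_half f) = ?S (embed_half g)" by (simp only: emb)
    then have "embed_half f = embed_half g"
      using bij l2e[OF fg(1)] l2e[OF fg(2)] unfolding bij_betw_def by (auto dest: inj_onD)
    then show "f = g" using restrict_embed fg(1,2) by metis
  next
    fix h assume "h \<in> ?T ` l2_half"
    then obtain f where f: "f \<in> l2_half" "h = ?T f" by blast
    have "?T f = ?T (restrict_half (embed_half f))" using restrict_embed[OF f(1)] by simp
    then have "h = restrict_half (?S (embed_half f))" using f(2) res by simp
    moreover have "?S (embed_half f) \<in> l2" using jac2_in_l2[OF l2e[OF f(1)]] .
    ultimately show "h \<in> l2_half" using restrict_half_l2 by simp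
  next
    fix h assume h: "h \<in> l2_half"
    then have "embed_half h \<in> ?S ` l2" using bij l2e by (auto simp: bij_betw_def)
    then obtain g where g: "g \<in> l2" "?S g = embed_half h" by auto
    have "?T (restrict_half g) = h" unfolding res g(2) using h by (rule restrict_embed)
    then show "h \<in> ?T ` l2_half" using restrict_half_l2[OF g(1)] by blast
  qed
  then show ?thesis by (simp add: spectrum_half_def)
qed

text \<open>On the left half the extension acts as multiplication by \<open>\<beta> - z\<close>,
  which is inverted by division.\<close>

lemma surj_jop_if_not_spectrum_half:
  assumes "z \<notin> spectrum_half a b" "z \<noteq> complex_of_real \<beta>"
  shows "surj (jacobi_op (ext_a a) (ext_b \<beta> b) z)"
proof -
  interpret bounded_jacobi "ext_a a" "ext_b \<beta> b" "max M \<bar>\<beta>\<bar>" by (rule bounded_ext)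
  have "\<exists>F. jacobi_op (ext_a a) (ext_b \<beta> b) z F = g" for g
  proof -
    have "restrict_half (coord g) \<in> (\<lambda>u n. jac_half a b u n - z * u n) ` l2_half"
      using assms(1) restrict_half_l2[OF coord_in_l2] by (auto simp: spectrum_half_def bij_betw_def)
    then obtain f where f: "f \<in> l2_half" "restrict_half (coord g) = (\<lambda>n. jac_half a b f n - z * f n)" by blast
    then have f0: "f 0 = 0" by (simp add: l2_half_def)
    define w where "w n = embed_half f n + (if n \<le> 0 then coord g n / (complex_of_real \<beta> - z) else 0)" for n
    have "(\<lambda>n. if n \<le> 0 then coord g n / (complex_of_real \<beta> - z) else 0) \<in> l2"
      by (rule l2_dominated[OF coord_in_l2[of g], where C = "1 / norm (complex_of_real \<beta> - z)"])
         (auto simp: norm_divide)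
    then have wl: "w \<in> l2" unfolding w_def using f(1) by (intro l2_add embed_half_l2) (auto simp: l2_half_def)
    have "jac2 (ext_a a) (ext_b \<beta> b) w n - z * w n = coord g n" for n
    proof (cases "n \<ge> 1")
      case True
      have "jac2 (ext_a a) (ext_b \<beta> b) w n = jac2 (ext_a a) (ext_b \<beta> b) (embed_half f) n"
        using True by (auto simp: jac2_def w_def ext_a_def)
      also have "\<dots> = jac_half a b f (nat n)" using True by (simp add: jac2_embed_half[of f, OF f0] embed_half_def)
      finally show ?thesis using True fun_cong[OF f(2), of "nat n"]
        by (simp add: w_def embed_half_def restrict_half_def)
    next
      case False
      then show ?thesis using assms(2)
        by (auto simp: jac2_def w_def ext_a_def ext_b_def embed_half_def divide_simps) (simp add: algebra_simps)
    qed
    then have "jacobi_op (ext_a a) (ext_b \<beta> b) z (Abs_ell2 w) = g"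
      by (intro ell2_eqI) (simp add: Abs_ell2_inverse[OF wl])
    then show ?thesis by blast
  qed
  then show ?thesis by (metis surj_def)
qed

lemma spectrum_half_bounded:
  assumes "complex_of_real x \<in> spectrum_half a b" shows "\<bar>x\<bar> \<le> 3 * M"
proof (rule ccontr)
  assume x: "\<not> \<bar>x\<bar> \<le> 3 * M"
  have M0: "0 \<le> M" using a_le[of 0] by simp
  interpret bounded_jacobi "ext_a a" "ext_b 0 b" M
    using bounded_ext[of 0] M0 by simp
  let ?J = "jacobi_op (ext_a a) (ext_b 0 b)"
  have "bij (?J (complex_of_real x))"
  proof (rule symmetric_bounded_below_bij[OF bounded_linear_jop])
    show "inner (?J (complex_of_real x) f) g = inner f (?J (complex_of_real x) g)" for f g
      using jop_adjoint[of "complex_of_real x"] by simp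
    show "\<bar>x\<bar> - 3 * M > 0" using x by simp
    fix f :: "int ell2"
    have "\<bar>x\<bar> * norm f = norm (cscale (complex_of_real x) f)" by (simp add: norm_cscale)
    also have "cscale (complex_of_real x) f = ?J 0 f - ?J (complex_of_real x) f"
      by (rule ell2_eqI) simp
    also have "norm \<dots> \<le> norm (?J 0 f) + norm (?J (complex_of_real x) f)" by (rule norm_triangle_ineq4)
    also have "norm (?J 0 f) \<le> 3 * M * norm f" using norm_jop_le[of 0 f] by (simp add: mult.commute)
    finally show "(\<bar>x\<bar> - 3 * M) * norm f \<le> norm (?J (complex_of_real x) f)" by (simp add: algebra_simps)
  qed
  then show False using not_spectrum_half_if_bij assms by blast
qed

text \<open>The supremum \<open>l\<close> of the numerical range is a spectral point. In the theorem
  this gives the real \<open>SUP\<close> its intended meaning, as over an empty set its value would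
  say nothing.\<close>

lemma spectrum_half_real_nonempty: "\<exists>x. complex_of_real x \<in> spectrum_half a b"
proof (rule ccontr)
  assume no: "\<nexists>x. complex_of_real x \<in> spectrum_half a b"
  \<comment> \<open>\<open>\<beta> < b 1 \<le> l\<close>, as \<open>b 1\<close> is the value of the
    form at \<open>delta_vec 1\<close>; so \<open>l\<close> avoids the artificial left half and
    surjectivity at \<open>l\<close> passes to the extension.\<close>
  define \<beta> where "\<beta> = b 1 - 1"
  define M' where "M' = max M \<bar>\<beta>\<bar>"
  interpret bounded_jacobi "ext_a a" "ext_b \<beta> b" M' unfolding M'_def by (rule bounded_ext)
  let ?J = "jacobi_op (ext_a a) (ext_b \<beta> b)"
  define S where "S = {inner (?J 0 f) f | f. norm f = 1}"
  have nd: "norm (delta_vec 1) = 1"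
    using inner_delta_vec[of "delta_vec 1" 1] by (simp add: norm_eq_sqrt_inner)
  have "inner (?J 0 (delta_vec 1)) (delta_vec 1) = b 1"
    by (simp add: inner_delta_vec jac2_def ext_b_def)
  then have b1: "b 1 \<in> S" using nd unfolding S_def by force
  have bdd: "bdd_above S"
  proof (rule bdd_aboveI)
    fix y assume "y \<in> S"
    then obtain f where f: "y = inner (?J 0 f) f" "norm f = 1" by (auto simp: S_def)
    have "y \<le> norm (?J 0 f) * norm f" unfolding f(1) by (rule norm_cauchy_schwarz)
    then show "y \<le> 3 * M'" using norm_jop_le[of 0 f] f(2) by simp
  qed
  define l where "l = Sup S"
  have lb: "b 1 \<le> l" unfolding l_def using b1 bdd by (rule cSup_upper)
  have Jl: "?J (complex_of_real l) f = ?J 0 f - l *\<^sub>R f" for f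
    by (rule ell2_eqI) (simp add: scaleR_conv_of_real)
  have up: "inner (?J 0 f) f \<le> l * (norm f)\<^sup>2" for f
  proof (cases "f = 0")
    case False
    define g where "g = f /\<^sub>R norm f"
    have ng: "norm g = 1" using False by (simp add: g_def)
    then have "inner (?J 0 g) g \<le> l" unfolding l_def by (intro cSup_upper bdd) (auto simp: S_def)
    moreover have "f = norm f *\<^sub>R g" using False by (simp add: g_def)
    then have "inner (?J 0 f) f = (norm f)\<^sup>2 * inner (?J 0 g) g"
      by (metis (no_types) bounded_linear_jop inner_scaleR_left inner_scaleR_right linear_simps(5) mult.assoc power2_eq_square)
    ultimately show ?thesis using mult_left_mono[of "inner (?J 0 g) g" l "(norm f)\<^sup>2"] by (simp add: mult.commute)
  qed simp
  have "\<not> surj (\<lambda>f. - ?J (complex_of_real l) f)"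
  proof (rule symmetric_nonneg_not_surj)
    show "bounded_linear (\<lambda>f. - ?J (complex_of_real l) f)"
      by (intro bounded_linear_minus bounded_linear_jop)
    show "inner (- ?J (complex_of_real l) f) g = inner f (- ?J (complex_of_real l) g)" for f g
      using jop_adjoint[of "complex_of_real l"] by simp
    show "0 \<le> inner (- ?J (complex_of_real l) f) f" for f
      unfolding Jl using up[of f] by (simp add: inner_diff_left power2_norm_eq_inner)
    fix d :: real assume "d > 0"
    then obtain y where "y \<in> S" "l - d < y"
      using less_cSup_iff[of S "l - d"] b1 bdd unfolding l_def by (metis diff_less_eq empty_iff less_add_same_cancel1)
    then obtain f where f: "norm f = 1" "l - d < inner (?J 0 f) f" by (auto simp: S_def)
    have "inner (- ?J (complex_of_real l) f) f = l * (norm f)\<^sup>2 - inner (?J 0 f) f"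
      unfolding Jl power2_norm_eq_inner by (simp add: inner_diff_left)
    then have "inner (- ?J (complex_of_real l) f) f < d * (norm f)\<^sup>2" using f by simp
    moreover have "f \<noteq> 0" using f(1) by auto
    ultimately show "\<exists>f. f \<noteq> 0 \<and> inner (- ?J (complex_of_real l) f) f < d * (norm f)\<^sup>2" by blast
  qed
  moreover have "surj (?J (complex_of_real l))"
  proof (rule surj_jop_if_not_spectrum_half)
    have "l \<noteq> \<beta>" using lb by (simp add: \<beta>_def)
    then show "complex_of_real l \<noteq> complex_of_real \<beta>" by (simp only: of_real_eq_iff not_False_eq_True)
  qed (use no in blast)
  then have "surj (\<lambda>f. - ?J (complex_of_real l) f)"
    by (metis (no_types, lifting) minus_minus surj_def)
  ultimately show False by simp
qed

end

section \<open>Translation compactness\<close>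

lemma jac2_translate:
  "jac2 a b u (m + k) = jac2 (\<lambda>n. a (m + n)) (\<lambda>n. b (m + n)) (\<lambda>n. u (m + n)) k"
  by (simp add: jac2_def algebra_simps)

lemma jac2_divide: "jac2 a b (\<lambda>k. u k / c) k = jac2 a b u k / c"
  by (simp add: jac2_def add_divide_distrib)

lemma jac2_limit:
  assumes "\<And>n. (\<lambda>j. A j n) \<longlonglongrightarrow> ar n" "\<And>n. (\<lambda>j. B j n) \<longlonglongrightarrow> br n" "\<And>n. (\<lambda>j. W j n) \<longlonglongrightarrow> w n"
    and "X \<longlonglongrightarrow> \<xi>"
    and res: "(\<lambda>j. jac2 (A j) (B j) (W j) k - complex_of_real (X j) * W j k) \<longlonglongrightarrow> 0"
  shows "jac2 ar br w k = complex_of_real \<xi> * w k"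
proof -
  have "(\<lambda>j. jac2 (A j) (B j) (W j) k - complex_of_real (X j) * W j k) \<longlonglongrightarrow>
      jac2 ar br w k - complex_of_real \<xi> * w k"
    unfolding jac2_def by (intro tendsto_intros assms)
  then show ?thesis using LIMSEQ_unique[OF res] by fastforce
qed

lemma translates_convergent_subsequence:
  fixes a b X :: "nat \<Rightarrow> real" and m :: "nat \<Rightarrow> nat" and W :: "nat \<Rightarrow> int \<Rightarrow> complex"
  assumes "\<And>n. \<bar>a n\<bar> \<le> C" "\<And>n. \<bar>b n\<bar> \<le> C" "\<And>j. \<bar>X j\<bar> \<le> C" "\<And>j k. norm (W j k) \<le> C"
  obtains r ar br \<xi> w where "strict_mono r" "\<And>k. (\<lambda>j. a (nat (int (m (r j)) + k))) \<longlonglongrightarrow> ar k"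
    "\<And>k. (\<lambda>j. b (nat (int (m (r j)) + k))) \<longlonglongrightarrow> br k" "(\<lambda>j. X (r j)) \<longlonglongrightarrow> \<xi>"
    "\<And>k. (\<lambda>j. W (r j) k) \<longlonglongrightarrow> w k"
proof -
  \<comment> \<open>All sequences are packed into one family indexed by site and tag (0 for
    \<open>a\<close>, 1 for \<open>b\<close>, 2 for \<open>X\<close>, any other for
    \<open>W\<close>), so that one diagonal extraction serves them all.\<close>
  define F where "F n i = (case i of (k, t) \<Rightarrow> if t = 0 then complex_of_real (a (nat (int (m n) + k)))
      else if t = 1 then complex_of_real (b (nat (int (m n) + k)))
      else if t = 2 then complex_of_real (X n) else W n k)" for n and i :: "int \<times> nat"
  have "norm (F n i) \<le> C" for n i
    unfolding F_def using assms(1)[of "nat (int (m n) + fst i)"] assms(2)[of "nat (int (m n) + fst i)"]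
      assms(3)[of n] assms(4)[of n "fst i"] by (simp add: case_prod_beta)
  then obtain r where r: "strict_mono r" "\<And>i. i \<in> UNIV \<Longrightarrow> \<exists>l. (\<lambda>n. F (r n) i) \<longlonglongrightarrow> l"
    using function_convergent_subsequence[of UNIV F C] by blast
  define L where "L i = lim (\<lambda>n. F (r n) i)" for i
  have L: "(\<lambda>n. F (r n) i) \<longlonglongrightarrow> L i" for i
    unfolding L_def using r(2)[of i] by (simp add: convergent_def flip: convergent_LIMSEQ_iff)
  show ?thesis
  proof (rule that[OF r(1)])
    fix k
    show "(\<lambda>j. a (nat (int (m (r j)) + k))) \<longlonglongrightarrow> Re (L (k, 0))"
      using tendsto_Re[OF L[of "(k, 0)"]] by (simp add: F_def)
    show "(\<lambda>j. b (nat (int (m (r j)) + k))) \<longlonglongrightarrow> Re (L (k, 1))"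
      using tendsto_Re[OF L[of "(k, 1)"]] by (simp add: F_def)
    show "(\<lambda>j. X (r j)) \<longlonglongrightarrow> Re (L (0, 2))"
      using tendsto_Re[OF L[of "(0, 2)"]] by (simp add: F_def)
    show "(\<lambda>j. W (r j) k) \<longlonglongrightarrow> L (k, 3)"
      using L[of "(k, 3)"] by (simp add: F_def)
  qed
qed

text \<open>\<open>P\<close> selects the sites where the equation survives, as a cut-off solution
  satisfies it on one side only. Every fixed offset is eventually a positive site, so the extended
  coefficients converge to those of the right limit.\<close>

lemma right_limit_solution:
  fixes a b X :: "nat \<Rightarrow> real" and m :: "nat \<Rightarrow> nat" and W :: "nat \<Rightarrow> int \<Rightarrow> complex"
  assumes bd: "\<And>n. \<bar>a n\<bar> \<le> C" "\<And>n. \<bar>b n\<bar> \<le> C" "\<And>j. \<bar>X j\<bar> \<le> C" "\<And>j k. norm (W j k) \<le> C"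
    and m: "filterlim m at_top sequentially"
    and res: "\<And>k. P k \<Longrightarrow> (\<lambda>j. jac2 (\<lambda>n. ext_a a (int (m j) + n)) (\<lambda>n. ext_b \<beta> b (int (m j) + n)) (W j) k
      - complex_of_real (X j) * W j k) \<longlonglongrightarrow> 0"
  obtains r ar br \<xi> w where "strict_mono r" "right_limit a b ar br" "(\<lambda>j. X (r j)) \<longlonglongrightarrow> \<xi>"
    "\<And>k. (\<lambda>j. W (r j) k) \<longlonglongrightarrow> w k" "\<And>k. P k \<Longrightarrow> jac2 ar br w k = complex_of_real \<xi> * w k"
proof -
  obtain r ar br \<xi> w where r: "strict_mono r" and ar: "\<And>k. (\<lambda>j. a (nat (int (m (r j)) + k))) \<longlonglongrightarrow> ar k"
    and br: "\<And>k. (\<lambda>j. b (nat (int (m (r j)) + k))) \<longlonglongrightarrow> br k" and \<xi>: "(\<lambda>j. X (r j)) \<longlonglongrightarrow> \<xi>"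
    and w: "\<And>k. (\<lambda>j. W (r j) k) \<longlonglongrightarrow> w k"
    using translates_convergent_subsequence[of a C b X W m] bd by metis
  have mr: "filterlim (\<lambda>j. m (r j)) at_top sequentially"
    using filterlim_compose[OF m filterlim_subseq[OF r]] .
  have "right_limit a b ar br"
    unfolding right_limit_def using mr ar br by (intro exI[of _ "\<lambda>j. m (r j)"]) simp
  moreover have "jac2 ar br w k = complex_of_real \<xi> * w k" if "P k" for k
  proof (rule jac2_limit)
    have ev: "\<forall>\<^sub>F j in sequentially. int (m (r j)) + n \<ge> 1" for n
      using mr[unfolded filterlim_at_top, rule_format, of "nat (1 - n)"] by (rule eventually_mono) auto
    show "(\<lambda>j. ext_a a (int (m (r j)) + n)) \<longlonglongrightarrow> ar n" for n
      by (rule Lim_transform_eventually[OF ar], rule eventually_mono[OF ev[of n]]) (simp add: ext_a_def)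
    show "(\<lambda>j. ext_b \<beta> b (int (m (r j)) + n)) \<longlonglongrightarrow> br n" for n
      by (rule Lim_transform_eventually[OF br], rule eventually_mono[OF ev[of n]]) (simp add: ext_b_def)
    show "(\<lambda>j. jac2 (\<lambda>n. ext_a a (int (m (r j)) + n)) (\<lambda>n. ext_b \<beta> b (int (m (r j)) + n)) (W (r j)) k
        - complex_of_real (X (r j)) * W (r j) k) \<longlonglongrightarrow> 0"
      using LIMSEQ_subseq_LIMSEQ[OF res[OF that] r] by (simp add: o_def)
  qed (use w \<xi> in auto)
  ultimately show ?thesis using that[OF r _ \<xi> w] by blast
qed

lemma isospectral_torus_gap_jacobi:
  assumes "finite_gap_set e" "(ar, br) \<in> isospectral_torus e"
  shows "\<exists>M. gap_jacobi ar br M e" "reflectionless e ar br"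
proof -
  obtain M1 where M1: "\<And>n. \<bar>ar n\<bar> \<le> M1" using assms(2) by (force simp: isospectral_torus_def bounded_iff)
  obtain M2 where M2: "\<And>n. \<bar>br n\<bar> \<le> M2" using assms(2) by (force simp: isospectral_torus_def bounded_iff)
  have "gap_jacobi ar br (max M1 M2) e"
    using assms M1 M2 finite_gap_set_closed
    by unfold_locales (auto simp: isospectral_torus_def intro: order_trans[OF _ max.cobounded1] order_trans[OF _ max.cobounded2])
  then show "\<exists>M. gap_jacobi ar br M e" ..
  show "reflectionless e ar br" using assms(2) by (simp add: isospectral_torus_def)
qed

lemma no_bounded_solution_off_spectrum:
  assumes "finite_gap_set e" "nevai_class e a b" "right_limit a b ar br" "\<xi> \<notin> e"
    and "\<And>k. norm (w k) \<le> C" "\<And>k. jac2 ar br w k = complex_of_real \<xi> * w k"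
  shows "w n = 0"
proof -
  have "(ar, br) \<in> isospectral_torus e" using assms(2,3) by (simp add: nevai_class_def)
  then obtain M where "gap_jacobi ar br M e" using isospectral_torus_gap_jacobi[OF assms(1)] by blast
  then interpret gap_jacobi ar br M e .
  have "complex_of_real \<xi> \<notin> spectrum2 ar br" using assms(4) by (auto simp: spec)
  then show ?thesis using resolvent_bounded_solution_zero[of "complex_of_real \<xi>" w C] assms(5,6) by blast
qed

text \<open>\<open>phat n = p\<^bsub>n-1\<^esub>(x)\<close>, so that the index is the site of the half line.\<close>

definition phat :: "(nat \<Rightarrow> real) \<Rightarrow> (nat \<Rightarrow> real) \<Rightarrow> real \<Rightarrow> int \<Rightarrow> real" where
  "phat a b x n = (if n \<ge> 1 then opoly a b (nat n - 1) x else 0)"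

lemma opoly_0 [simp]: "opoly a b 0 x = 1"
  by (simp add: opoly_def)

lemma fst_opp: "fst (opp a b n x) = phat a b x (int n)"
  by (cases n) (auto simp: phat_def opoly_def nat_add_distrib)

lemma opoly_Suc:
  "opoly a b (Suc n) x = ((x - b (Suc n)) * opoly a b n x - a n * phat a b x (int n)) / a (Suc n)"
  by (simp add: opoly_def fst_opp)

lemma phat_Suc: "phat a b x (int n + 1) = opoly a b n x"
  by (simp add: phat_def nat_add_distrib)

text \<open>Continued by zero, the polynomials solve the equation at every integer site because the
  left half is decoupled; translations then carry no boundary term.\<close>

lemma jac2_phat:
  assumes "\<forall>n\<ge>1. a n > 0"
  shows "jac2 (ext_a a) (ext_b \<beta> b) (\<lambda>n. complex_of_real (phat a b x n)) k = complex_of_real x * complex_of_real (phat a b x k)"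
proof (cases "k \<ge> 1")
  case True
  define n where "n = nat k - 1"
  have k: "k = int n + 1" using True by (simp add: n_def)
  have "a (Suc n) > 0" using assms by simp
  then have rec: "a (Suc n) * opoly a b (Suc n) x = (x - b (Suc n)) * opoly a b n x - a n * phat a b x (int n)"
    by (simp add: opoly_Suc)
  have e: "ext_a a (int n) * phat a b x (int n) = a n * phat a b x (int n)"
    by (auto simp: ext_a_def phat_def)
  have "ext_a a (int n) * phat a b x (int n) + ext_b \<beta> b (int n + 1) * phat a b x (int n + 1)
      + ext_a a (int n + 1) * phat a b x (int n + 1 + 1) = x * phat a b x (int n + 1)"
  proof -
    have "ext_b \<beta> b (int n + 1) = b (Suc n)" "ext_a a (int n + 1) = a (Suc n)"
      "phat a b x (int n + 1 + 1) = opoly a b (Suc n) x" "phat a b x (int n + 1) = opoly a b n x"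
      using phat_Suc[of a b x "Suc n"] phat_Suc[of a b x n]
      by (simp_all add: ext_a_def ext_b_def nat_add_distrib add.commute)
    then show ?thesis unfolding e by (simp only: rec) (simp add: algebra_simps)
  qed
  then have "complex_of_real (ext_a a (int n) * phat a b x (int n) + ext_b \<beta> b (int n + 1) * phat a b x (int n + 1)
      + ext_a a (int n + 1) * phat a b x (int n + 1 + 1)) = complex_of_real (x * phat a b x (int n + 1))" by (rule arg_cong)
  then show ?thesis by (simp add: jac2_def k)
next
  case False
  then show ?thesis by (auto simp: jac2_def ext_a_def phat_def)
qed

lemma solution_eq_phat:
  fixes u :: "int \<Rightarrow> complex"
  assumes "\<forall>n\<ge>1. a n > 0" and "\<And>k. jac2 (ext_a a) (ext_b \<beta> b) u k = complex_of_real x * u k"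
    and "u 0 = 0"
  shows "u (int n) = u 1 * complex_of_real (phat a b x (int n)) \<and>
    u (int n + 1) = u 1 * complex_of_real (phat a b x (int n + 1))"
proof (induction n)
  case 0
  then show ?case using assms(3) by (simp add: phat_def)
next
  case (Suc n)
  let ?A = "complex_of_real (a (Suc n))"
  have "a (Suc n) > 0" using assms(1) by simp
  then have "?A \<noteq> 0" by simp
  have ea: "ext_a a (int n + 1) = a (Suc n)" by (simp add: ext_a_def nat_add_distrib)
  have eq1: "complex_of_real (ext_a a (int n)) * u (int n) + complex_of_real (ext_b \<beta> b (int n + 1)) * u (int n + 1) + ?A * u (int n + 1 + 1)
      = complex_of_real x * u (int n + 1)"
    using assms(2)[of "int n + 1"] by (simp add: jac2_def ea)
  have eq2: "complex_of_real (ext_a a (int n)) * complex_of_real (phat a b x (int n)) +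
      complex_of_real (ext_b \<beta> b (int n + 1)) * complex_of_real (phat a b x (int n + 1)) + ?A * complex_of_real (phat a b x (int n + 1 + 1))
      = complex_of_real x * complex_of_real (phat a b x (int n + 1))"
    using jac2_phat[OF assms(1), of \<beta> b x "int n + 1"] by (simp add: jac2_def ea)
  have alg: "A * U = A * (y * q2)"
    if "c * v0 + d * v1 + A * U = t * v1" "c * q0 + d * q1 + A * q2 = t * q1" "v0 = y * q0" "v1 = y * q1"
    for c d t y v0 v1 q0 q1 q2 A U :: complex
    using that by algebra
  have "?A * u (int n + 1 + 1) = ?A * (u 1 * complex_of_real (phat a b x (int n + 1 + 1)))"
    by (rule alg[OF eq1 eq2 conjunct1[OF Suc.IH] conjunct2[OF Suc.IH]])
  then have "u (int n + 1 + 1) = u 1 * complex_of_real (phat a b x (int n + 1 + 1))"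
    using \<open>?A \<noteq> 0\<close> by simp
  then show ?case using Suc.IH by (simp add: algebra_simps)
qed

section \<open>Boundedness of the polynomials at spectral points off the bands\<close>

lemma l2_norm_max:
  fixes u :: "int \<Rightarrow> complex"
  assumes "u \<in> l2" obtains m where "\<And>k. norm (u k) \<le> norm (u m)"
proof (cases "\<forall>k. u k = 0")
  case True then show ?thesis using that[of 0] by simp
next
  case False
  then obtain k0 where k0: "u k0 \<noteq> 0" by blast
  define S where "S = {k. norm (u k) \<ge> norm (u k0)}"
  have "finite S"
  proof (rule ccontr)
    assume "infinite S"
    define B where "B = (\<Sum>\<^sub>\<infinity>i. (norm (u i))\<^sup>2)"
    obtain N :: nat where N: "B / (norm (u k0))\<^sup>2 < real N" using reals_Archimedean2 by blast
    obtain F where F: "F \<subseteq> S" "card F = N" "finite F"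
      using \<open>infinite S\<close> by (meson infinite_arbitrarily_large)
    have "real N * (norm (u k0))\<^sup>2 = (\<Sum>i\<in>F. (norm (u k0))\<^sup>2)" using F by simp
    also have "\<dots> \<le> (\<Sum>i\<in>F. (norm (u i))\<^sup>2)"
      using F by (intro sum_mono power_mono) (auto simp: S_def)
    also have "\<dots> \<le> B" unfolding B_def using assms F(3) by (intro finite_sum_le_infsum) (auto simp: l2_def)
    finally show False using N k0 by (simp add: field_simps)
  qed
  moreover have "k0 \<in> S" by (simp add: S_def)
  ultimately obtain m where m: "m \<in> S" "\<And>k. k \<in> S \<Longrightarrow> norm (u k) \<le> norm (u m)"
    using obtains_MAX[of S "\<lambda>k. norm (u k)"] by (metis Max_ge empty_iff finite_imageI image_eqI)
  show ?thesis
  proof (rule that[of m])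
    fix k show "norm (u k) \<le> norm (u m)"
      using m \<open>k0 \<in> S\<close> by (cases "k \<in> S") (force simp: S_def)+
  qed
qed

lemma sum_geometric_int_le:
  fixes q :: real
  assumes "0 < q" "q < 1" "finite F"
  shows "(\<Sum>k\<in>F. q ^ nat \<bar>n - k\<bar>) \<le> 2 / (1 - q)"
proof -
  have half: "(\<Sum>k\<in>F'. q ^ nat \<bar>n - k\<bar>) \<le> 1 / (1 - q)" if "finite F'" "inj_on (\<lambda>k. nat \<bar>n - k\<bar>) F'" for F'
  proof -
    have "(\<Sum>k\<in>F'. q ^ nat \<bar>n - k\<bar>) = (\<Sum>i\<in>(\<lambda>k. nat \<bar>n - k\<bar>) ` F'. q ^ i)"
      by (simp add: sum.reindex[OF that(2)])
    also have "\<dots> \<le> (\<Sum>i. q ^ i)"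
      using assms that(1) by (intro sum_le_suminf summable_geometric) auto
    also have "\<dots> = 1 / (1 - q)" using assms by (intro suminf_geometric) auto
    finally show ?thesis .
  qed
  have "F = (F \<inter> {..n}) \<union> (F \<inter> {n<..})" by auto
  then have "(\<Sum>k\<in>F. q ^ nat \<bar>n - k\<bar>) = (\<Sum>k\<in>F \<inter> {..n}. q ^ nat \<bar>n - k\<bar>) + (\<Sum>k\<in>F \<inter> {n<..}. q ^ nat \<bar>n - k\<bar>)"
    using assms(3) by (metis (no_types, lifting) Int_assoc disjoint_iff finite_Int greaterThan_iff IntD2 atMost_iff not_less sum.union_disjoint)
  also have "\<dots> \<le> 1 / (1 - q) + 1 / (1 - q)"
    using assms(3) by (intro add_mono half) (auto simp: inj_on_def)
  finally show ?thesis by simp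
qed

text \<open>The relative change between neighbours is \<open>1 - q\<close> or
  \<open>1 / q - 1\<close>, and the second is the larger. It measures the commutator of the weight
  with a Jacobi operator.\<close>

lemma weight_ratio:
  fixes q :: real and c n n' :: int
  assumes "0 < q" "q < 1" "\<bar>n - n'\<bar> = 1"
  shows "\<bar>q ^ nat \<bar>n' - c\<bar> - q ^ nat \<bar>n - c\<bar>\<bar> \<le> (1 / q - 1) * q ^ nat \<bar>n' - c\<bar>"
proof -
  let ?w = "q ^ nat \<bar>n' - c\<bar>"
  have w: "?w > 0" using assms by simp
  have "nat \<bar>n - c\<bar> = Suc (nat \<bar>n' - c\<bar>) \<or> nat \<bar>n' - c\<bar> = Suc (nat \<bar>n - c\<bar>)" using assms(3) by linarith
  then show ?thesis
  proof
    assume "nat \<bar>n - c\<bar> = Suc (nat \<bar>n' - c\<bar>)"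
    then have "\<bar>?w - q ^ nat \<bar>n - c\<bar>\<bar> = (1 - q) * ?w" using assms w by (simp add: algebra_simps abs_if mult_less_cancel_right)
    moreover have "1 - q \<le> 1 / q - 1"
      using assms zero_le_power2[of "1 - q"] by (simp add: field_simps power2_eq_square)
    ultimately show ?thesis using w by (simp add: mult_right_mono)
  next
    assume s: "nat \<bar>n' - c\<bar> = Suc (nat \<bar>n - c\<bar>)"
    then have e: "q ^ nat \<bar>n - c\<bar> = ?w / q" using assms by simp
    have "\<bar>?w - ?w / q\<bar> = (1 / q - 1) * ?w"
      using assms w by (simp add: abs_if field_simps)
    then show ?thesis unfolding e by simp
  qed
qed

context half_jacobi
begin

text \<open>Otherwise there are sequences with maximum 1 and residuals tending to 0. If their maxima
  sit at one site infinitely often, a limit is a bounded half-line solution, hence a multiple of the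
  polynomials, against \<open>unb\<close>. If the maxima run to infinity, a limit of translates is a
  bounded solution for a right limit at an energy off its spectrum.\<close>

lemma sup_norm_bounded_below:
  assumes apos: "\<forall>n\<ge>1. a n > 0" and gap: "finite_gap_set e" and nev: "nevai_class e a b" and "x \<notin> e"
    and unb: "\<nexists>C. \<forall>n. \<bar>opoly a b n x\<bar> \<le> C"
  defines "T \<equiv> \<lambda>f k. jac2 (ext_a a) (ext_b (x + 1) b) f k - complex_of_real x * f k"
  shows "\<exists>c>0. \<forall>f m \<delta>. (\<forall>k. norm (f k) \<le> norm (f m)) \<longrightarrow> (\<forall>k. norm (T f k) \<le> \<delta>) \<longrightarrow> c * norm (f m) \<le> \<delta>"
proof (rule ccontr)
  let ?A = "ext_a a" and ?B = "ext_b (x + 1) b"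
  assume neg: "\<not> ?thesis"
  have "\<exists>f m \<delta>. (\<forall>k. norm (f k) \<le> norm (f m)) \<and> (\<forall>k. norm (T f k) \<le> \<delta>) \<and> \<delta> < inverse (real (j + 2)) * norm (f m)" for j :: nat
  proof -
    have "inverse (real (j + 2)) > 0" by simp
    then show ?thesis using neg by (meson not_le)
  qed
  then obtain f m \<delta> where fm: "\<And>j k. norm (f j k) \<le> norm (f j (m j))" and Tf: "\<And>j k. norm (T (f j) k) \<le> \<delta> j"
    and \<delta>: "\<And>j. \<delta> j < inverse (real (j + 2)) * norm (f j (m j))" by metis
  have pos: "norm (f j (m j)) > 0" for j
    using \<delta>[of j] order_trans[OF norm_ge_zero Tf[of j 0]] by (cases "f j (m j) = 0") auto
  define W where "W j k = f j k / f j (m j)" for j k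
  have W1: "norm (W j k) \<le> 1" for j k using fm[of j k] pos[of j] by (simp add: W_def norm_divide)
  have Wm: "W j (m j) = 1" for j using pos[of j] by (simp add: W_def)
  have TW: "norm (T (W j) k) \<le> inverse (real (j + 2))" for j k
  proof -
    have "T (W j) k = T (f j) k / f j (m j)"
      unfolding T_def W_def jac2_divide by (simp add: diff_divide_distrib)
    then have "norm (T (W j) k) = norm (T (f j) k) / norm (f j (m j))" by (simp add: norm_divide)
    also have "\<dots> \<le> (inverse (real (j + 2)) * norm (f j (m j))) / norm (f j (m j))"
      using Tf[of j k] \<delta>[of j] pos[of j] by (intro divide_right_mono) auto
    also have "\<dots> = inverse (real (j + 2))" using pos[of j] by simp
    finally show ?thesis .
  qed
  have inv0: "(\<lambda>j. inverse (real (j + 2))) \<longlonglongrightarrow> 0"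
    using LIMSEQ_ignore_initial_segment[OF LIMSEQ_inverse_real_of_nat, of 1] by (simp add: numeral_2_eq_2)
  have TW0: "(\<lambda>j. T (W j) (h j)) \<longlonglongrightarrow> 0" for h
    by (rule Lim_null_comparison[OF always_eventually[OF allI[OF TW]] inv0])
  \<comment> \<open>By the choice \<open>x + 1\<close>, \<open>T\<close> is the identity on the left
    half, so a maximum there would have residual 1; the tolerance is at most 1/2 because of the
    \<open>j + 2\<close>.\<close>
  have m1: "m j \<ge> 1" for j
  proof (rule ccontr)
    assume "\<not> m j \<ge> 1"
    then have "T (W j) (m j) = 1" using Wm[of j] by (simp add: T_def jac2_def ext_a_def ext_b_def algebra_simps)
    then have "1 \<le> inverse (real (j + 2))" using TW[of j "m j"] by simp
    then show False by (simp add: field_simps)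
  qed
  show False
  proof (cases "\<exists>m0. infinite {j. m j = m0}")
    case True
    then obtain m0 where inf: "infinite {j. m j = m0}" by blast
    define r0 where "r0 = enumerate {j. m j = m0}"
    have r0: "strict_mono r0" "\<And>j. m (r0 j) = m0"
      using strict_mono_enumerate[OF inf] enumerate_in_set[OF inf] by (auto simp: r0_def)
    have bds: "\<bar>a n\<bar> \<le> max M 1" "\<bar>b n\<bar> \<le> max M 1" "\<bar>0::real\<bar> \<le> max M 1" "norm (W (r0 j) k) \<le> max M 1" for n j k
      using W1[of "r0 j" k] a_le[of n] b_le[of n] by (simp_all add: le_max_iff_disj)
    \<comment> \<open>The maximum does not move here, so translation and energy are dummies and only
      the limit of \<open>W\<close> is kept.\<close>
    obtain r :: "nat \<Rightarrow> nat" and w where r: "strict_mono r" and w: "\<And>k. (\<lambda>j. W (r0 (r j)) k) \<longlonglongrightarrow> w k"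
    proof -
      show thesis
        by (rule translates_convergent_subsequence[of a "max M 1" b "\<lambda>_. 0" "\<lambda>j. W (r0 j)" "\<lambda>_. 0",
              OF bds]) (rule that)
    qed
    have sol: "jac2 ?A ?B w k = complex_of_real x * w k" for k
    proof (rule jac2_limit[of "\<lambda>_. ?A" _ "\<lambda>_. ?B" _ "\<lambda>j. W (r0 (r j))" _ "\<lambda>_. x"])
      have "strict_mono (r0 \<circ> r)" using r0(1) r by (rule strict_mono_o)
      then show "(\<lambda>j. jac2 ?A ?B (W (r0 (r j))) k - complex_of_real x * W (r0 (r j)) k) \<longlonglongrightarrow> 0"
        using LIMSEQ_subseq_LIMSEQ[OF TW0[of "\<lambda>_. k"]] by (simp add: T_def o_def)
    qed (auto intro: w)
    have "w m0 = 1"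
      using w[of m0] Wm[of "r0 (r _)"] unfolding r0(2) by (simp add: LIMSEQ_const_iff)
    have w1: "norm (w k) \<le> 1" for k
      by (rule tendsto_upperbound[OF tendsto_norm[OF w[of k]]]) (simp_all add: W1)
    have "w 0 = 0" using sol[of 0] by (simp add: jac2_def ext_a_def ext_b_def algebra_simps)
    note eq = solution_eq_phat[OF apos sol this]
    have "w 1 \<noteq> 0"
    proof
      assume "w 1 = 0"
      then have "w (int (nat m0)) = 0" using eq[of "nat m0"] by simp
      moreover have "m0 \<ge> 1" using m1[of "r0 0"] r0(2) by simp
      ultimately show False using \<open>w m0 = 1\<close> by simp
    qed
    have "\<bar>opoly a b n x\<bar> \<le> 1 / norm (w 1)" for n
    proof -
      have "w (int n + 1) = w 1 * complex_of_real (opoly a b n x)" using eq[of n] by (simp add: phat_Suc)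
      then have "norm (w 1) * \<bar>opoly a b n x\<bar> \<le> 1" using w1[of "int n + 1"] by (simp add: norm_mult)
      then show ?thesis using \<open>w 1 \<noteq> 0\<close> by (simp add: field_simps)
    qed
    then show False using unb by blast
  next
    case False
    define m' where "m' j = nat (m j)" for j
    have mi: "int (m' j) = m j" for j using m1[of j] by (simp add: m'_def)
    have "filterlim m' at_top sequentially"
      unfolding filterlim_at_top
    proof
      fix N :: nat
      have "{j. \<not> N \<le> m' j} \<subseteq> (\<Union>i\<in>{1..int N}. {j. m j = i})"
        using m1 by (auto simp: m'_def not_le)
      moreover have "finite (\<Union>i\<in>{1..int N}. {j. m j = i})" using False by auto
      ultimately have "finite {j. \<not> N \<le> m' j}" by (rule finite_subset)
      then show "\<forall>\<^sub>F j in sequentially. N \<le> m' j"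
        by (simp add: cofinite_eq_sequentially[symmetric] eventually_cofinite)
    qed
    have bds: "\<bar>a n\<bar> \<le> max (max M 1) \<bar>x\<bar>" "\<bar>b n\<bar> \<le> max (max M 1) \<bar>x\<bar>" "\<bar>x\<bar> \<le> max (max M 1) \<bar>x\<bar>"
      "norm (W j (m j + k)) \<le> max (max M 1) \<bar>x\<bar>" for n j k
      using W1[of j "m j + k"] a_le[of n] b_le[of n] by (simp_all add: le_max_iff_disj)
    have res: "(\<lambda>j. jac2 (\<lambda>n. ?A (int (m' j) + n)) (\<lambda>n. ?B (int (m' j) + n)) (\<lambda>k. W j (m j + k)) k
        - complex_of_real x * W j (m j + k)) \<longlonglongrightarrow> 0" for k
      using TW0[of "\<lambda>j. m j + k"] unfolding T_def mi jac2_translate .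
    obtain r :: "nat \<Rightarrow> nat" and ar br \<xi> w where r: "strict_mono r" "right_limit a b ar br" "(\<lambda>j::nat. x) \<longlonglongrightarrow> \<xi>"
      "\<And>k. (\<lambda>j. W (r j) (m (r j) + k)) \<longlonglongrightarrow> w k" "\<And>k. jac2 ar br w k = complex_of_real \<xi> * w k"
    proof -
      show thesis
        by (rule right_limit_solution[of a "max (max M 1) \<bar>x\<bar>" b "\<lambda>_. x" "\<lambda>j k. W j (m j + k)" m'
              "\<lambda>_. True" "x + 1", OF bds \<open>filterlim m' at_top sequentially\<close> res]) (rule that, simp_all)
    qed
    have "\<xi> = x" using r(3) by (simp add: LIMSEQ_const_iff)
    have "w 0 = 1" using r(4)[of 0] by (simp add: Wm LIMSEQ_const_iff)
    have "norm (w k) \<le> 1" for k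
      by (rule tendsto_upperbound[OF tendsto_norm[OF r(4)[of k]]]) (simp_all add: W1)
    then have "w 0 = 0"
      using no_bounded_solution_off_spectrum[OF gap nev r(2) \<open>x \<notin> e\<close>, of w 1] r(5) \<open>\<xi> = x\<close> by blast
    then show False using \<open>w 0 = 1\<close> by simp
  qed
qed

text \<open>If the polynomials were unbounded, the sup-norm bound would apply to the weighted
  sequences \<open>q ^ |n - c0| * f n\<close>; for \<open>q\<close> near 1 the commutator costs at
  most half of it. Summing over the centres \<open>c0\<close> gives a lower bound in
  \<open>l2\<close>, and symmetry makes the extension bijective, against
  \<open>spec\<close>.\<close>

lemma opoly_bounded_off_bands:
  assumes apos: "\<forall>n\<ge>1. a n > 0" and gap: "finite_gap_set e" and nev: "nevai_class e a b" and "x \<notin> e"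
    and spec: "complex_of_real x \<in> spectrum_half a b"
  shows "\<exists>C. \<forall>n. \<bar>opoly a b n x\<bar> \<le> C"
proof (rule ccontr)
  assume unb: "\<not> ?thesis"
  define M' where "M' = max M \<bar>x + 1\<bar>"
  let ?A = "ext_a a" and ?B = "ext_b (x + 1) b"
  interpret bounded_jacobi ?A ?B M' unfolding M'_def by (rule bounded_ext)
  let ?T = "\<lambda>f k. jac2 ?A ?B f k - complex_of_real x * f k"
  let ?J = "jacobi_op ?A ?B (complex_of_real x)"
  obtain c where "c > 0" and c: "\<And>f m \<delta>. (\<And>k. norm (f k) \<le> norm (f m)) \<Longrightarrow> (\<And>k. norm (?T f k) \<le> \<delta>) \<Longrightarrow> c * norm (f m) \<le> \<delta>"
    using sup_norm_bounded_below[OF apos gap nev \<open>x \<notin> e\<close> unb] by metis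
  \<comment> \<open>Chosen so that \<open>1 / q - 1 = c / (4 * (M' + 1))\<close>; the two neighbour
    terms together then cost at most \<open>c / 2\<close>.\<close>
  define q where "q = 1 / (1 + c / (4 * (M' + 1)))"
  have M'0: "M' \<ge> 0" by (rule M_nonneg)
  have q: "0 < q" "q < 1" using \<open>c > 0\<close> M'0 by (auto simp: q_def add_pos_pos)
  have q1: "2 * M' * (1 / q - 1) \<le> c / 2"
  proof -
    have "2 * M' * (1 / q - 1) = (c / 2) * (M' / (M' + 1))" using M'0 by (simp add: q_def field_simps)
    also have "\<dots> \<le> (c / 2) * 1" using \<open>c > 0\<close> M'0 by (intro mult_left_mono) auto
    finally show ?thesis by simp
  qed
  have point: "\<exists>n. (norm (coord f c0))\<^sup>2 \<le> (2 / c)\<^sup>2 * ((q\<^sup>2) ^ nat \<bar>n - c0\<bar> * (norm (coord (?J f) n))\<^sup>2)" for f c0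
  proof -
    define wt where "wt n = q ^ nat \<bar>n - c0\<bar>" for n
    have wt: "0 < wt n" "wt n \<le> 1" for n using q by (auto simp: wt_def power_le_one)
    define g where "g n = complex_of_real (wt n) * coord f n" for n
    define h where "h n = complex_of_real (wt n) * coord (?J f) n" for n
    have nwt: "norm (complex_of_real (wt n)) \<le> 1" for n using wt[of n] by simp
    have "g \<in> l2" "h \<in> l2" unfolding g_def h_def
      by (rule l2_bounded_mult[OF coord_in_l2 nwt])+
    obtain m where m: "\<And>k. norm (g k) \<le> norm (g m)" using l2_norm_max[OF \<open>g \<in> l2\<close>] by blast
    obtain n where n: "\<And>k. norm (h k) \<le> norm (h n)" using l2_norm_max[OF \<open>h \<in> l2\<close>] by blast
    have "norm (?T g k) \<le> norm (h n) + c / 2 * norm (g m)" for k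
    proof -
      have nb: "norm (complex_of_real (?A l) * (complex_of_real (wt k' - wt k) * coord f k')) \<le> M' * ((1 / q - 1) * norm (g m))"
        if "\<bar>k - k'\<bar> = 1" for k' l
      proof -
        have "\<bar>wt k' - wt k\<bar> * norm (coord f k') \<le> (1 / q - 1) * wt k' * norm (coord f k')"
          unfolding wt_def using weight_ratio[OF q that] by (intro mult_right_mono) auto
        also have "\<dots> = (1 / q - 1) * norm (g k')" using wt[of k'] by (simp add: g_def norm_mult)
        also have "\<dots> \<le> (1 / q - 1) * norm (g m)" using q by (intro mult_left_mono m) (auto simp: field_simps)
        finally have le: "\<bar>wt k' - wt k\<bar> * norm (coord f k') \<le> (1 / q - 1) * norm (g m)" .
        show ?thesis
          unfolding norm_mult norm_of_real by (rule mult_mono[OF a_bound le M'0]) simp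
      qed
      \<comment> \<open>Commuting the weight past the operator leaves only the off-diagonal terms
        with weight differences.\<close>
      have "?T g k = h k + complex_of_real (?A (k - 1)) * (complex_of_real (wt (k - 1) - wt k) * coord f (k - 1))
          + complex_of_real (?A k) * (complex_of_real (wt (k + 1) - wt k) * coord f (k + 1))"
        unfolding g_def h_def coord_jop jac2_def by (simp add: algebra_simps)
      also have "norm \<dots> \<le> norm (h n) + M' * ((1 / q - 1) * norm (g m)) + M' * ((1 / q - 1) * norm (g m))"
        by (rule order_trans[OF norm_triangle_ineq add_mono[OF order_trans[OF norm_triangle_ineq add_mono[OF n nb]] nb]]) simp_all
      also have "\<dots> = norm (h n) + (2 * M' * (1 / q - 1)) * norm (g m)" by (simp add: algebra_simps)
      also have "\<dots> \<le> norm (h n) + c / 2 * norm (g m)" using q1 by (intro add_left_mono mult_right_mono) auto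
      finally show ?thesis .
    qed
    from c[of g m, OF m this] have "c * norm (g m) \<le> norm (h n) + c / 2 * norm (g m)" .
    then have "c / 2 * norm (g m) \<le> norm (h n)" by simp
    moreover have "norm (coord f c0) \<le> norm (g m)" using m[of c0] by (simp add: g_def wt_def)
    then have "c / 2 * norm (coord f c0) \<le> c / 2 * norm (g m)" using \<open>c > 0\<close> by (intro mult_left_mono) auto
    ultimately have "c / 2 * norm (coord f c0) \<le> norm (h n)" by linarith
    then have "norm (coord f c0) \<le> 2 / c * norm (h n)" using \<open>c > 0\<close> by (simp add: field_simps)
    then have "(norm (coord f c0))\<^sup>2 \<le> (2 / c * norm (h n))\<^sup>2" by (rule power_mono) simp
    also have "\<dots> = (2 / c)\<^sup>2 * ((q\<^sup>2) ^ nat \<bar>n - c0\<bar> * (norm (coord (?J f) n))\<^sup>2)"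
    proof -
      have "(wt n)\<^sup>2 = (q\<^sup>2) ^ nat \<bar>n - c0\<bar>" by (simp add: wt_def power_mult[symmetric] mult.commute)
      moreover have "norm (h n) = wt n * norm (coord (?J f) n)" using wt(1)[of n] unfolding h_def norm_mult norm_of_real by (simp only: abs_of_pos)
      ultimately show ?thesis by (simp only: power_mult_distrib)
    qed
    finally show ?thesis by blast
  qed
  define K where "K = (2 / c)\<^sup>2 * (2 / (1 - q\<^sup>2))"
  have q2: "0 < q\<^sup>2" "q\<^sup>2 < 1" using q by (auto simp: power_less_one_iff)
  have "K > 0" using \<open>c > 0\<close> q2 by (simp add: K_def)
  \<comment> \<open>Each centre \<open>c0\<close> is controlled by a single site
    \<open>n c0\<close>. Enlarging this to the sum over all such sites gives a geometric kernel,
    whose sums over \<open>k\<close> are bounded by \<open>2 / (1 - q\<^sup>2)\<close>.\<close>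
  have fin: "(\<Sum>k\<in>F. (norm (coord f k))\<^sup>2) \<le> K * (norm (?J f))\<^sup>2" if "finite F" for f F
  proof -
    obtain n where n: "\<And>c0. (norm (coord f c0))\<^sup>2 \<le> (2 / c)\<^sup>2 * ((q\<^sup>2) ^ nat \<bar>n c0 - c0\<bar> * (norm (coord (?J f) (n c0)))\<^sup>2)"
      using point[of f] by metis
    let ?s = "\<lambda>l k. (q\<^sup>2) ^ nat \<bar>l - k\<bar> * (norm (coord (?J f) l))\<^sup>2"
    have "(\<Sum>k\<in>F. (norm (coord f k))\<^sup>2) \<le> (\<Sum>k\<in>F. (2 / c)\<^sup>2 * (\<Sum>l\<in>n ` F. ?s l k))"
    proof (rule sum_mono)
      fix k assume "k \<in> F"
      have "?s (n k) k \<le> (\<Sum>l\<in>n ` F. ?s l k)"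
        by (rule member_le_sum) (use \<open>k \<in> F\<close> that q2 in auto)
      then have "(2 / c)\<^sup>2 * ?s (n k) k \<le> (2 / c)\<^sup>2 * (\<Sum>l\<in>n ` F. ?s l k)"
        by (rule mult_left_mono) simp
      then show "(norm (coord f k))\<^sup>2 \<le> (2 / c)\<^sup>2 * (\<Sum>l\<in>n ` F. ?s l k)" using n[of k] by linarith
    qed
    also have "\<dots> = (2 / c)\<^sup>2 * (\<Sum>l\<in>n ` F. (\<Sum>k\<in>F. (q\<^sup>2) ^ nat \<bar>l - k\<bar>) * (norm (coord (?J f) l))\<^sup>2)"
      unfolding sum_distrib_left[symmetric] sum_distrib_right by (subst sum.swap) simp
    also have "\<dots> \<le> (2 / c)\<^sup>2 * (\<Sum>l\<in>n ` F. (2 / (1 - q\<^sup>2)) * (norm (coord (?J f) l))\<^sup>2)"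
      by (intro mult_left_mono sum_mono mult_right_mono sum_geometric_int_le q2 that) auto
    also have "\<dots> = K * (\<Sum>l\<in>n ` F. (norm (coord (?J f) l))\<^sup>2)"
      by (simp only: K_def sum_distrib_left mult.assoc)
    also have "\<dots> \<le> K * (norm (?J f))\<^sup>2"
      using \<open>K > 0\<close> that by (intro mult_left_mono sum_coord_le_norm) auto
    finally show ?thesis .
  qed
  have low: "inverse (sqrt K) * norm f \<le> norm (?J f)" for f
  proof -
    have "(norm f)\<^sup>2 \<le> K * (norm (?J f))\<^sup>2"
      unfolding norm_ell2_power2[of f] by (rule l2_finite_sumsI(2)) (rule fin)
    also have "\<dots> = (sqrt K * norm (?J f))\<^sup>2" using \<open>K > 0\<close> by (simp add: power_mult_distrib)
    finally have "norm f \<le> sqrt K * norm (?J f)" by (rule power2_le_imp_le) (use \<open>K > 0\<close> in simp)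
    then show ?thesis using \<open>K > 0\<close> by (simp add: field_simps)
  qed
  have "bij ?J"
    by (rule symmetric_bounded_below_bij[OF bounded_linear_jop _ _ low])
       (use jop_adjoint[of "complex_of_real x"] \<open>K > 0\<close> in simp_all)
  then show False using not_spectrum_half_if_bij spec by blast
qed

end

section \<open>The uniform Nevai condition\<close>

lemma jac2_cong:
  "u (k - 1) = v (k - 1) \<Longrightarrow> u k = v k \<Longrightarrow> u (k + 1) = v (k + 1) \<Longrightarrow> jac2 a b u k = jac2 a b v k"
  by (simp add: jac2_def)

lemma CD_kernel_diag: "CD_kernel a b n x x = (\<Sum>j\<le>n. (opoly a b j x)\<^sup>2)"
  by (simp add: CD_kernel_def power2_eq_square)

lemma opoly_power2_le_CD_kernel: "j \<le> n \<Longrightarrow> (opoly a b j x)\<^sup>2 \<le> CD_kernel a b n x x"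
  unfolding CD_kernel_diag by (rule member_le_sum) auto

lemma CD_kernel_ge_1: "1 \<le> CD_kernel a b n x x"
  using opoly_power2_le_CD_kernel[of 0 n a b x] by simp

lemma sum_phat_le_CD_kernel:
  assumes "finite F" "F \<subseteq> {..int n + 1}"
  shows "(\<Sum>i\<in>F. (phat a b x i)\<^sup>2) \<le> CD_kernel a b n x x"
proof -
  have inj: "inj_on (\<lambda>i. nat i - 1) (F \<inter> {1..})" by (auto simp: inj_on_def)
  have "(\<Sum>i\<in>F. (phat a b x i)\<^sup>2) = (\<Sum>i\<in>F \<inter> {1..}. (opoly a b (nat i - 1) x)\<^sup>2)"
    using assms(1) by (subst sum.inter_restrict) (auto intro!: sum.cong simp: phat_def)
  also have "\<dots> = (\<Sum>j\<in>(\<lambda>i. nat i - 1) ` (F \<inter> {1..}). (opoly a b j x)\<^sup>2)"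
    by (simp only: sum.reindex[OF inj] o_def)
  also have "\<dots> \<le> (\<Sum>j\<le>n. (opoly a b j x)\<^sup>2)"
    using assms(2) by (intro sum_mono2) auto
  finally show ?thesis by (simp add: CD_kernel_diag)
qed

lemma jac2_phat_translate:
  assumes "\<forall>n\<ge>1. a n > 0"
  shows "jac2 (\<lambda>n. ext_a a (m + n)) (\<lambda>n. ext_b \<beta> b (m + n)) (\<lambda>n. complex_of_real (phat a b x (m + n) / P)) k
    = complex_of_real x * complex_of_real (phat a b x (m + k) / P)"
  using jac2_phat[OF assms, of \<beta> b x "m + k"] unfolding jac2_translate of_real_divide jac2_divide by simp

context half_jacobi
begin

lemma ratio_sequence_impossible:
  fixes n :: "nat \<Rightarrow> nat" and x :: "nat \<Rightarrow> real"
  assumes apos: "\<forall>n\<ge>1. a n > 0" and gap: "finite_gap_set e" and nev: "nevai_class e a b"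
    and "\<eta> > 0" and nj: "\<And>j. n j \<ge> j" and xs: "\<And>j. complex_of_real (x j) \<in> spectrum_half a b"
    and big: "\<And>j. \<eta> * CD_kernel a b (n j) (x j) (x j) < (opoly a b (n j) (x j))\<^sup>2"
  shows False
proof -
  \<comment> \<open>The polynomial of degree \<open>n\<close> sits at site
    \<open>n + 1\<close>.\<close>
  define m where "m j = n j + 1" for j
  define P where "P j = opoly a b (n j) (x j)" for j
  \<comment> \<open>Cut off to the right of 0, because \<open>big\<close> controls only degrees up
    to \<open>n j\<close>; the equation is then available for \<open>k \<le> - 1\<close>.\<close>
  define V where "V j k = (if k \<le> 0 then phat a b (x j) (int (m j) + k) / P j else 0)" for j k
  have CDP: "CD_kernel a b (n j) (x j) (x j) < (P j)\<^sup>2 / \<eta>" for j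
    using big[of j] \<open>\<eta> > 0\<close> by (simp add: P_def field_simps)
  have "(P j)\<^sup>2 > 0" for j
  proof -
    have "0 < (P j)\<^sup>2 / \<eta>" using CDP[of j] CD_kernel_ge_1[of a b "n j" "x j"] by linarith
    then show ?thesis using \<open>\<eta> > 0\<close> by (simp add: zero_less_divide_iff)
  qed
  then have P0: "P j \<noteq> 0" for j by (metis power2_eq_square mult_zero_left less_irrefl)
  have Vsum: "(\<Sum>k\<in>F. (V j k)\<^sup>2) \<le> 1 / \<eta>" if "finite F" for F j
  proof -
    let ?F = "F \<inter> {..0}"
    have "(\<Sum>k\<in>F. (V j k)\<^sup>2) = (\<Sum>k\<in>?F. (phat a b (x j) (int (m j) + k) / P j)\<^sup>2)"
      using that by (subst sum.inter_restrict) (auto intro!: sum.cong simp: V_def)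
    also have "\<dots> = (\<Sum>k\<in>?F. (phat a b (x j) (int (m j) + k))\<^sup>2) / (P j)\<^sup>2"
      by (simp add: power_divide sum_divide_distrib)
    also have "(\<Sum>k\<in>?F. (phat a b (x j) (int (m j) + k))\<^sup>2) = (\<Sum>i\<in>(\<lambda>k. int (m j) + k) ` ?F. (phat a b (x j) i)\<^sup>2)"
      by (subst sum.reindex) (auto simp: inj_on_def)
    also have "\<dots> / (P j)\<^sup>2 \<le> CD_kernel a b (n j) (x j) (x j) / (P j)\<^sup>2"
      using that by (intro divide_right_mono sum_phat_le_CD_kernel) (auto simp: m_def)
    also have "\<dots> \<le> ((P j)\<^sup>2 / \<eta>) / (P j)\<^sup>2" using CDP[of j] by (intro divide_right_mono) auto
    also have "\<dots> = 1 / \<eta>" using P0[of j] by simp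
    finally show ?thesis .
  qed
  have V1: "\<bar>V j k\<bar> \<le> sqrt (1 / \<eta>)" for j k
    using Vsum[of "{k}" j] by (simp add: real_le_rsqrt)
  have V0: "V j 0 = 1" for j
    using P0[of j] phat_Suc[of a b "x j" "n j"] by (simp add: V_def m_def P_def add.commute)
  \<comment> \<open>One constant for both compactness arguments: \<open>M\<close> for the
    coefficients, \<open>3 * M\<close> for the energies, \<open>sqrt (1 / \<eta>)\<close> for
    \<open>V\<close>, the last two for the later family \<open>V'\<close>.\<close>
  define C where "C = max (max M (3 * M)) (max (sqrt (1 / \<eta>)) (max 2 (2 * sqrt (1 / \<eta>))))"
  have M3: "M \<le> C" "3 * M \<le> C" "sqrt (1 / \<eta>) \<le> C" "2 \<le> C" "2 * sqrt (1 / \<eta>) \<le> C" by (auto simp: C_def)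
  have bda: "\<bar>a i\<bar> \<le> C" and bdb: "\<bar>b i\<bar> \<le> C" for i
    using a_le[of i] b_le[of i] M3(1) by linarith+
  have bdx: "\<bar>x j\<bar> \<le> C" for j
    using spectrum_half_bounded[OF xs[of j]] M3(2) by linarith
  have bdV: "norm (complex_of_real (V j k)) \<le> C" for j k
    using V1[of j k] M3(3) by simp
  have mtop: "filterlim m at_top sequentially"
    by (rule filterlim_at_top_mono[OF filterlim_ident]) (simp add: m_def nj le_SucI)
  have res: "(\<lambda>j. jac2 (\<lambda>i. ext_a a (int (m j) + i)) (\<lambda>i. ext_b 0 b (int (m j) + i)) (\<lambda>k. complex_of_real (V j k)) k
      - complex_of_real (x j) * complex_of_real (V j k)) \<longlonglongrightarrow> 0" if "k \<le> - 1" for k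
  proof -
    have "jac2 (\<lambda>i. ext_a a (int (m j) + i)) (\<lambda>i. ext_b 0 b (int (m j) + i)) (\<lambda>k. complex_of_real (V j k)) k
        = jac2 (\<lambda>i. ext_a a (int (m j) + i)) (\<lambda>i. ext_b 0 b (int (m j) + i))
            (\<lambda>k. complex_of_real (phat a b (x j) (int (m j) + k) / P j)) k" for j
      using that by (intro jac2_cong) (auto simp: V_def)
    then show ?thesis unfolding jac2_phat_translate[OF apos] using that by (simp add: V_def)
  qed
  obtain r ar br \<xi> w where r: "strict_mono r" and rl: "right_limit a b ar br" and \<xi>: "(\<lambda>j. x (r j)) \<longlonglongrightarrow> \<xi>"
    and w: "\<And>k. (\<lambda>j. complex_of_real (V (r j) k)) \<longlonglongrightarrow> w k"
    and sol: "\<And>k. k \<le> - 1 \<Longrightarrow> jac2 ar br w k = complex_of_real \<xi> * w k"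
  proof -
    show thesis
      by (rule right_limit_solution[of a C b x "\<lambda>j k. complex_of_real (V j k)" m "\<lambda>k. k \<le> - 1" 0,
            OF bda bdb bdx bdV mtop res]) (assumption, rule that)
  qed
  show False
  proof (cases "\<xi> \<in> e")
    case True
    define u where "u k = Re (w k)" for k
    have Vu: "(\<lambda>j. V (r j) k) \<longlonglongrightarrow> u k" for k
      using tendsto_Re[OF w[of k]] by (simp add: u_def)
    have wu: "w k = complex_of_real (u k)" for k
      using LIMSEQ_unique[OF w[of k] tendsto_of_real[OF Vu[of k]]] .
    have u0: "u 0 = 1" using Vu[of 0] by (simp add: V0 LIMSEQ_const_iff)
    have "(ar, br) \<in> isospectral_torus e" using nev rl by (simp add: nevai_class_def)
    then obtain M' where "gap_jacobi ar br M' e" and rfl: "reflectionless e ar br"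
      using isospectral_torus_gap_jacobi[OF gap] by blast
    then interpret J: gap_jacobi ar br M' e by simp
    \<comment> \<open>The cut-off lost the value at 1; it is restored so that the equation also
      holds at 0.\<close>
    define u' where "u' = u(1 := ((\<xi> - br 0) * u 0 - ar (-1) * u (-1)) / ar 0)"
    have same: "u' k = u k" if "k \<le> 0" for k using that by (auto simp: u'_def)
    show False
    proof (rule J.no_left_l2_solution[OF gap rfl True, of u' "1 / \<eta>"])
      show "jac2 ar br (\<lambda>k. complex_of_real (u' k)) k = complex_of_real (\<xi> * u' k)" if "k \<le> 0" for k
      proof (cases "k = 0")
        case True
        have "ar 0 * u' 1 = (\<xi> - br 0) * u 0 - ar (-1) * u (-1)"
          using J.a_pos[of 0] by (simp add: u'_def)
        then have "ar (-1) * u' (-1) + br 0 * u' 0 + ar 0 * u' 1 = \<xi> * u' 0"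
          by (simp add: same algebra_simps)
        from arg_cong[OF this, of complex_of_real] show ?thesis using True by (simp add: jac2_def)
      next
        case False
        then have "k \<le> - 1" using that by simp
        have "jac2 ar br (\<lambda>k. complex_of_real (u' k)) k = jac2 ar br w k"
          using \<open>k \<le> - 1\<close> by (intro jac2_cong) (auto simp: same wu)
        also have "\<dots> = complex_of_real (\<xi> * u' k)" using sol[OF \<open>k \<le> - 1\<close>] \<open>k \<le> - 1\<close> by (simp add: wu same)
        finally show ?thesis .
      qed
      show "u' 0 \<noteq> 0" using u0 by (simp add: same)
      fix F :: "int set" assume F: "finite F" "F \<subseteq> {..0}"
      have "(\<Sum>k\<in>F. (u k)\<^sup>2) \<le> 1 / \<eta>"
      proof (rule tendsto_upperbound)
        show "(\<lambda>j. \<Sum>k\<in>F. (V (r j) k)\<^sup>2) \<longlonglongrightarrow> (\<Sum>k\<in>F. (u k)\<^sup>2)" by (intro tendsto_intros Vu)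
      qed (simp_all add: Vsum[OF F(1)])
      moreover have "(\<Sum>k\<in>F. (u' k)\<^sup>2) = (\<Sum>k\<in>F. (u k)\<^sup>2)"
        by (rule sum.cong) (use F same in auto)
      ultimately show "(\<Sum>k\<in>F. (u' k)\<^sup>2) \<le> 1 / \<eta>" by simp
    qed
  next
    case False
    have "open (- e)" using finite_gap_set_closed[OF gap] by (simp add: open_Compl)
    then have "\<forall>\<^sub>F j in sequentially. x (r j) \<in> - e"
      using \<xi> False by (intro topological_tendstoD) auto
    then obtain J where J: "\<And>j. j \<ge> J \<Longrightarrow> x (r j) \<notin> e" by (auto simp: eventually_sequentially)
    define r' where "r' j = r (j + J)" for j
    have r'j: "r' j \<ge> j" for j
      using seq_suble[OF r, of "j + J"] by (simp add: r'_def)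
    \<comment> \<open>The factor 2 replaces a maximum, which a bounded sequence need not attain.
      Searching from \<open>n (r' j)\<close> on keeps the indices going to infinity.\<close>
    have ex: "\<exists>N\<ge>n (r' j). \<forall>k\<ge>n (r' j). \<bar>opoly a b k (x (r' j))\<bar> \<le> 2 * \<bar>opoly a b N (x (r' j))\<bar>" for j
    proof -
      define y where "y = x (r' j)"
      define S where "S = (\<lambda>k. \<bar>opoly a b k y\<bar>) ` {n (r' j)..}"
      have "y \<notin> e" using J[of "j + J"] by (simp add: y_def r'_def)
      then obtain B where "\<And>k. \<bar>opoly a b k y\<bar> \<le> B"
        using opoly_bounded_off_bands[OF apos gap nev _ xs[of "r' j"]] unfolding y_def by blast
      then have bdd: "bdd_above S" unfolding S_def by (auto intro!: bdd_aboveI)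
      have "\<bar>P (r' j)\<bar> \<in> S" by (auto simp: S_def P_def y_def)
      then have "\<bar>P (r' j)\<bar> \<le> Sup S" using bdd by (rule cSup_upper)
      then have "Sup S > 0" using P0[of "r' j"] by linarith
      then have "Sup S / 2 < Sup S" by simp
      then obtain s where "s \<in> S" "Sup S / 2 < s" using less_cSup_iff[of S "Sup S / 2"] \<open>\<bar>P (r' j)\<bar> \<in> S\<close> bdd by blast
      then obtain N where N: "N \<ge> n (r' j)" "Sup S / 2 < \<bar>opoly a b N y\<bar>" by (auto simp: S_def)
      have "\<bar>opoly a b k y\<bar> \<le> 2 * \<bar>opoly a b N y\<bar>" if "k \<ge> n (r' j)" for k
      proof -
        have "\<bar>opoly a b k y\<bar> \<le> Sup S" using that bdd by (intro cSup_upper) (auto simp: S_def)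
        then show ?thesis using N(2) by linarith
      qed
      then show ?thesis using N(1) unfolding y_def by blast
    qed
    then obtain N where N: "\<And>j. N j \<ge> n (r' j)"
      "\<And>j k. k \<ge> n (r' j) \<Longrightarrow> \<bar>opoly a b k (x (r' j))\<bar> \<le> 2 * \<bar>opoly a b (N j) (x (r' j))\<bar>" by metis
    define y where "y j = x (r' j)" for j
    define Q where "Q j = opoly a b (N j) (y j)" for j
    define m' where "m' j = N j + 1" for j
    define V' where "V' j k = phat a b (y j) (int (m' j) + k) / Q j" for j k
    have PQ: "\<bar>P (r' j)\<bar> \<le> 2 * \<bar>Q j\<bar>" for j
      using N(2)[of j "n (r' j)"] by (simp add: P_def Q_def y_def)
    have Q0: "Q j \<noteq> 0" for j using PQ[of j] P0[of "r' j"] by auto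
    \<comment> \<open>Degrees below \<open>n (r' j)\<close> are controlled by the kernel, through
      \<open>p_k^2 \<le> K \<le> P^2 / \<eta>\<close> and \<open>|P| \<le> 2 |Q|\<close>; the others
      by the choice of \<open>N\<close>.\<close>
    have small: "\<bar>opoly a b k (y j)\<bar> \<le> C * \<bar>Q j\<bar>" for j k
    proof (cases "k \<ge> n (r' j)")
      case True
      then have "\<bar>opoly a b k (y j)\<bar> \<le> 2 * \<bar>Q j\<bar>" using N(2) by (simp add: Q_def y_def)
      also have "\<dots> \<le> C * \<bar>Q j\<bar>" using M3(4) by (intro mult_right_mono) auto
      finally show ?thesis .
    next
      case False
      have "(opoly a b k (y j))\<^sup>2 \<le> (P (r' j))\<^sup>2 / \<eta>"
        using opoly_power2_le_CD_kernel[of k "n (r' j)" a b "y j"] CDP[of "r' j"] False by (simp add: y_def)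
      then have "sqrt ((opoly a b k (y j))\<^sup>2) \<le> sqrt ((P (r' j))\<^sup>2 / \<eta>)" by (rule real_sqrt_le_mono)
      then have "\<bar>opoly a b k (y j)\<bar> \<le> sqrt (1 / \<eta>) * \<bar>P (r' j)\<bar>" by (simp add: real_sqrt_divide)
      also have "\<dots> \<le> sqrt (1 / \<eta>) * (2 * \<bar>Q j\<bar>)" using PQ[of j] \<open>\<eta> > 0\<close> by (intro mult_left_mono) auto
      also have "\<dots> = (2 * sqrt (1 / \<eta>)) * \<bar>Q j\<bar>" by simp
      also have "\<dots> \<le> C * \<bar>Q j\<bar>" using M3(5) by (intro mult_right_mono) auto
      finally show ?thesis .
    qed
    have bdV': "norm (complex_of_real (V' j k)) \<le> C" for j k
    proof -
      have "C \<ge> 0" using M3(4) by simp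
      then have "\<bar>phat a b (y j) i\<bar> \<le> C * \<bar>Q j\<bar>" for i using small[of "nat i - 1" j] by (simp add: phat_def)
      then have "\<bar>phat a b (y j) (int (m' j) + k)\<bar> / \<bar>Q j\<bar> \<le> C"
        using Q0[of j] by (simp add: pos_divide_le_eq)
      then show ?thesis unfolding norm_of_real V'_def abs_divide .
    qed
    have bdy: "\<bar>y j\<bar> \<le> C" for j unfolding y_def by (rule bdx)
    have m'top: "filterlim m' at_top sequentially"
    proof (rule filterlim_at_top_mono[OF filterlim_ident], rule always_eventually, rule allI)
      fix j show "j \<le> m' j" using r'j[of j] nj[of "r' j"] N(1)[of j] by (simp add: m'_def)
    qed
    have res': "(\<lambda>j. jac2 (\<lambda>i. ext_a a (int (m' j) + i)) (\<lambda>i. ext_b 0 b (int (m' j) + i)) (\<lambda>k. complex_of_real (V' j k)) k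
      - complex_of_real (y j) * complex_of_real (V' j k)) \<longlonglongrightarrow> 0" for k
      unfolding V'_def jac2_phat_translate[OF apos] by simp
    obtain s ar' br' \<xi>' w' where s: "strict_mono s" and rl': "right_limit a b ar' br'" and \<xi>': "(\<lambda>j. y (s j)) \<longlonglongrightarrow> \<xi>'"
      and w': "\<And>k. (\<lambda>j. complex_of_real (V' (s j) k)) \<longlonglongrightarrow> w' k"
      and sol': "\<And>k. jac2 ar' br' w' k = complex_of_real \<xi>' * w' k"
    proof -
      show thesis
        by (rule right_limit_solution[of a C b y "\<lambda>j k. complex_of_real (V' j k)" m' "\<lambda>k. True" 0,
              OF bda bdb bdy bdV' m'top res']) (rule that, simp_all)
    qed
    \<comment> \<open>The second extraction runs along the same energies, so its limit energy is
      again off the bands.\<close>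
    have "y \<longlonglongrightarrow> \<xi>" unfolding y_def r'_def using LIMSEQ_ignore_initial_segment[OF \<xi>, of J] .
    then have "(\<lambda>j. y (s j)) \<longlonglongrightarrow> \<xi>" using LIMSEQ_subseq_LIMSEQ[OF _ s] by (auto simp: o_def)
    then have "\<xi>' = \<xi>" using \<xi>' LIMSEQ_unique by blast
    have V'0: "V' j 0 = 1" for j
      using Q0[of j] phat_Suc[of a b "y j" "N j"] by (simp add: V'_def m'_def Q_def add.commute)
    have "w' 0 = 1" using w'[of 0] by (simp add: V'0 LIMSEQ_const_iff)
    moreover have "norm (w' k) \<le> C" for k
      by (rule tendsto_upperbound[OF tendsto_norm[OF w'[of k]]]) (use bdV' in simp_all)
    then have "w' 0 = 0"
      using no_bounded_solution_off_spectrum[OF gap nev rl' False, of w' C 0] sol' \<open>\<xi>' = \<xi>\<close> by blast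
    ultimately show False by simp
  qed
qed

end

theorem theorem8p2:
  fixes e :: "real set" and a b :: "nat \<Rightarrow> real"
  assumes "finite_gap_set e"
    and "\<forall>n\<ge>1. a n > 0"
    and "bounded (range a)" and "bounded (range b)"
    and "nevai_class e a b"
  shows "(\<lambda>n. SUP x0 \<in> {x. complex_of_real x \<in> spectrum_half a b}.
              (opoly a b n x0)\<^sup>2 / CD_kernel a b n x0 x0) \<longlonglongrightarrow> 0"
proof -
  obtain M1 where M1: "\<And>n. \<bar>a n\<bar> \<le> M1" using assms(3) by (force simp: bounded_iff)
  obtain M2 where M2: "\<And>n. \<bar>b n\<bar> \<le> M2" using assms(4) by (force simp: bounded_iff)
  interpret half_jacobi a b "max M1 M2"
    by unfold_locales (use M1 M2 in \<open>auto simp: le_max_iff_disj\<close>)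
  define S where "S = {x. complex_of_real x \<in> spectrum_half a b}"
  define R where "R n x = (opoly a b n x)\<^sup>2 / CD_kernel a b n x x" for n x
  have CD0: "CD_kernel a b n x x > 0" for n x using CD_kernel_ge_1[of a b n x] by linarith
  have R0: "0 \<le> R n x" and R1: "R n x \<le> 1" for n x
    using CD0[of n x] opoly_power2_le_CD_kernel[of n n a b x] by (auto simp: R_def pos_divide_le_eq)
  \<comment> \<open>A spectral point makes the supremum nonnegative, so failure of convergence means
    that it is at least some \<open>eps\<close> for arbitrarily large \<open>n\<close>.\<close>
  obtain z where "z \<in> S" using spectrum_half_real_nonempty by (auto simp: S_def)
  have bdd: "bdd_above (R n ` S)" for n by (rule bdd_aboveI2[OF R1])
  have SUP0: "0 \<le> (SUP x\<in>S. R n x)" for n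
    by (rule cSUP_upper2[OF bdd \<open>z \<in> S\<close> R0])
  have "(\<lambda>n. SUP x\<in>S. R n x) \<longlonglongrightarrow> 0"
  proof (rule ccontr)
    assume "\<not> ?thesis"
    then obtain eps where "eps > 0" and eps: "\<And>N. \<exists>n\<ge>N. eps \<le> (SUP x\<in>S. R n x)"
      unfolding LIMSEQ_iff using SUP0 by (auto simp: not_less)
    have "\<exists>n x. n \<ge> N \<and> x \<in> S \<and> eps / 2 < R n x" for N
    proof -
      obtain n where n: "n \<ge> N" "eps \<le> (SUP x\<in>S. R n x)" using eps by blast
      then have "eps / 2 < (SUP x\<in>S. R n x)" using \<open>eps > 0\<close> by linarith
      then show ?thesis using less_cSUP_iff[OF _ bdd[of n], of "eps / 2"] \<open>z \<in> S\<close> n(1) by auto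
    qed
    then obtain n x where nx: "\<And>j. n j \<ge> j" "\<And>j. x j \<in> S" "\<And>j. eps / 2 < R (n j) (x j)" by metis
    show False
    proof (rule ratio_sequence_impossible[OF assms(2) assms(1) assms(5), of "eps / 2" n x])
      show "eps / 2 * CD_kernel a b (n j) (x j) (x j) < (opoly a b (n j) (x j))\<^sup>2" for j
        using nx(3)[of j] CD0[of "n j" "x j"] by (simp add: R_def pos_less_divide_eq)
    qed (use nx \<open>eps > 0\<close> in \<open>auto simp: S_def\<close>)
  qed
  then show ?thesis by (simp add: S_def R_def)
qed

end
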